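(* Let $G$ be a topological group and $X$ a compact $G$-system. Consider the following conditions: (a) $X$ is HNS (equivalently, $\mathrm{RN}_{app}$). (b) $\breve{G}:=\{\breve g:X\to X\}_{g\in G}$ is a fragmented family. (c) $E(X)=\{p:X\to X\}_{p\in E(X)}$ is a fragmented family. (d) $(G,E(X))$ is HNS (equivalently, $\mathrm{RN}_{app}$). (e) $E(X)$ is an $\mathcal F$-semigroup. Then: (1) Always, $(a)\Leftrightarrow(b)\Leftrightarrow(c)\Rightarrow(d)\Leftrightarrow(e)$. (2) If $X$ is point transitive (i.e. some orbit is dense in $X$), then $(a)\Leftrightarrow(b)\Leftrightarrow(c)\Leftrightarrow(d)\Leftrightarrow(e)$.
   Context: A compact $G$-system is a compact Hausdorff space $X$ with a (jointly) continuous left action of the topological group $G$; $\breve g:X\to X$, $x\mapsto gx$. Compact spaces carry their unique compatible uniform structure. The enveloping semigroup $E(X)$ is the closure of $\{\breve g:g\in G\}$ in $X^X$ with the pointwise convergence topology; it is a semigroup under composition, and a compact $G$-system under $gp=\breve g\circ p$. A uniform $G$-space $(Y,\mu)$ is not sensitive (NS) if for every $\varepsilon\in\mu$ there is a nonempty open $O\subset Y$ with $(gx,gy)\in\varepsilon$ for all $x,y\in O$, $g\in G$. $X$ is hereditarily not sensitive (HNS) if every nonempty closed $G$-invariant subspace is NS. RN and $\mathrm{RN}_{app}$: a Banach space $V$ is Asplund if every separable Banach subspace has separable dual. $\mathrm{Iso}(V)$ is the group of linear isometries of $V$ onto itself. A compact $G$-system $X$ is Radon-Nikodým (RN) if there exist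 an Asplund space $V$, a strongly continuous co-homomorphism $h:G\to\mathrm{Iso}(V)$ (i.e. $h(gg')=h(g')h(g)$, and $g\mapsto h(g)v$ is norm continuous for each $v$), and a bounded topological embedding $\alpha:X\to(V^*,\text{weak}^* )$ with $\alpha(gx)=g\alpha(x)$, where $(g\varphi)(v)=\varphi(h(g)(v))$. $X$ is $\mathrm{RN}_{app}$ if it is isomorphic to a $G$-subsystem of a product of RN $G$-systems. A family $\mathcal F$ of maps from a topological space $X$ to a uniform space $(Y,\mu)$ is fragmented if for every nonempty $A\subset X$ and $\varepsilon\in\mu$ there is an open $O\subset X$ with $O\cap A\ne\emptyset$ such that $f(O\cap A)\times f(O\cap A)\subset\varepsilon$ for every $f\in\mathcal F$ simultaneously. A compact right topological semigroup $S$ (each map $s\mapsto sp$ is continuous) is an $\mathcal F$-semigroup if the family of maps $\{\lambda_p:S\to S\}_{p\in S}$, $\lambda_p(s)=ps$, is a fragmented family. *)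

theory Defs
  imports "HOL-Analysis.Analysis" "HOL-Library.Function_Algebras"
begin

section \<open>Uniform structures on compact spaces\<close>

definition uniform_structure :: "'a set \<Rightarrow> ('a \<times> 'a) set set \<Rightarrow> bool" where
  "uniform_structure S \<mu> \<longleftrightarrow>
     S \<times> S \<in> \<mu> \<and>
     (\<forall>\<epsilon>\<in>\<mu>. Id_on S \<subseteq> \<epsilon> \<and> \<epsilon> \<subseteq> S \<times> S) \<and>
     (\<forall>\<epsilon>\<in>\<mu>. \<forall>\<delta>. \<epsilon> \<subseteq> \<delta> \<and> \<delta> \<subseteq> S \<times> S \<longrightarrow> \<delta> \<in> \<mu>) \<and>
     (\<forall>\<epsilon>\<in>\<mu>. \<forall>\<delta>\<in>\<mu>. \<epsilon> \<inter> \<delta> \<in> \<mu>) \<and>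
     (\<forall>\<epsilon>\<in>\<mu>. \<epsilon>\<inverse> \<in> \<mu>) \<and>
     (\<forall>\<epsilon>\<in>\<mu>. \<exists>\<delta>\<in>\<mu>. \<delta> O \<delta> \<subseteq> \<epsilon>)"

definition compatible_uniformity :: "'a topology \<Rightarrow> ('a \<times> 'a) set set \<Rightarrow> bool" where
  "compatible_uniformity X \<mu> \<longleftrightarrow>
     uniform_structure (topspace X) \<mu> \<and>
     (\<forall>U. openin X U \<longleftrightarrow> U \<subseteq> topspace X \<and> (\<forall>x\<in>U. \<exists>\<epsilon>\<in>\<mu>. \<epsilon> `` {x} \<subseteq> U))"

text \<open>Meaningful for compact Hausdorff \<open>X\<close> only; see \<open>compatible_uniformity_unique\<close> and
  \<open>compact_uniformity_eq\<close> below.\<close>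

definition compact_uniformity :: "'a topology \<Rightarrow> ('a \<times> 'a) set set" where
  "compact_uniformity X = (THE \<mu>. compatible_uniformity X \<mu>)"

definition diagonal_nhds :: "'a topology \<Rightarrow> ('a \<times> 'a) set set" where
  "diagonal_nhds X =
     {\<epsilon>. \<epsilon> \<subseteq> topspace X \<times> topspace X \<and>
          (\<exists>U. openin (prod_topology X X) U \<and> Id_on (topspace X) \<subseteq> U \<and> U \<subseteq> \<epsilon>)}"

lemma uniform_structureD:
  assumes "uniform_structure S \<mu>"
  shows "S \<times> S \<in> \<mu>"
    and "\<epsilon> \<in> \<mu> \<Longrightarrow> Id_on S \<subseteq> \<epsilon> \<and> \<epsilon> \<subseteq> S \<times> S"
    and "\<epsilon> \<in> \<mu> \<Longrightarrow> \<epsilon> \<subseteq> \<delta> \<Longrightarrow> \<delta> \<subseteq> S \<times> S \<Longrightarrow> \<delta> \<in> \<mu>"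
    and "\<epsilon> \<in> \<mu> \<Longrightarrow> \<delta> \<in> \<mu> \<Longrightarrow> \<epsilon> \<inter> \<delta> \<in> \<mu>"
    and "\<epsilon> \<in> \<mu> \<Longrightarrow> \<epsilon>\<inverse> \<in> \<mu>"
    and "\<epsilon> \<in> \<mu> \<Longrightarrow> \<exists>\<delta>\<in>\<mu>. \<delta> O \<delta> \<subseteq> \<epsilon>"
proof -
  note c1 = assms[unfolded uniform_structure_def]
  note c2 = c1[THEN conjunct2]
  note c3 = c2[THEN conjunct2]
  note c4 = c3[THEN conjunct2]
  note c5 = c4[THEN conjunct2]
  show "S \<times> S \<in> \<mu>" by (rule c1[THEN conjunct1])
  show "\<epsilon> \<in> \<mu> \<Longrightarrow> Id_on S \<subseteq> \<epsilon> \<and> \<epsilon> \<subseteq> S \<times> S" by (rule c2[THEN conjunct1, THEN bspec])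
  show "\<epsilon> \<in> \<mu> \<Longrightarrow> \<epsilon> \<subseteq> \<delta> \<Longrightarrow> \<delta> \<subseteq> S \<times> S \<Longrightarrow> \<delta> \<in> \<mu>"
    by (rule c3[THEN conjunct1, THEN bspec, THEN spec, THEN mp, OF _ conjI])
  show "\<epsilon> \<in> \<mu> \<Longrightarrow> \<delta> \<in> \<mu> \<Longrightarrow> \<epsilon> \<inter> \<delta> \<in> \<mu>"
    by (rule c4[THEN conjunct1, THEN bspec, THEN bspec])
  show "\<epsilon> \<in> \<mu> \<Longrightarrow> \<epsilon>\<inverse> \<in> \<mu>" by (rule c5[THEN conjunct1, THEN bspec])
  show "\<epsilon> \<in> \<mu> \<Longrightarrow> \<exists>\<delta>\<in>\<mu>. \<delta> O \<delta> \<subseteq> \<epsilon>" by (rule c5[THEN conjunct2, THEN bspec])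
qed

lemma compatible_uniformityD:
  assumes "compatible_uniformity X \<mu>"
  shows "uniform_structure (topspace X) \<mu>"
    and "openin X U \<longleftrightarrow> U \<subseteq> topspace X \<and> (\<forall>x\<in>U. \<exists>\<epsilon>\<in>\<mu>. \<epsilon> `` {x} \<subseteq> U)"
  by (rule assms[unfolded compatible_uniformity_def, THEN conjunct1])
    (rule assms[unfolded compatible_uniformity_def, THEN conjunct2, THEN spec])

lemma diagonal_open_half:
  assumes "compact_space X" "Hausdorff_space X"
    and U: "openin (prod_topology X X) U" "Id_on (topspace X) \<subseteq> U"
  shows "\<exists>V. openin (prod_topology X X) V \<and> Id_on (topspace X) \<subseteq> V \<and> V O V \<subseteq> U"
proof -
  let ?S = "topspace X"
  have reg: "regular_space X"
    using assms(1,2) by (simp add: compact_Hausdorff_imp_regular_space)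
  have "\<exists>A B. openin X A \<and> openin X B \<and> x \<in> B \<and> X closure_of B \<subseteq> A \<and> A \<times> A \<subseteq> U"
    if x: "x \<in> ?S" for x
  proof -
    have "(x,x) \<in> U" using U x by auto
    then obtain P Q where PQ: "openin X P" "openin X Q" "x \<in> P" "x \<in> Q" "P \<times> Q \<subseteq> U"
      using U(1) unfolding openin_prod_topology_alt by meson
    have A: "openin X (P \<inter> Q)" using PQ by blast
    have "closedin X (?S - (P \<inter> Q))" using A by blast
    moreover have "x \<in> ?S - (?S - (P \<inter> Q))" using x PQ by auto
    ultimately obtain B where B: "openin X B" "x \<in> B" "disjnt (?S - (P \<inter> Q)) (X closure_of B)"
      using reg unfolding regular_space by meson
    moreover have "X closure_of B \<subseteq> P \<inter> Q"
      using B(3) closure_of_subset_topspace[of X B] by (auto simp: disjnt_iff)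
    moreover have "(P \<inter> Q) \<times> (P \<inter> Q) \<subseteq> U" using PQ(5) by blast
    ultimately show ?thesis using A B(1,2) by blast
  qed
  then obtain A B where AB: "\<And>x. x \<in> ?S \<Longrightarrow> openin X (A x) \<and> openin X (B x) \<and> x \<in> B x
      \<and> X closure_of (B x) \<subseteq> A x \<and> A x \<times> A x \<subseteq> U"
    by metis
  obtain F where F: "finite F" "F \<subseteq> B ` ?S" "?S \<subseteq> \<Union>F"
  proof -
    have "(\<forall>W \<in> B ` ?S. openin X W) \<and> ?S \<subseteq> \<Union>(B ` ?S)" using AB by auto
    with assms(1) show ?thesis using that unfolding compact_space_alt by meson
  qed
  then obtain I where I: "finite I" "I \<subseteq> ?S" "F = B ` I"
    by (meson finite_subset_image)
  define W where "W i = (A i \<times> A i) \<union> ((?S - X closure_of B i) \<times> (?S - X closure_of B i))" for i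
  define V where "V = (?S \<times> ?S) \<inter> (\<Inter>i\<in>I. W i)"
  have opW: "openin (prod_topology X X) (W i)" if "i \<in> I" for i
  proof -
    have "openin X (A i)" using AB I(2) that by blast
    moreover have "openin X (?S - X closure_of B i)" by (simp add: openin_diff)
    ultimately show ?thesis
      unfolding W_def by (intro openin_Un) (simp_all add: openin_prod_Times_iff)
  qed
  have "openin (prod_topology X X) V"
  proof (cases "I = {}")
    case True then show ?thesis unfolding V_def
      by (simp add: openin_prod_Times_iff)
  next
    case False
    have "openin (prod_topology X X) (\<Inter>i\<in>I. W i)"
      using False opW I by (intro openin_INT2) auto
    then show ?thesis unfolding V_def
      by (intro openin_Int) (simp add: openin_prod_Times_iff)
  qed
  moreover have "Id_on ?S \<subseteq> V"
  proof
    fix p assume "p \<in> Id_on ?S"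
    then obtain y where y: "y \<in> ?S" "p = (y,y)" by (rule Id_onE)
    have "(y,y) \<in> W i" if "i \<in> I" for i
    proof -
      have "X closure_of B i \<subseteq> A i" using AB I(2) that by blast
      then show ?thesis using y(1) unfolding W_def by blast
    qed
    then show "p \<in> V" using y unfolding V_def by simp
  qed
  moreover have "V O V \<subseteq> U"
  proof clarify
    fix x y z assume xy: "(x,y) \<in> V" and yz: "(y,z) \<in> V"
    have y: "y \<in> ?S" using xy unfolding V_def by auto
    then obtain i where i: "i \<in> I" "y \<in> B i" using F I by auto
    have "B i \<subseteq> X closure_of B i" using AB I i by (meson closure_of_subset openin_subset subsetD)
    then have "y \<in> X closure_of B i" using i by auto
    moreover have "(x,y) \<in> W i" "(y,z) \<in> W i" using xy yz i unfolding V_def by auto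
    ultimately have "(x,z) \<in> A i \<times> A i" unfolding W_def by auto
    then show "(x,z) \<in> U" using AB I i by blast
  qed
  ultimately show ?thesis by blast
qed

lemma compatible_diagonal_nhds:
  assumes "compact_space X" "Hausdorff_space X"
  shows "compatible_uniformity X (diagonal_nhds X)"
proof -
  let ?S = "topspace X"
  let ?P = "prod_topology X X"
  have 1: "?S \<times> ?S \<in> diagonal_nhds X"
    unfolding diagonal_nhds_def by (auto intro!: exI[of _ "?S \<times> ?S"] simp: openin_prod_Times_iff)
  have 2: "\<epsilon> \<inter> \<delta> \<in> diagonal_nhds X" if "\<epsilon> \<in> diagonal_nhds X" "\<delta> \<in> diagonal_nhds X" for \<epsilon> \<delta>
  proof -
    obtain U V where "openin ?P U" "Id_on ?S \<subseteq> U" "U \<subseteq> \<epsilon>" "openin ?P V" "Id_on ?S \<subseteq> V" "V \<subseteq> \<delta>"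
      using \<open>\<epsilon> \<in> diagonal_nhds X\<close> \<open>\<delta> \<in> diagonal_nhds X\<close> unfolding diagonal_nhds_def by blast
    then have "openin ?P (U \<inter> V) \<and> Id_on ?S \<subseteq> U \<inter> V \<and> U \<inter> V \<subseteq> \<epsilon> \<inter> \<delta>" by auto
    then show ?thesis using that unfolding diagonal_nhds_def by blast
  qed
  have 3: "\<epsilon>\<inverse> \<in> diagonal_nhds X" if \<epsilon>: "\<epsilon> \<in> diagonal_nhds X" for \<epsilon>
  proof -
    obtain U where U: "openin ?P U" "Id_on ?S \<subseteq> U" "U \<subseteq> \<epsilon>"
      using \<epsilon> unfolding diagonal_nhds_def by blast
    have "openin ?P (U\<inverse>)"
      unfolding openin_prod_topology_alt
    proof (intro allI impI)
      fix x y assume "(x,y) \<in> U\<inverse>"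
      then have "(y,x) \<in> U" by simp
      then obtain P Q where PQ: "openin X P" "openin X Q" "y \<in> P" "x \<in> Q" "P \<times> Q \<subseteq> U"
        using U(1) unfolding openin_prod_topology_alt by meson
      then have "Q \<times> P \<subseteq> U\<inverse>" by blast
      with PQ show "\<exists>V W. openin X V \<and> openin X W \<and> x \<in> V \<and> y \<in> W \<and> V \<times> W \<subseteq> U\<inverse>" by blast
    qed
    moreover have "Id_on ?S \<subseteq> U\<inverse>" "U\<inverse> \<subseteq> \<epsilon>\<inverse>" "\<epsilon>\<inverse> \<subseteq> ?S \<times> ?S"
      using U \<epsilon> unfolding diagonal_nhds_def by auto
    ultimately show ?thesis unfolding diagonal_nhds_def by blast
  qed
  have 4: "\<exists>\<delta>\<in>diagonal_nhds X. \<delta> O \<delta> \<subseteq> \<epsilon>" if \<epsilon>: "\<epsilon> \<in> diagonal_nhds X" for \<epsilon>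
  proof -
    obtain U where U: "openin ?P U" "Id_on ?S \<subseteq> U" "U \<subseteq> \<epsilon>"
      using \<epsilon> unfolding diagonal_nhds_def by blast
    obtain V where V: "openin ?P V" "Id_on ?S \<subseteq> V" "V O V \<subseteq> U"
      using diagonal_open_half[OF assms U(1,2)] by blast
    have "V \<subseteq> ?S \<times> ?S" using openin_subset[OF V(1)] by simp
    then have "V \<in> diagonal_nhds X" using V unfolding diagonal_nhds_def by blast
    then show ?thesis using V U by blast
  qed
  have uni: "uniform_structure ?S (diagonal_nhds X)"
    unfolding uniform_structure_def
  proof (intro conjI ballI allI impI)
    fix \<epsilon> \<delta> assume "\<epsilon> \<in> diagonal_nhds X" "\<epsilon> \<subseteq> \<delta> \<and> \<delta> \<subseteq> ?S \<times> ?S"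
    then show "\<delta> \<in> diagonal_nhds X" unfolding diagonal_nhds_def by blast
  next
    fix \<epsilon> assume "\<epsilon> \<in> diagonal_nhds X"
    then show "Id_on ?S \<subseteq> \<epsilon>" "\<epsilon> \<subseteq> ?S \<times> ?S" unfolding diagonal_nhds_def by blast+
  qed (fact 1 | erule 2 3 4 | assumption)+
  have t1: "t1_space X" using assms Hausdorff_imp_t1_space by blast
  have "openin X U \<longleftrightarrow> U \<subseteq> ?S \<and> (\<forall>x\<in>U. \<exists>\<epsilon>\<in>diagonal_nhds X. \<epsilon> `` {x} \<subseteq> U)" for U
  proof
    assume U: "openin X U"
    have "\<exists>\<epsilon>\<in>diagonal_nhds X. \<epsilon> `` {x} \<subseteq> U" if x: "x \<in> U" for x
    proof -
      have xS: "x \<in> ?S" using U x openin_subset by blast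
      let ?E = "((?S - {x}) \<times> ?S) \<union> (?S \<times> U)"
      have "openin X (?S - {x})"
        using t1 xS closedin_t1_singleton by (metis openin_diff openin_topspace)
      then have "openin ?P ?E" using U by (intro openin_Un) (auto simp: openin_prod_Times_iff)
      moreover have "Id_on ?S \<subseteq> ?E" using x by auto
      moreover have "?E \<subseteq> ?S \<times> ?S" using U openin_subset by fastforce
      ultimately have "?E \<in> diagonal_nhds X" unfolding diagonal_nhds_def by blast
      moreover have "?E `` {x} \<subseteq> U" by auto
      ultimately show ?thesis by blast
    qed
    then show "U \<subseteq> ?S \<and> (\<forall>x\<in>U. \<exists>\<epsilon>\<in>diagonal_nhds X. \<epsilon> `` {x} \<subseteq> U)"
      using U openin_subset by blast
  next
    assume R: "U \<subseteq> ?S \<and> (\<forall>x\<in>U. \<exists>\<epsilon>\<in>diagonal_nhds X. \<epsilon> `` {x} \<subseteq> U)"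
    show "openin X U"
    proof (subst openin_subopen, intro ballI)
      fix x assume x: "x \<in> U"
      then obtain \<epsilon> where \<epsilon>: "\<epsilon> \<in> diagonal_nhds X" "\<epsilon> `` {x} \<subseteq> U" using R by blast
      then obtain W where W: "openin ?P W" "Id_on ?S \<subseteq> W" "W \<subseteq> \<epsilon>"
        unfolding diagonal_nhds_def by blast
      have "(x,x) \<in> W" using W R x by auto
      then obtain P Q where "openin X P" "openin X Q" "x \<in> P" "x \<in> Q" "P \<times> Q \<subseteq> W"
        using W(1) unfolding openin_prod_topology_alt by meson
      then show "\<exists>T. openin X T \<and> x \<in> T \<and> T \<subseteq> U" using W \<epsilon> by blast
    qed
  qed
  with uni show ?thesis unfolding compatible_uniformity_def by blast
qed

lemma compatible_uniformity_interior:
  assumes \<mu>: "compatible_uniformity X \<mu>" and \<delta>: "\<delta> \<in> \<mu>" and x: "x \<in> topspace X"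
  shows "\<exists>I. openin X I \<and> x \<in> I \<and> I \<subseteq> \<delta> `` {x}"
proof -
  let ?S = "topspace X"
  note u = compatible_uniformityD(1)[OF \<mu>]
  note refl = uniform_structureD(2)[OF u]
  define I where "I = {y \<in> ?S. \<exists>\<eta>\<in>\<mu>. \<eta> `` {y} \<subseteq> \<delta> `` {x}}"
  have "\<exists>\<kappa>\<in>\<mu>. \<kappa> `` {y} \<subseteq> I" if y: "y \<in> I" for y
  proof -
    obtain \<eta> where \<eta>: "\<eta> \<in> \<mu>" "\<eta> `` {y} \<subseteq> \<delta> `` {x}" using y unfolding I_def by blast
    then obtain \<kappa> where \<kappa>: "\<kappa> \<in> \<mu>" "\<kappa> O \<kappa> \<subseteq> \<eta>" using uniform_structureD(6)[OF u] by blast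
    have "z \<in> I" if "(y,z) \<in> \<kappa>" for z
    proof -
      have "\<kappa> `` {z} \<subseteq> \<delta> `` {x}" using that \<kappa> \<eta> by blast
      moreover have "z \<in> ?S" using refl[OF \<kappa>(1)] that by blast
      ultimately show ?thesis unfolding I_def using \<kappa> by blast
    qed
    then show ?thesis using \<kappa> by blast
  qed
  moreover have "I \<subseteq> ?S" unfolding I_def by blast
  ultimately have "openin X I" using compatible_uniformityD(2)[OF \<mu>] by blast
  moreover have "x \<in> I" unfolding I_def using x \<delta> by blast
  moreover have "I \<subseteq> \<delta> `` {x}" unfolding I_def using refl by blast
  ultimately show ?thesis by blast
qed

lemma compatible_uniformity_unique:
  assumes "compact_space X" and \<mu>: "compatible_uniformity X \<mu>"
  shows "\<mu> = diagonal_nhds X"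
proof
  let ?S = "topspace X"
  let ?P = "prod_topology X X"
  note u = compatible_uniformityD(1)[OF \<mu>]
  note full = uniform_structureD(1)[OF u] and refl = uniform_structureD(2)[OF u]
    and up = uniform_structureD(3)[OF u] and inter = uniform_structureD(4)[OF u]
    and conv = uniform_structureD(5)[OF u] and half = uniform_structureD(6)[OF u]
  note interior = compatible_uniformity_interior[OF \<mu>]
  show "\<mu> \<subseteq> diagonal_nhds X"
  proof
    fix \<epsilon> assume \<epsilon>: "\<epsilon> \<in> \<mu>"
    obtain \<delta> where \<delta>: "\<delta> \<in> \<mu>" "\<delta> O \<delta> \<subseteq> \<epsilon>" using half \<epsilon> by blast
    define \<kappa> where "\<kappa> = \<delta> \<inter> \<delta>\<inverse>"
    have \<kappa>: "\<kappa> \<in> \<mu>" unfolding \<kappa>_def using \<delta> inter conv by blast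
    obtain I where I: "\<And>x. x \<in> ?S \<Longrightarrow> openin X (I x) \<and> x \<in> I x \<and> I x \<subseteq> \<kappa> `` {x}"
      using interior[OF \<kappa>] by metis
    let ?U = "\<Union>x\<in>?S. I x \<times> I x"
    have "openin ?P ?U" using I by (intro openin_Union) (auto simp: openin_prod_Times_iff)
    moreover have "Id_on ?S \<subseteq> ?U" using I by auto
    moreover have "?U \<subseteq> \<epsilon>"
    proof clarify
      fix x y z assume "x \<in> ?S" "y \<in> I x" "z \<in> I x"
      then have "(x,y) \<in> \<kappa>" "(x,z) \<in> \<kappa>" using I by blast+
      then show "(y,z) \<in> \<epsilon>" using \<delta> unfolding \<kappa>_def by blast
    qed
    ultimately show "\<epsilon> \<in> diagonal_nhds X" using refl[OF \<epsilon>] unfolding diagonal_nhds_def by blast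
  qed
  show "diagonal_nhds X \<subseteq> \<mu>"
  proof
    fix \<epsilon> assume "\<epsilon> \<in> diagonal_nhds X"
    then obtain U where U: "openin ?P U" "Id_on ?S \<subseteq> U" "U \<subseteq> \<epsilon>" and \<epsilon>: "\<epsilon> \<subseteq> ?S \<times> ?S"
      unfolding diagonal_nhds_def by blast
    have "\<exists>\<delta> I. \<delta> \<in> \<mu> \<and> openin X I \<and> x \<in> I \<and> (\<forall>y\<in>I. \<forall>z. (y,z) \<in> \<delta> \<longrightarrow> (y,z) \<in> U)"
      if x: "x \<in> ?S" for x
    proof -
      have "(x,x) \<in> U" using U x by auto
      then obtain P Q where PQ: "openin X P" "openin X Q" "x \<in> P" "x \<in> Q" "P \<times> Q \<subseteq> U"
        using U(1) unfolding openin_prod_topology_alt by meson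
      then have "openin X (P \<inter> Q)" "x \<in> P \<inter> Q" by auto
      then obtain \<eta> where \<eta>: "\<eta> \<in> \<mu>" "\<eta> `` {x} \<subseteq> P \<inter> Q"
        using compatible_uniformityD(2)[OF \<mu>] by meson
      obtain \<delta> where \<delta>: "\<delta> \<in> \<mu>" "\<delta> O \<delta> \<subseteq> \<eta>" using half \<eta> by blast
      obtain I where I: "openin X I" "x \<in> I" "I \<subseteq> \<delta> `` {x}" using interior[OF \<delta>(1) x] by blast
      have "(y,z) \<in> U" if "y \<in> I" "(y,z) \<in> \<delta>" for y z
      proof -
        have xy: "(x,y) \<in> \<delta>" using I that by blast
        then have "(y,y) \<in> \<delta>" using refl[OF \<delta>(1)] by blast
        then have "(x,y) \<in> \<eta>" "(x,z) \<in> \<eta>" using xy \<delta> that by blast+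
        then show ?thesis using \<eta> PQ by blast
      qed
      then show ?thesis using \<delta> I by blast
    qed
    then obtain \<delta> I where DI: "\<And>x. x \<in> ?S \<Longrightarrow> \<delta> x \<in> \<mu> \<and> openin X (I x) \<and> x \<in> I x
        \<and> (\<forall>y\<in>I x. \<forall>z. (y,z) \<in> \<delta> x \<longrightarrow> (y,z) \<in> U)"
      by metis
    obtain F where F: "finite F" "F \<subseteq> I ` ?S" "?S \<subseteq> \<Union>F"
    proof -
      have "(\<forall>W \<in> I ` ?S. openin X W) \<and> ?S \<subseteq> \<Union>(I ` ?S)" using DI by auto
      with assms(1) show ?thesis using that unfolding compact_space_alt by meson
    qed
    then obtain J where J: "finite J" "J \<subseteq> ?S" "F = I ` J"
      by (meson finite_subset_image)
    define \<kappa> where "\<kappa> = (?S \<times> ?S) \<inter> (\<Inter>j\<in>J. \<delta> j)"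
    have "(?S \<times> ?S) \<inter> (\<Inter>j\<in>K. \<delta> j) \<in> \<mu>" if "finite K" "K \<subseteq> ?S" for K
      using that
    proof (induction K)
      case empty then show ?case using full by simp
    next
      case (insert k K)
      then have "\<delta> k \<inter> ((?S \<times> ?S) \<inter> (\<Inter>j\<in>K. \<delta> j)) \<in> \<mu>" using inter DI by blast
      moreover have "\<delta> k \<inter> ((?S \<times> ?S) \<inter> (\<Inter>j\<in>K. \<delta> j)) = (?S \<times> ?S) \<inter> (\<Inter>j\<in>insert k K. \<delta> j)"
        by blast
      ultimately show ?case by simp
    qed
    then have "\<kappa> \<in> \<mu>" unfolding \<kappa>_def using J by blast
    moreover have "\<kappa> \<subseteq> \<epsilon>"
    proof clarify
      fix y z assume yz: "(y,z) \<in> \<kappa>"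
      then have "y \<in> ?S" unfolding \<kappa>_def by blast
      then obtain j where j: "j \<in> J" "y \<in> I j" using F J by auto
      then have "(y,z) \<in> \<delta> j" using yz unfolding \<kappa>_def by blast
      then show "(y,z) \<in> \<epsilon>" using DI j J U by blast
    qed
    ultimately show "\<epsilon> \<in> \<mu>" using up \<epsilon> by blast
  qed
qed

lemma compact_uniformity_eq:
  assumes "compact_space X" "Hausdorff_space X"
  shows "compact_uniformity X = diagonal_nhds X"
  unfolding compact_uniformity_def
  using compatible_diagonal_nhds[OF assms] compatible_uniformity_unique[OF assms(1)]
  by (rule the_equality)


section \<open>Compact G-systems\<close>

text \<open>The acting group is a type of class \<^class>\<open>topological_group_add\<close>. That class is not
  commutative; it merely writes the group operation as \<open>+\<close> and the unit as \<open>0\<close>.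
  Spaces are carried by \<open>topspace X\<close>, and self-maps of a space are extensional functions.\<close>

definition compact_G_system :: "('g::topological_group_add \<Rightarrow> 'x \<Rightarrow> 'x) \<Rightarrow> 'x topology \<Rightarrow> bool" where
  "compact_G_system act X \<longleftrightarrow>
     compact_space X \<and> Hausdorff_space X \<and>
     continuous_map (prod_topology euclidean X) X (\<lambda>(g, x). act g x) \<and>
     (\<forall>x\<in>topspace X. act 0 x = x) \<and>
     (\<forall>g h. \<forall>x\<in>topspace X. act (g + h) x = act g (act h x))"

definition G_invariant :: "('g \<Rightarrow> 'x \<Rightarrow> 'x) \<Rightarrow> 'x set \<Rightarrow> bool" where
  "G_invariant act Y \<longleftrightarrow> (\<forall>g. \<forall>y\<in>Y. act g y \<in> Y)"

definition point_transitive :: "('g \<Rightarrow> 'x \<Rightarrow> 'x) \<Rightarrow> 'x topology \<Rightarrow> bool" where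
  "point_transitive act X \<longleftrightarrow> (\<exists>x\<in>topspace X. X closure_of range (\<lambda>g. act g x) = topspace X)"

definition translation :: "('g \<Rightarrow> 'x \<Rightarrow> 'x) \<Rightarrow> 'x topology \<Rightarrow> 'g \<Rightarrow> 'x \<Rightarrow> 'x" where
  "translation act X g = restrict (act g) (topspace X)"

definition enveloping_semigroup :: "('g \<Rightarrow> 'x \<Rightarrow> 'x) \<Rightarrow> 'x topology \<Rightarrow> ('x \<Rightarrow> 'x) set" where
  "enveloping_semigroup act X =
     product_topology (\<lambda>_. X) (topspace X) closure_of range (translation act X)"

definition enveloping_topology :: "('g \<Rightarrow> 'x \<Rightarrow> 'x) \<Rightarrow> 'x topology \<Rightarrow> ('x \<Rightarrow> 'x) topology" where
  "enveloping_topology act X =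
     subtopology (product_topology (\<lambda>_. X) (topspace X)) (enveloping_semigroup act X)"

definition enveloping_action :: "('g \<Rightarrow> 'x \<Rightarrow> 'x) \<Rightarrow> 'x topology \<Rightarrow> 'g \<Rightarrow> ('x \<Rightarrow> 'x) \<Rightarrow> ('x \<Rightarrow> 'x)" where
  "enveloping_action act X g p = compose (topspace X) (translation act X g) p"


section \<open>Non-sensitivity and fragmentability\<close>

definition not_sensitive :: "('g \<Rightarrow> 'y \<Rightarrow> 'y) \<Rightarrow> 'y topology \<Rightarrow> ('y \<times> 'y) set set \<Rightarrow> bool" where
  "not_sensitive act Y \<mu> \<longleftrightarrow>
     (\<forall>\<epsilon>\<in>\<mu>. \<exists>U. openin Y U \<and> U \<noteq> {} \<and> (\<forall>x\<in>U. \<forall>y\<in>U. \<forall>g. (act g x, act g y) \<in> \<epsilon>))"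

definition HNS :: "('g \<Rightarrow> 'x \<Rightarrow> 'x) \<Rightarrow> 'x topology \<Rightarrow> bool" where
  "HNS act X \<longleftrightarrow>
     (\<forall>Y. closedin X Y \<and> Y \<noteq> {} \<and> G_invariant act Y \<longrightarrow>
          not_sensitive act (subtopology X Y) (compact_uniformity (subtopology X Y)))"

definition fragmented_family :: "'x topology \<Rightarrow> ('y \<times> 'y) set set \<Rightarrow> ('x \<Rightarrow> 'y) set \<Rightarrow> bool" where
  "fragmented_family X \<mu> F \<longleftrightarrow>
     (\<forall>A \<epsilon>. A \<subseteq> topspace X \<and> A \<noteq> {} \<and> \<epsilon> \<in> \<mu> \<longrightarrow>
        (\<exists>U. openin X U \<and> U \<inter> A \<noteq> {} \<and> (\<forall>f\<in>F. f ` (U \<inter> A) \<times> f ` (U \<inter> A) \<subseteq> \<epsilon>)))"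

definition compact_right_topological_semigroup :: "('s \<Rightarrow> 's \<Rightarrow> 's) \<Rightarrow> 's topology \<Rightarrow> bool" where
  "compact_right_topological_semigroup m S \<longleftrightarrow>
     compact_space S \<and> Hausdorff_space S \<and>
     (\<forall>s\<in>topspace S. \<forall>t\<in>topspace S. m s t \<in> topspace S) \<and>
     (\<forall>s\<in>topspace S. \<forall>t\<in>topspace S. \<forall>u\<in>topspace S. m (m s t) u = m s (m t u)) \<and>
     (\<forall>p\<in>topspace S. continuous_map S S (\<lambda>s. m s p))"

definition F_semigroup :: "('s \<Rightarrow> 's \<Rightarrow> 's) \<Rightarrow> 's topology \<Rightarrow> bool" where
  "F_semigroup m S \<longleftrightarrow>
     compact_right_topological_semigroup m S \<and>
     fragmented_family S (compact_uniformity S) (m ` topspace S)"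


section \<open>Asplund spaces\<close>

instantiation "fun" :: (type, real_vector) real_vector
begin

definition "scaleR c f = (\<lambda>x. c *\<^sub>R f x)"

instance
  by standard (auto simp: scaleR_fun_def fun_eq_iff algebra_simps)

end

text \<open>A (real) Banach space is given by a linear subspace \<open>V\<close> of some real vector space type
  together with a function \<open>N\<close> that is a complete norm on \<open>V\<close>; the values of \<open>N\<close> off \<open>V\<close> are
  irrelevant. Unlike a type of class \<^class>\<open>banach\<close>, such pairs can be quantified over.\<close>

definition norm_on :: "'v::real_vector set \<Rightarrow> ('v \<Rightarrow> real) \<Rightarrow> bool" where
  "norm_on V N \<longleftrightarrow> subspace V \<and>
     (\<forall>v\<in>V. 0 \<le> N v) \<and> (\<forall>v\<in>V. N v = 0 \<longleftrightarrow> v = 0) \<and>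
     (\<forall>c. \<forall>v\<in>V. N (c *\<^sub>R v) = \<bar>c\<bar> * N v) \<and>
     (\<forall>v\<in>V. \<forall>w\<in>V. N (v + w) \<le> N v + N w)"

definition banach_on :: "'v::real_vector set \<Rightarrow> ('v \<Rightarrow> real) \<Rightarrow> bool" where
  "banach_on V N \<longleftrightarrow> norm_on V N \<and>
     (\<forall>s::nat \<Rightarrow> 'v. (\<forall>n. s n \<in> V) \<and> (\<forall>e>0. \<exists>M. \<forall>m\<ge>M. \<forall>n\<ge>M. N (s m - s n) < e) \<longrightarrow>
        (\<exists>v\<in>V. (\<lambda>n. N (s n - v)) \<longlonglongrightarrow> 0))"

definition norm_separable :: "'v::real_vector set \<Rightarrow> ('v \<Rightarrow> real) \<Rightarrow> bool" where
  "norm_separable V N \<longleftrightarrow>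
     (\<exists>D. countable D \<and> D \<subseteq> V \<and> (\<forall>v\<in>V. \<forall>e>0. \<exists>d\<in>D. N (v - d) < e))"

definition linear_on :: "'v::real_vector set \<Rightarrow> ('v \<Rightarrow> 'w::real_vector) \<Rightarrow> bool" where
  "linear_on V f \<longleftrightarrow>
     (\<forall>v\<in>V. \<forall>w\<in>V. f (v + w) = f v + f w) \<and> (\<forall>c. \<forall>v\<in>V. f (c *\<^sub>R v) = c *\<^sub>R f v)"

text \<open>Functionals on \<open>V\<close> are extended by \<open>0\<close> off \<open>V\<close>, so that each has exactly one representative
  and the dual is itself a linear subspace of a function type.\<close>

definition dual_on :: "'v::real_vector set \<Rightarrow> ('v \<Rightarrow> real) \<Rightarrow> ('v \<Rightarrow> real) set" where
  "dual_on V N =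
     {\<phi>. (\<forall>v. v \<notin> V \<longrightarrow> \<phi> v = 0) \<and> linear_on V \<phi> \<and> (\<exists>C. \<forall>v\<in>V. \<bar>\<phi> v\<bar> \<le> C * N v)}"

definition dual_norm :: "'v::real_vector set \<Rightarrow> ('v \<Rightarrow> real) \<Rightarrow> ('v \<Rightarrow> real) \<Rightarrow> real" where
  "dual_norm V N \<phi> = (SUP v\<in>{v \<in> V. N v \<le> 1}. \<bar>\<phi> v\<bar>)"

definition weak_star :: "'v::real_vector set \<Rightarrow> ('v \<Rightarrow> real) \<Rightarrow> ('v \<Rightarrow> real) topology" where
  "weak_star V N = subtopology (product_topology (\<lambda>_. euclideanreal) UNIV) (dual_on V N)"

definition asplund_on :: "'v::real_vector set \<Rightarrow> ('v \<Rightarrow> real) \<Rightarrow> bool" where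
  "asplund_on V N \<longleftrightarrow> banach_on V N \<and>
     (\<forall>W. W \<subseteq> V \<and> banach_on W N \<and> norm_separable W N \<longrightarrow>
          norm_separable (dual_on W N) (dual_norm W N))"

definition Iso_on :: "'v::real_vector set \<Rightarrow> ('v \<Rightarrow> real) \<Rightarrow> ('v \<Rightarrow> 'v) set" where
  "Iso_on V N = {f. bij_betw f V V \<and> linear_on V f \<and> (\<forall>v\<in>V. N (f v) = N v)}"

definition strongly_continuous_cohom ::
    "'v::real_vector set \<Rightarrow> ('v \<Rightarrow> real) \<Rightarrow> ('g::topological_group_add \<Rightarrow> 'v \<Rightarrow> 'v) \<Rightarrow> bool" where
  "strongly_continuous_cohom V N h \<longleftrightarrow>
     (\<forall>g. h g \<in> Iso_on V N) \<and>
     (\<forall>g g'. \<forall>v\<in>V. h (g + g') v = h g' (h g v)) \<and>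
     (\<forall>v\<in>V. \<forall>g\<^sub>0. ((\<lambda>g. N (h g v - h g\<^sub>0 v)) \<longlongrightarrow> 0) (nhds g\<^sub>0))"


section \<open>Radon-Nikodym systems and their approximable version\<close>

text \<open>HOL cannot quantify over types inside a formula, so the type \<open>'v\<close> containing the Asplund
  space, and below also the index type \<open>'i\<close> and the type \<open>'y\<close> containing the points of the factors,
  are explicit parameters.\<close>

definition RN_in ::
    "'v::real_vector itself \<Rightarrow> ('g::topological_group_add \<Rightarrow> 'x \<Rightarrow> 'x) \<Rightarrow> 'x topology \<Rightarrow> bool" where
  "RN_in tv act X \<longleftrightarrow> compact_G_system act X \<and>
     (\<exists>(V::'v set) N h \<alpha>.
        asplund_on V N \<and> strongly_continuous_cohom V N h \<and>
        embedding_map X (weak_star V N) \<alpha> \<and>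
        (\<exists>C. \<forall>x\<in>topspace X. dual_norm V N (\<alpha> x) \<le> C) \<and>
        (\<forall>g. \<forall>x\<in>topspace X. \<forall>v\<in>V. \<alpha> (act g x) v = \<alpha> x (h g v)))"

definition product_action :: "'i set \<Rightarrow> ('i \<Rightarrow> 'g \<Rightarrow> 'y \<Rightarrow> 'y) \<Rightarrow> 'g \<Rightarrow> ('i \<Rightarrow> 'y) \<Rightarrow> ('i \<Rightarrow> 'y)" where
  "product_action I a g f = (\<lambda>i\<in>I. a i g (f i))"

definition RN_app_in ::
    "'i itself \<Rightarrow> 'y itself \<Rightarrow> 'v::real_vector itself \<Rightarrow>
     ('g::topological_group_add \<Rightarrow> 'x \<Rightarrow> 'x) \<Rightarrow> 'x topology \<Rightarrow> bool" where
  "RN_app_in ti ty tv act X \<longleftrightarrow> compact_G_system act X \<and>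
     (\<exists>(I::'i set) (Y::'i \<Rightarrow> 'y topology) a Z \<theta>.
        (\<forall>i\<in>I. RN_in TYPE('v) (a i) (Y i)) \<and>
        closedin (product_topology Y I) Z \<and> G_invariant (product_action I a) Z \<and>
        homeomorphic_map X (subtopology (product_topology Y I) Z) \<theta> \<and>
        (\<forall>g. \<forall>x\<in>topspace X. \<theta> (act g x) = product_action I a g (\<theta> x)))"

text \<open>The types chosen here are large enough for every \<open>X\<close> over \<open>'x\<close>. Each factor of the product
  may be replaced by the projection of \<open>X\<close> to it, i.e. by a quotient of \<open>X\<close>, whose points are
  subsets of \<open>X\<close>. As \<open>X\<close> is compact, it suffices to keep one separating factor for each pair of
  distinct points of \<open>X\<close>, and there are at most as many pairs as functions \<open>'x \<Rightarrow> real\<close>.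
  Finally, an Asplund space \<open>V\<close> may be replaced by its quotient by the common kernel of
  \<open>\<alpha>(X)\<close>, which \<open>v \<mapsto> (x \<mapsto> \<alpha> x v)\<close> identifies with a space of real functions on \<open>X\<close>, with
  its own norm.\<close>

abbreviation RN_app :: "('g::topological_group_add \<Rightarrow> 'x \<Rightarrow> 'x) \<Rightarrow> 'x topology \<Rightarrow> bool" where
  "RN_app \<equiv> RN_app_in TYPE('x \<Rightarrow> real) TYPE('x set) TYPE('x \<Rightarrow> real)"

end

theory Submission
  imports Defs
begin

text \<open>All conditions are reduced to one notion: a family of real functions is equifragmented if every
  nonempty set has a nonempty relatively open part on which all members oscillate by at most \<open>e\<close>.
  \<open>X\<close> is HNS iff for every \<open>f \<in> C(X)\<close> the family of all \<open>x \<mapsto> f (g x)\<close> is equifragmented. This property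
  passes to pointwise limits, pullbacks and quotients of compact spaces, which yields the equivalences
  around the enveloping semigroup; for a point transitive system, \<open>X\<close> is a quotient of \<open>E(X)\<close>.

  If a bounded set of functionals on an Asplund space were not fragmented by the norm, a Cantor scheme would
  produce uncountably many functionals that are uniformly separated on a countable set, and the closed span of
  that set would be a separable subspace with non-separable dual. Hence RN systems are HNS.

  Conversely, let \<open>\<rho>\<close> be the square root of the pseudometric \<open>sup\<^sub>g |f (g x) - f (g y)|\<close>, and let \<open>V\<close> be the
  space of those continuous \<open>v\<close> with \<open>|v x - v y| = o(\<rho> x y)\<close> as \<open>\<rho> x y\<close> tends to \<open>0\<close>. It contains all
  \<open>x \<mapsto> f (g x)\<close>, and \<open>G\<close> acts on it by isometries. A gliding hump argument shows that a functional
  on a subspace of \<open>V\<close> is continuous for the sup norm on the unit ball, so by the Hahn--Banach theorem it is close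
  to a difference of two positive functionals on \<open>C(X)\<close>. On a separable subspace these are norm limits
  of combinations of point evaluations, because \<open>X\<close> is covered by countably many sets on which the unit
  ball oscillates little. Thus \<open>V\<close> is Asplund, and evaluation maps \<open>X\<close> onto an RN system that separates
  any two points which \<open>f\<close> separates.\<close>

section \<open>Fragmented families of real functions\<close>

text \<open>\<open>RN_app\<close> asks for Asplund spaces inside
  \<open>'x \<Rightarrow> real\<close>, so the representing space is written down as a space of
  functions on \<open>X\<close>. All Lipschitz functions would be too many: the gliding hump and the
  norm continuity of the action both compare small and large scales of the gauge, and both need
  functions that are flat at small scales. This is the origin of the little-o condition; the square
  root turns the 1-Lipschitz functions of the orbit pseudometric into functions that satisfy it.
  \<open>X\<close> need not be metrizable, so countable covers are found in an image of
  \<open>X\<close> in a countable power of the line. Fragmentation then has to pass to images,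
  although open sets need not have open images; irreducible preimages overcome this. The covering
  sets are arbitrary, so near-minimal continuous majorants stand in for their measures. Real
  functions suffice throughout because, on a compact space, every entourage is controlled by
  finitely many members of any point-separating family of continuous functions.\<close>

definition equifragmented :: "'a topology \<Rightarrow> ('a \<Rightarrow> real) set \<Rightarrow> bool" where
  "equifragmented X F \<longleftrightarrow>
     (\<forall>A e. A \<subseteq> topspace X \<and> A \<noteq> {} \<and> 0 < e \<longrightarrow>
        (\<exists>U. openin X U \<and> U \<inter> A \<noteq> {} \<and> (\<forall>f\<in>F. \<forall>x\<in>U \<inter> A. \<forall>y\<in>U \<inter> A. \<bar>f x - f y\<bar> \<le> e)))"

lemma equifragmentedD:
  assumes "equifragmented X F" "A \<subseteq> topspace X" "A \<noteq> {}" "0 < e"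
  obtains U where "openin X U" "U \<inter> A \<noteq> {}"
    "\<And>f x y. f \<in> F \<Longrightarrow> x \<in> U \<inter> A \<Longrightarrow> y \<in> U \<inter> A \<Longrightarrow> \<bar>f x - f y\<bar> \<le> e"
  using assms unfolding equifragmented_def by metis

lemma equifragmentedI:
  assumes "\<And>A e. A \<subseteq> topspace X \<Longrightarrow> A \<noteq> {} \<Longrightarrow> 0 < e \<Longrightarrow>
    \<exists>U. openin X U \<and> U \<inter> A \<noteq> {} \<and> (\<forall>f\<in>F. \<forall>x\<in>U \<inter> A. \<forall>y\<in>U \<inter> A. \<bar>f x - f y\<bar> \<le> e)"
  shows "equifragmented X F"
  using assms unfolding equifragmented_def by blast

lemma equifragmented_subset: "equifragmented X F \<Longrightarrow> H \<subseteq> F \<Longrightarrow> equifragmented X H"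
  unfolding equifragmented_def by (meson subsetD)

text \<open>Members of \<open>H\<close> are compared with \<open>f\<close> only on
  \<open>topspace X\<close>, since restricted maps and functions extended by 0 differ from the plain
  ones elsewhere. With \<open>\<pi>\<close> the identity, the lemma exchanges such variants.\<close>

lemma equifragmented_pullback:
  assumes F: "equifragmented Y F" and \<pi>: "continuous_map X Y \<pi>"
    and H: "\<And>h. h \<in> H \<Longrightarrow> \<exists>f\<in>F. \<forall>x\<in>topspace X. h x = f (\<pi> x)"
  shows "equifragmented X H"
proof (rule equifragmentedI)
  fix A and e :: real assume A: "A \<subseteq> topspace X" "A \<noteq> {}" and e: "0 < e"
  have "\<pi> ` A \<subseteq> topspace Y"
    using A \<pi> by (auto simp: continuous_map_def)
  then obtain U where U: "openin Y U" "U \<inter> \<pi> ` A \<noteq> {}"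
    "\<And>f x y. f \<in> F \<Longrightarrow> x \<in> U \<inter> \<pi> ` A \<Longrightarrow> y \<in> U \<inter> \<pi> ` A \<Longrightarrow> \<bar>f x - f y\<bar> \<le> e"
    using equifragmentedD[OF F _ _ e, of "\<pi> ` A"] A(2) by blast
  let ?V = "{x \<in> topspace X. \<pi> x \<in> U}"
  have "openin X ?V"
    using \<pi> U(1) by (rule openin_continuous_map_preimage)
  moreover have "?V \<inter> A \<noteq> {}"
    using U(2) A(1) by blast
  moreover have "\<bar>h x - h y\<bar> \<le> e" if "h \<in> H" "x \<in> ?V \<inter> A" "y \<in> ?V \<inter> A" for h x y
  proof -
    obtain f where "f \<in> F" "\<forall>x\<in>topspace X. h x = f (\<pi> x)"
      using H \<open>h \<in> H\<close> by blast
    then show ?thesis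
      using U(3)[of f "\<pi> x" "\<pi> y"] that by auto
  qed
  ultimately show "\<exists>U. openin X U \<and> U \<inter> A \<noteq> {} \<and> (\<forall>f\<in>H. \<forall>x\<in>U \<inter> A. \<forall>y\<in>U \<inter> A. \<bar>f x - f y\<bar> \<le> e)"
    by blast
qed

text \<open>The piece found for one family is itself a nonempty set, inside which a piece for the
  remaining families is sought.\<close>

lemma equifragmented_finite_UN:
  assumes "finite I" "\<And>i. i \<in> I \<Longrightarrow> equifragmented X (F i)"
  shows "equifragmented X (\<Union>i\<in>I. F i)"
  using assms
proof (induction I)
  case empty
  then show ?case
    unfolding equifragmented_def by (auto intro!: exI[of _ "topspace X"])
next
  case (insert i I)
  show ?case
  proof (rule equifragmentedI)
    fix A and e :: real assume A: "A \<subseteq> topspace X" "A \<noteq> {}" and e: "0 < e"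
    have Fi: "equifragmented X (F i)" and FI: "equifragmented X (\<Union>i\<in>I. F i)"
      using insert by auto
    obtain U where U: "openin X U" "U \<inter> A \<noteq> {}"
      "\<And>f x y. f \<in> F i \<Longrightarrow> x \<in> U \<inter> A \<Longrightarrow> y \<in> U \<inter> A \<Longrightarrow> \<bar>f x - f y\<bar> \<le> e"
      using equifragmentedD[OF Fi A e] by blast
    have UA: "U \<inter> A \<subseteq> topspace X"
      using A by blast
    obtain V where V: "openin X V" "V \<inter> (U \<inter> A) \<noteq> {}"
      "\<And>f x y. f \<in> (\<Union>i\<in>I. F i) \<Longrightarrow> x \<in> V \<inter> (U \<inter> A) \<Longrightarrow> y \<in> V \<inter> (U \<inter> A) \<Longrightarrow> \<bar>f x - f y\<bar> \<le> e"
      using equifragmentedD[OF FI UA U(2) e] by blast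
    have "openin X (V \<inter> U)" "(V \<inter> U) \<inter> A \<noteq> {}"
      using U V by auto
    moreover have "\<bar>f x - f y\<bar> \<le> e"
      if "f \<in> (\<Union>i\<in>insert i I. F i)" "x \<in> (V \<inter> U) \<inter> A" "y \<in> (V \<inter> U) \<inter> A" for f x y
    proof (cases "f \<in> F i")
      case True
      then show ?thesis using that U(3) by blast
    next
      case False
      then have "f \<in> (\<Union>i\<in>I. F i)" using that by blast
      then show ?thesis using that V(3)[of f x y] by blast
    qed
    ultimately show "\<exists>U. openin X U \<and> U \<inter> A \<noteq> {} \<and>
      (\<forall>f\<in>\<Union>i\<in>insert i I. F i. \<forall>x\<in>U \<inter> A. \<forall>y\<in>U \<inter> A. \<bar>f x - f y\<bar> \<le> e)"
      by blast
  qed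
qed

text \<open>The same open set works for \<open>H\<close>, because oscillation involves two points at
  a time and the bound \<open>\<le> e\<close> is closed. Hence approximation at pairs of points is
  all that is asked of \<open>H\<close>.\<close>

lemma equifragmented_pointwise_closure:
  assumes F: "equifragmented X F"
    and H: "\<And>h x y e. h \<in> H \<Longrightarrow> x \<in> topspace X \<Longrightarrow> y \<in> topspace X \<Longrightarrow> 0 < e \<Longrightarrow>
      \<exists>f\<in>F. \<bar>h x - f x\<bar> < e \<and> \<bar>h y - f y\<bar> < (e::real)"
  shows "equifragmented X H"
proof (rule equifragmentedI)
  fix A and e :: real assume A: "A \<subseteq> topspace X" "A \<noteq> {}" and e: "0 < e"
  obtain U where U: "openin X U" "U \<inter> A \<noteq> {}"
    "\<And>f x y. f \<in> F \<Longrightarrow> x \<in> U \<inter> A \<Longrightarrow> y \<in> U \<inter> A \<Longrightarrow> \<bar>f x - f y\<bar> \<le> e"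
    using equifragmentedD[OF F A e] by blast
  have "\<bar>h x - h y\<bar> \<le> e" if h: "h \<in> H" "x \<in> U \<inter> A" "y \<in> U \<inter> A" for h x y
  proof (rule field_le_epsilon)
    fix d :: real assume "0 < d"
    then obtain f where "f \<in> F" "\<bar>h x - f x\<bar> < d/2" "\<bar>h y - f y\<bar> < d/2"
      using H[of h x y "d/2"] h A by auto
    then show "\<bar>h x - h y\<bar> \<le> e + d"
      using U(3)[of f x y] h by linarith
  qed
  then show "\<exists>U. openin X U \<and> U \<inter> A \<noteq> {} \<and> (\<forall>f\<in>H. \<forall>x\<in>U \<inter> A. \<forall>y\<in>U \<inter> A. \<bar>f x - f y\<bar> \<le> e)"
    using U by blast
qed

text \<open>This is the existence of irreducible restrictions of surjections: along a chain of
  closed sets mapped onto \<open>A\<close>, the intersection is still mapped onto \<open>A\<close>,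
  since every fibre is compact.\<close>

lemma minimal_closed_preimage:
  assumes X: "compact_space X" and Y: "Hausdorff_space Y" and \<pi>: "continuous_map X Y \<pi>"
    and A: "closedin Y A" "A \<subseteq> \<pi> ` topspace X"
  obtains Z where "closedin X Z" "\<pi> ` Z = A"
    "\<And>Z'. closedin X Z' \<Longrightarrow> Z' \<subset> Z \<Longrightarrow> \<pi> ` Z' \<noteq> A"
proof -
  let ?S = "topspace X"
  \<comment> \<open>Open complements stand for the closed sets, so that chains are bounded above by
    their unions.\<close>
  define \<A> where "\<A> = {V. openin X V \<and> \<pi> ` (?S - V) = A}"
  have "{x \<in> ?S. \<pi> x \<in> topspace Y - A} \<in> \<A>"
  proof -
    have "openin X {x \<in> ?S. \<pi> x \<in> topspace Y - A}"
      using A(1) by (intro openin_continuous_map_preimage[OF \<pi>]) blast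
    moreover have "\<pi> ` (?S - {x \<in> ?S. \<pi> x \<in> topspace Y - A}) = A"
      using A \<pi> by (auto simp: continuous_map_def)
    ultimately show ?thesis unfolding \<A>_def by blast
  qed
  then have "\<A> \<noteq> {}" by blast
  moreover have "\<Union>\<C> \<in> \<A>" if \<C>: "\<C> \<noteq> {}" "subset.chain \<A> \<C>" for \<C>
  proof -
    have op: "openin X V" and im: "\<pi> ` (?S - V) = A" if "V \<in> \<C>" for V
      using \<C>(2) that unfolding \<A>_def subset.chain_def by blast+
    have "a \<in> \<pi> ` (?S - \<Union>\<C>)" if a: "a \<in> A" for a
    proof (rule ccontr)
      assume na: "a \<notin> \<pi> ` (?S - \<Union>\<C>)"
      let ?K = "{x \<in> ?S. \<pi> x \<in> {a}}"
      have "closedin Y {a}"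
        using Y a A(1) by (meson closedin_Hausdorff_singleton closedin_subset subsetD)
      then have "closedin X ?K"
        by (rule closedin_continuous_map_preimage[OF \<pi>])
      then have "compactin X ?K"
        using X by (rule closedin_compact_space[rotated])
      moreover have "?K \<subseteq> \<Union>\<C>"
        using na by blast
      ultimately obtain \<F> where \<F>: "finite \<F>" "\<F> \<subseteq> \<C>" "?K \<subseteq> \<Union>\<F>"
        using op unfolding compactin_def by meson
      \<comment> \<open>A finite part of a chain lies in one member, and the complement of that
        member would then miss the fibre over \<open>a\<close>.\<close>
      have "\<exists>V\<in>\<C>. \<Union>\<F> \<subseteq> V"
        using \<F>(1,2)
      proof (induction \<F>)
        case empty
        then show ?case using \<C>(1) by blast
      next
        case (insert W \<F>)
        then obtain V where V: "V \<in> \<C>" "\<Union>\<F> \<subseteq> V" by (meson insert_subset)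
        have "W \<in> \<C>" using insert.prems by simp
        consider "V \<subseteq> W" | "W \<subseteq> V"
          using \<C>(2) V(1) \<open>W \<in> \<C>\<close> unfolding subset.chain_def by blast
        then show ?case
        proof cases
          case 1
          then have "\<Union>(insert W \<F>) \<subseteq> W" using V(2) by simp
          then show ?thesis using \<open>W \<in> \<C>\<close> by (rule bexI)
        next
          case 2
          then have "\<Union>(insert W \<F>) \<subseteq> V" using V(2) by simp
          then show ?thesis using V(1) by (rule bexI)
        qed
      qed
      then obtain V where "V \<in> \<C>" "\<Union>\<F> \<subseteq> V" by (rule bexE)
      have "?K \<subseteq> V" using \<F>(3) \<open>\<Union>\<F> \<subseteq> V\<close> by (rule subset_trans)
      then have "a \<notin> \<pi> ` (?S - V)" by blast
      then show False using im[OF \<open>V \<in> \<C>\<close>] a by blast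
    qed
    moreover obtain V where "V \<in> \<C>" using \<C>(1) by blast
    moreover have "\<pi> ` (?S - \<Union>\<C>) \<subseteq> \<pi> ` (?S - V)"
      using \<open>V \<in> \<C>\<close> by blast
    ultimately have "\<pi> ` (?S - \<Union>\<C>) = A"
      using im by blast
    then show ?thesis
      using op unfolding \<A>_def by blast
  qed
  ultimately obtain M where M: "M \<in> \<A>" "\<And>V. V \<in> \<A> \<Longrightarrow> M \<subseteq> V \<Longrightarrow> V = M"
    using subset_Zorn_nonempty[of \<A>] by blast
  show ?thesis
  proof (rule that[of "?S - M"])
    show "closedin X (?S - M)" "\<pi> ` (?S - M) = A"
      using M(1) unfolding \<A>_def by blast+
    show "\<pi> ` Z' \<noteq> A" if Z': "closedin X Z'" "Z' \<subset> ?S - M" for Z'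
    proof
      assume "\<pi> ` Z' = A"
      moreover have "?S - (?S - Z') = Z'"
        using closedin_subset[OF Z'(1)] by blast
      ultimately have "?S - Z' \<in> \<A>"
        using Z'(1) unfolding \<A>_def by auto
      moreover have "M \<subseteq> ?S - Z'"
        using M(1) Z'(2) openin_subset unfolding \<A>_def by blast
      ultimately have "?S - Z' = M"
        using M(2) by blast
      then show False
        using Z' closedin_subset[OF Z'(1)] by blast
    qed
  qed
qed

text \<open>A piece of an arbitrary preimage of \<open>B\<close> may have an image without relative
  interior, which would say nothing about \<open>B\<close>. The piece is therefore sought in an
  irreducible closed preimage.\<close>

lemma equifragmented_quotient:
  assumes X: "compact_space X" and Y: "Hausdorff_space Y" and \<pi>: "continuous_map X Y \<pi>"
    and onto: "topspace Y \<subseteq> \<pi> ` topspace X"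
    and F: "equifragmented X ((\<lambda>f x. f (\<pi> x)) ` F)"
  shows "equifragmented Y F"
proof (rule equifragmentedI)
  fix B and e :: real assume B: "B \<subseteq> topspace Y" "B \<noteq> {}" and e: "0 < e"
  \<comment> \<open>Irreducible preimages are available for closed sets; an open set that meets the
    closure also meets \<open>B\<close>.\<close>
  define A where "A = Y closure_of B"
  have BA: "B \<subseteq> A"
    unfolding A_def by (rule closure_of_subset[OF B(1)])
  have A: "closedin Y A" "A \<subseteq> \<pi> ` topspace X"
    unfolding A_def using closure_of_subset_topspace onto by force+
  \<comment> \<open>As no smaller closed set is mapped onto \<open>A\<close>, the image of a nonempty relatively open part of \<open>Z\<close>
    contains one of \<open>A\<close>.\<close>
  obtain Z where Z: "closedin X Z" "\<pi> ` Z = A"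
    and minimal: "\<And>Z'. closedin X Z' \<Longrightarrow> Z' \<subset> Z \<Longrightarrow> \<pi> ` Z' \<noteq> A"
    using minimal_closed_preimage[OF X Y \<pi> A] by metis
  have "Z \<subseteq> topspace X" "Z \<noteq> {}"
    using Z B(2) BA closedin_subset by auto
  then obtain U where U: "openin X U" "U \<inter> Z \<noteq> {}"
    and small: "\<And>f x y. f \<in> F \<Longrightarrow> x \<in> U \<inter> Z \<Longrightarrow> y \<in> U \<inter> Z \<Longrightarrow> \<bar>f (\<pi> x) - f (\<pi> y)\<bar> \<le> e"
    using equifragmentedD[OF F _ _ e, of Z] by (metis (no_types, lifting) image_eqI)
  have cl: "closedin X (Z - U)"
    using Z(1) U(1) by (rule closedin_diff)
  have "closedin Y (\<pi> ` (Z - U))"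
    using continuous_imp_closed_map_gen[OF X _ \<pi>] Y cl by (simp add: closed_map_def Hausdorff_imp_kc_space)
  then have O: "openin Y (topspace Y - \<pi> ` (Z - U))"
    by blast
  have "Z - U \<subset> Z"
    using U(2) by blast
  then have "\<pi> ` (Z - U) \<noteq> A"
    using minimal[OF cl] by blast
  then obtain a where a: "a \<in> A" "a \<in> topspace Y - \<pi> ` (Z - U)"
    using Z(2) closedin_subset[OF A(1)] by blast
  then have "(topspace Y - \<pi> ` (Z - U)) \<inter> B \<noteq> {}"
    unfolding A_def using O by (metis disjoint_iff in_closure_of)
  moreover have "\<exists>z. z \<in> U \<inter> Z \<and> \<pi> z = y" if "y \<in> (topspace Y - \<pi> ` (Z - U)) \<inter> B" for y
    using that BA Z(2) by blast
  then have "\<bar>f x - f y\<bar> \<le> e"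
    if "f \<in> F" "x \<in> (topspace Y - \<pi> ` (Z - U)) \<inter> B" "y \<in> (topspace Y - \<pi> ` (Z - U)) \<inter> B" for f x y
    using that small by metis
  ultimately show "\<exists>U. openin Y U \<and> U \<inter> B \<noteq> {} \<and> (\<forall>f\<in>F. \<forall>x\<in>U \<inter> B. \<forall>y\<in>U \<inter> B. \<bar>f x - f y\<bar> \<le> e)"
    using O by (intro exI[of _ "topspace Y - \<pi> ` (Z - U)"] conjI ballI) simp_all
qed

text \<open>The image of \<open>X\<close> under the countably many \<open>f n\<close> is second
  countable, so by Lindelof there is a largest relatively open set with a countable cover by small
  sets. It is everything, because a fragment of the rest would enlarge it.\<close>

lemma equifragmented_countable_cover:
  fixes f :: "nat \<Rightarrow> 'a \<Rightarrow> real"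
  assumes X: "compact_space X" and cont: "\<And>n. continuous_map X euclideanreal (f n)"
    and frag: "equifragmented X (range f)" and e: "0 < e"
  obtains \<C> where "countable \<C>" "topspace X \<subseteq> \<Union>\<C>"
    "\<And>C n x y. C \<in> \<C> \<Longrightarrow> x \<in> C \<Longrightarrow> y \<in> C \<Longrightarrow> \<bar>f n x - f n y\<bar> \<le> e"
proof -
  define \<pi> where "\<pi> x = (\<lambda>n. f n x)" for x
  define S where "S = \<pi> ` topspace X"
  have "continuous_map X (euclidean :: (nat \<Rightarrow> real) topology) \<pi>"
    unfolding euclidean_product_topology[symmetric] continuous_map_componentwise_UNIV \<pi>_def using cont by blast
  then have \<pi>: "continuous_map X (top_of_set S) \<pi>"
    unfolding S_def by (simp add: continuous_map_in_subtopology)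
  have fr: "equifragmented (top_of_set S) (range (\<lambda>n y. y n))"
  proof (rule equifragmented_quotient[OF X _ \<pi>])
    show "Hausdorff_space (top_of_set S)"
      by (simp add: Hausdorff_space_subtopology)
    show "topspace (top_of_set S) \<subseteq> \<pi> ` topspace X"
      by (simp add: S_def)
    show "equifragmented X ((\<lambda>f x. f (\<pi> x)) ` range (\<lambda>n y. y n))"
      using frag by (simp add: image_image \<pi>_def)
  qed
  define small where "small C \<longleftrightarrow> (\<forall>n. \<forall>x\<in>C. \<forall>y\<in>C. \<bar>x n - y n\<bar> \<le> e)" for C :: "(nat \<Rightarrow> real) set"
  define \<O> where "\<O> = {W. openin (top_of_set S) W \<and> (\<exists>\<C>. countable \<C> \<and> W \<subseteq> \<Union>\<C> \<and> (\<forall>C\<in>\<C>. small C))}"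
  obtain \<O>' where \<O>': "\<O>' \<subseteq> \<O>" "countable \<O>'" "\<Union>\<O>' = \<Union>\<O>"
    using Lindelof_openin[of \<O> S] unfolding \<O>_def by blast
  then have "\<forall>W\<in>\<O>'. \<exists>\<C>. countable \<C> \<and> W \<subseteq> \<Union>\<C> \<and> (\<forall>C\<in>\<C>. small C)"
    unfolding \<O>_def by blast
  then obtain c where c: "\<And>W. W \<in> \<O>' \<Longrightarrow> countable (c W) \<and> W \<subseteq> \<Union>(c W) \<and> (\<forall>C\<in>c W. small C)"
    by metis
  define \<C> where "\<C> = (\<Union>W\<in>\<O>'. c W)"
  have \<C>: "countable \<C>" "\<Union>\<O> \<subseteq> \<Union>\<C>" "\<And>C. C \<in> \<C> \<Longrightarrow> small C"
  proof -
    show "countable \<C>" unfolding \<C>_def using \<O>'(2) c by auto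
    have "W \<subseteq> \<Union>\<C>" if "W \<in> \<O>'" for W
      using c[OF that] that unfolding \<C>_def by fastforce
    then show "\<Union>\<O> \<subseteq> \<Union>\<C>" unfolding \<O>'(3)[symmetric] by (rule Sup_least)
    show "\<And>C. C \<in> \<C> \<Longrightarrow> small C" unfolding \<C>_def using c by blast
  qed
  have S: "S \<subseteq> \<Union>\<C>"
  proof (rule ccontr)
    assume "\<not> S \<subseteq> \<Union>\<C>"
    then have ne: "S - \<Union>\<C> \<noteq> {}" by blast
    have sub: "S - \<Union>\<C> \<subseteq> topspace (top_of_set S)" by simp
    obtain U where U: "openin (top_of_set S) U" "U \<inter> (S - \<Union>\<C>) \<noteq> {}"
      and sm: "\<And>h x y. h \<in> range (\<lambda>n y. y n) \<Longrightarrow> x \<in> U \<inter> (S - \<Union>\<C>) \<Longrightarrow> y \<in> U \<inter> (S - \<Union>\<C>) \<Longrightarrow> \<bar>h x - h y\<bar> \<le> e"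
      using equifragmentedD[OF fr sub ne e] by blast
    have "small (U \<inter> (S - \<Union>\<C>))"
      unfolding small_def using sm by blast
    then have "\<forall>C\<in>insert (U \<inter> (S - \<Union>\<C>)) \<C>. small C"
      using \<C>(3) by blast
    moreover have "U \<subseteq> \<Union>(insert (U \<inter> (S - \<Union>\<C>)) \<C>)"
      using openin_subset[OF U(1)] by auto
    moreover have "countable (insert (U \<inter> (S - \<Union>\<C>)) \<C>)"
      using \<C>(1) by simp
    ultimately have "U \<in> \<O>"
      unfolding \<O>_def using U(1) by blast
    then show False using U(2) \<C>(2) by blast
  qed
  show ?thesis
  proof (rule that[of "(\<lambda>C. {x. \<pi> x \<in> C}) ` \<C>"])
    show "countable ((\<lambda>C. {x. \<pi> x \<in> C}) ` \<C>)" using \<C>(1) by simp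
    show "topspace X \<subseteq> \<Union>((\<lambda>C. {x. \<pi> x \<in> C}) ` \<C>)" using S unfolding S_def by blast
    show "\<bar>f n x - f n y\<bar> \<le> e" if C: "C \<in> (\<lambda>C. {x. \<pi> x \<in> C}) ` \<C>" "x \<in> C" "y \<in> C" for C n x y
    proof -
      obtain C' where C': "C' \<in> \<C>" "C = {x. \<pi> x \<in> C'}"
        using C(1) by blast
      then have "\<pi> x \<in> C'" "\<pi> y \<in> C'"
        using C by auto
      then have "\<bar>\<pi> x n - \<pi> y n\<bar> \<le> e"
        using \<C>(3)[OF C'(1)] unfolding small_def by blast
      then show ?thesis
        by (simp add: \<pi>_def)
    qed
  qed
qed

section \<open>Positive functionals on compact spaces\<close>

definition real_cone :: "('v::real_vector \<times> real) set \<Rightarrow> bool" where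
  "real_cone R \<longleftrightarrow> (\<forall>p\<in>R. \<forall>q\<in>R. p + q \<in> R) \<and> (\<forall>c>0. \<forall>p\<in>R. c *\<^sub>R p \<in> R)"

text \<open>If adjoining the ray of \<open>(u, t)\<close> forced a negative bound on the zero
  vector, dividing by \<open>c\<close> would give \<open>(- u, s / c - t)\<close> in
  \<open>M\<close>, and raising its bound by \<open>- s / c\<close> would put
  \<open>(- u, - t)\<close> there. This lets a maximal cone decide every pair.\<close>

lemma real_cone_insert_dichotomy:
  fixes M :: "('v::real_vector \<times> real) set"
  assumes M: "real_cone M" and up: "\<And>t. 0 \<le> t \<Longrightarrow> (0, t) \<in> M"
    and "(- u, - t) \<notin> M" and pos: "\<And>t. (0, t) \<in> M \<Longrightarrow> 0 \<le> t"
    and s: "p \<in> M" "0 \<le> c" "p + c *\<^sub>R (u, t) = (0, s)"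
  shows "0 \<le> s"
proof (rule ccontr)
  assume "\<not> 0 \<le> s"
  obtain v r where p: "p = (v, r)" by (cases p)
  have vr: "v = - (c *\<^sub>R u)" "r = s - c * t"
    using s(3) unfolding p by (auto simp: eq_neg_iff_add_eq_0)
  have "c \<noteq> 0"
    using s(1) pos[of s] vr p \<open>\<not> 0 \<le> s\<close> by auto
  then have "0 < c" using s(2) by simp
  then have "(1 / c) *\<^sub>R p \<in> M"
    using M s(1) unfolding real_cone_def by simp
  then have "(- u, s / c - t) \<in> M"
    unfolding p vr using \<open>0 < c\<close> by (simp add: diff_divide_distrib)
  moreover have "(0, - s / c) \<in> M"
    using \<open>\<not> 0 \<le> s\<close> \<open>0 < c\<close> by (intro up) (simp add: field_simps)
  ultimately have "(- u, s / c - t) + (0, - s / c) \<in> M"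
    using M unfolding real_cone_def by blast
  then show False using \<open>(- u, - t) \<notin> M\<close> by simp
qed

text \<open>A form of the Hahn--Banach theorem: a pair \<open>(u, t) \<in> R\<close> is the constraint \<open>\<Lambda> u \<le> t\<close>.\<close>

lemma linear_functional_of_cone:
  fixes S :: "'v::real_vector set"
  assumes S: "subspace S" and R: "real_cone R" "R \<subseteq> S \<times> UNIV"
    and up: "\<And>t. 0 \<le> t \<Longrightarrow> (0, t) \<in> R"
    and total: "\<And>u. u \<in> S \<Longrightarrow> \<exists>t. (u, t) \<in> R" and pos: "\<And>t. (0, t) \<in> R \<Longrightarrow> 0 \<le> t"
  obtains \<Lambda> where "linear_on S \<Lambda>" "\<And>u t. (u, t) \<in> R \<Longrightarrow> \<Lambda> u \<le> (t::real)"
proof -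
  \<comment> \<open>A cone is consistent if it never demands \<open>\<Lambda> 0 \<le> t\<close> for
    a negative \<open>t\<close>; these are the consistent cones above \<open>R\<close>.\<close>
  define \<A> where "\<A> = {Q. R \<subseteq> Q \<and> real_cone Q \<and> Q \<subseteq> S \<times> UNIV \<and> (\<forall>t. (0, t) \<in> Q \<longrightarrow> 0 \<le> t)}"
  have "R \<in> \<A>"
    unfolding \<A>_def using R pos by blast
  then have "\<A> \<noteq> {}" by blast
  moreover have "\<Union>\<C> \<in> \<A>" if \<C>: "\<C> \<noteq> {}" "subset.chain \<A> \<C>" for \<C>
  proof -
    have Q: "R \<subseteq> Q \<and> real_cone Q \<and> Q \<subseteq> S \<times> UNIV \<and> (\<forall>t. (0, t) \<in> Q \<longrightarrow> 0 \<le> t)" if "Q \<in> \<C>" for Q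
      using \<C>(2) that unfolding \<A>_def subset.chain_def by blast
    have "real_cone (\<Union>\<C>)"
      unfolding real_cone_def
    proof (intro conjI ballI allI impI)
      fix p q assume "p \<in> \<Union>\<C>" "q \<in> \<Union>\<C>"
      then obtain P Q' where PQ: "P \<in> \<C>" "p \<in> P" "Q' \<in> \<C>" "q \<in> Q'" by blast
      then have "P \<subseteq> Q' \<or> Q' \<subseteq> P"
        using \<C>(2) unfolding subset.chain_def by blast
      then obtain P' where "P' \<in> \<C>" "p \<in> P'" "q \<in> P'"
        using PQ by blast
      then show "p + q \<in> \<Union>\<C>"
        using Q[of P'] unfolding real_cone_def by blast
    next
      fix c :: real and p assume "0 < c" "p \<in> \<Union>\<C>"
      then obtain P where "P \<in> \<C>" "p \<in> P" by blast
      then show "c *\<^sub>R p \<in> \<Union>\<C>"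
        using Q[of P] \<open>0 < c\<close> unfolding real_cone_def by blast
    qed
    moreover have "R \<subseteq> \<Union>\<C>"
      using Q \<C>(1) by blast
    moreover have "\<Union>\<C> \<subseteq> S \<times> UNIV"
      using Q by (meson Sup_least)
    moreover have "\<forall>t. (0, t) \<in> \<Union>\<C> \<longrightarrow> 0 \<le> t"
      using Q by (meson UnionE)
    ultimately show ?thesis
      unfolding \<A>_def by blast
  qed
  ultimately obtain M where M: "M \<in> \<A>" and maximal: "\<And>Q. Q \<in> \<A> \<Longrightarrow> M \<subseteq> Q \<Longrightarrow> Q = M"
    using subset_Zorn_nonempty[of \<A>] by blast
  have RM: "R \<subseteq> M" and cone: "real_cone M"
    and MS: "M \<subseteq> S \<times> UNIV" and Mpos: "\<And>t. (0, t) \<in> M \<Longrightarrow> 0 \<le> t"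
    using M unfolding \<A>_def by auto
  have Madd: "(u + v, t + s) \<in> M" if "(u, t) \<in> M" "(v, s) \<in> M" for u v t s
    using cone that unfolding real_cone_def by (metis add_Pair)
  have Mscale: "(c *\<^sub>R u, c * t) \<in> M" if "0 < c" "(u, t) \<in> M" for c u t
    using cone that unfolding real_cone_def by (metis scaleR_Pair real_scaleR_def)
  have Mup: "(0, t) \<in> M" if "0 \<le> t" for t
    using RM up[OF that] by blast
  \<comment> \<open>An upper bound that the maximal cone does not impose is contradicted by it:
    \<open>(- u, - t)\<close> demands \<open>t \<le> \<Lambda> u\<close>.\<close>
  have dichotomy: "(- u, - t) \<in> M" if u: "u \<in> S" and n: "(u, t) \<notin> M" for u t
  proof (rule ccontr)
    assume nn: "(- u, - t) \<notin> M"
    define Q where "Q = {p + c *\<^sub>R (u, t) |p c. p \<in> M \<and> 0 \<le> c}"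
    have QI: "p + c *\<^sub>R (u, t) \<in> Q" if "p \<in> M" "0 \<le> c" for p c
      unfolding Q_def using that by blast
    have "M \<subseteq> Q"
    proof
      fix p assume "p \<in> M"
      then show "p \<in> Q" using QI[of p 0] by (simp add: zero_prod_def[symmetric])
    qed
    have "(u, t) \<in> Q"
      using QI[OF Mup[of 0], of 1] by simp
    have "real_cone Q"
      unfolding real_cone_def
    proof (intro conjI ballI allI impI)
      fix p q assume "p \<in> Q" "q \<in> Q"
      then obtain p' q' c d where pq: "p = p' + c *\<^sub>R (u, t)" "q = q' + d *\<^sub>R (u, t)"
        "p' \<in> M" "q' \<in> M" "0 \<le> c" "0 \<le> d"
        unfolding Q_def by blast
      then have "p' + q' \<in> M"
        using cone unfolding real_cone_def by blast
      moreover have "p + q = (p' + q') + (c + d) *\<^sub>R (u, t)"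
        unfolding pq(1,2) scaleR_add_left by (simp add: add_ac del: scaleR_Pair)
      ultimately show "p + q \<in> Q"
        using QI[of "p' + q'" "c + d"] pq by (metis add_nonneg_nonneg)
    next
      fix k :: real and p assume k: "0 < k" and "p \<in> Q"
      then obtain p' c where p: "p = p' + c *\<^sub>R (u, t)" "p' \<in> M" "0 \<le> c"
        unfolding Q_def by blast
      moreover have "k *\<^sub>R p' \<in> M"
        using p k cone unfolding real_cone_def by blast
      moreover have "k *\<^sub>R p = k *\<^sub>R p' + (k * c) *\<^sub>R (u, t)"
        unfolding p(1) scaleR_add_right by (simp del: scaleR_Pair)
      ultimately show "k *\<^sub>R p \<in> Q"
        using QI[of "k *\<^sub>R p'" "k * c"] k by (metis less_imp_le mult_nonneg_nonneg)
    qed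
    moreover have "Q \<subseteq> S \<times> UNIV"
      unfolding Q_def using MS u S by (auto intro!: subspace_add subspace_scale)
    moreover have "0 \<le> s" if sQ: "(0, s) \<in> Q" for s
    proof -
      obtain p c where "p \<in> M" "0 \<le> c" "p + c *\<^sub>R (u, t) = (0, s)"
        using sQ unfolding Q_def by force
      then show ?thesis
        using real_cone_insert_dichotomy[OF cone Mup nn Mpos] by blast
    qed
    ultimately have "Q \<in> \<A>"
      unfolding \<A>_def using RM \<open>M \<subseteq> Q\<close> by blast
    then show False
      using maximal \<open>M \<subseteq> Q\<close> \<open>(u, t) \<in> Q\<close> n by blast
  qed
  \<comment> \<open>The cone laws make this infimum sublinear; \<open>dichotomy\<close> adds
    \<open>\<Lambda> (- u) \<le> - \<Lambda> u\<close>, and a sublinear functional with this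
    property is linear.\<close>
  define \<Lambda> where "\<Lambda> u = Inf {t. (u, t) \<in> M}" for u
  have ne: "{t. (u, t) \<in> M} \<noteq> {}" if "u \<in> S" for u
    using total[OF that] RM by blast
  have neg: "- u \<in> S" if "u \<in> S" for u
    using subspace_neg[OF S that] .
  have bdd: "bdd_below {t. (u, t) \<in> M}" if u: "u \<in> S" for u
  proof -
    obtain s where "(- u, s) \<in> M" using ne[OF neg[OF u]] by blast
    then have "- s \<le> t" if "(u, t) \<in> M" for t
      using Mpos[of "t + s"] Madd[OF that, of "- u" s] by simp
    then show ?thesis by (intro bdd_belowI[of _ "- s"]) simp
  qed
  have le: "\<Lambda> u \<le> t" if "(u, t) \<in> M" for u t
  proof -
    have "u \<in> S" using that MS by blast
    then show ?thesis unfolding \<Lambda>_def using that bdd by (intro cInf_lower) auto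
  qed
  have greatest: "r \<le> \<Lambda> u" if "u \<in> S" "\<And>t. (u, t) \<in> M \<Longrightarrow> r \<le> t" for r u
    unfolding \<Lambda>_def using that ne by (intro cInf_greatest) auto
  have subadd: "\<Lambda> (u + v) \<le> \<Lambda> u + \<Lambda> v" if uv: "u \<in> S" "v \<in> S" for u v
  proof -
    have "\<Lambda> (u + v) - s \<le> \<Lambda> u" if s: "(v, s) \<in> M" for s
      by (rule greatest[OF uv(1)]) (use le Madd s in \<open>force simp: diff_le_eq\<close>)
    then have "\<Lambda> (u + v) - \<Lambda> u \<le> \<Lambda> v"
      by (intro greatest[OF uv(2)]) (simp add: algebra_simps)
    then show ?thesis by simp
  qed
  have odd: "\<Lambda> (- u) \<le> - \<Lambda> u" if u: "u \<in> S" for u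
  proof -
    have "\<Lambda> u \<le> - \<Lambda> (- u)"
    proof (rule dense_le)
      fix t assume "t < \<Lambda> u"
      then have "(u, t) \<notin> M" using le by force
      then show "t \<le> - \<Lambda> (- u)"
        using le[OF dichotomy[OF u]] by fastforce
    qed
    then show ?thesis by simp
  qed
  have add: "\<Lambda> (u + v) = \<Lambda> u + \<Lambda> v" if "u \<in> S" "v \<in> S" for u v
    using subadd[OF that] subadd[of "u + v" "- v"] odd[of v] neg that subspace_add[OF S that] by simp
  have zero: "\<Lambda> 0 = 0"
    using add[of 0 0] subspace_0[OF S] by simp
  have minus: "\<Lambda> (- u) = - \<Lambda> u" if "u \<in> S" for u
    using add[OF that neg[OF that]] zero by simp
  have scale_le: "\<Lambda> (c *\<^sub>R u) \<le> c * \<Lambda> u" if "0 < c" "u \<in> S" for c u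
  proof -
    have "\<Lambda> (c *\<^sub>R u) / c \<le> \<Lambda> u"
      using le Mscale that by (intro greatest) (force simp: divide_le_eq mult.commute)+
    then show ?thesis using that by (simp add: field_simps)
  qed
  have scale_pos: "\<Lambda> (c *\<^sub>R u) = c * \<Lambda> u" if "0 < c" "u \<in> S" for c u
  proof (rule antisym[OF scale_le[OF that]])
    have "\<Lambda> ((1 / c) *\<^sub>R (c *\<^sub>R u)) \<le> (1 / c) * \<Lambda> (c *\<^sub>R u)"
      using that by (intro scale_le subspace_scale[OF S]) simp_all
    then show "c * \<Lambda> u \<le> \<Lambda> (c *\<^sub>R u)"
      using that by (simp add: field_simps)
  qed
  have scale: "\<Lambda> (c *\<^sub>R u) = c * \<Lambda> u" if "u \<in> S" for c u
  proof -
    consider "0 < c" | "c = 0" | "0 < - c" by linarith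
    then show ?thesis
    proof cases
      case 3
      then have "\<Lambda> ((- c) *\<^sub>R u) = (- c) * \<Lambda> u" by (rule scale_pos[OF _ that])
      then show ?thesis using minus[OF subspace_scale[OF S that, of c]] by simp
    qed (use scale_pos that zero in auto)
  qed
  show ?thesis
  proof (rule that)
    show "linear_on S \<Lambda>"
      unfolding linear_on_def using add scale by simp
    show "\<Lambda> u \<le> t" if "(u, t) \<in> R" for u t
      using le RM that by blast
  qed
qed

section \<open>Positive functionals and their approximation by atoms\<close>

definition continuous_functions :: "'a topology \<Rightarrow> ('a \<Rightarrow> real) set" where
  "continuous_functions X = {u. continuous_map X euclideanreal u}"

lemma continuous_functionsI [intro]:
  "continuous_map X euclideanreal u \<Longrightarrow> u \<in> continuous_functions X"
  by (simp add: continuous_functions_def)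

lemma continuous_functionsD [dest]:
  "u \<in> continuous_functions X \<Longrightarrow> continuous_map X euclideanreal u"
  by (simp add: continuous_functions_def)

lemma subspace_continuous_functions: "subspace (continuous_functions X)"
  unfolding subspace_def continuous_functions_def
  by (simp add: zero_fun_def plus_fun_def scaleR_fun_def continuous_map_add continuous_map_real_mult_left)

text \<open>By Riesz' theorem these are the finite regular Borel measures; functionals avoid all
  questions of measurability. Values off \<open>topspace X\<close> have no influence: if
  \<open>u\<close> vanishes on the space, positivity applies to both \<open>u\<close> and
  \<open>- u\<close>.\<close>

definition positive_functional :: "'a topology \<Rightarrow> (('a \<Rightarrow> real) \<Rightarrow> real) \<Rightarrow> bool" where
  "positive_functional X \<Lambda> \<longleftrightarrow> linear_on (continuous_functions X) \<Lambda> \<and>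
     (\<forall>u\<in>continuous_functions X. (\<forall>x\<in>topspace X. 0 \<le> u x) \<longrightarrow> 0 \<le> \<Lambda> u)"

lemma positive_functional_add:
  assumes "positive_functional X \<Lambda>" "continuous_map X euclideanreal u" "continuous_map X euclideanreal v"
  shows "\<Lambda> (\<lambda>x. u x + v x) = \<Lambda> u + \<Lambda> v"
proof -
  have "\<Lambda> (u + v) = \<Lambda> u + \<Lambda> v"
    using assms unfolding positive_functional_def linear_on_def by blast
  then show ?thesis by (simp add: plus_fun_def)
qed

lemma positive_functional_mult:
  assumes "positive_functional X \<Lambda>" "continuous_map X euclideanreal u"
  shows "\<Lambda> (\<lambda>x. c * u x) = c * \<Lambda> u"
proof -
  have "\<Lambda> (c *\<^sub>R u) = c *\<^sub>R \<Lambda> u"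
    using assms unfolding positive_functional_def linear_on_def by blast
  then show ?thesis by (simp add: scaleR_fun_def)
qed

lemma positive_functional_diff:
  assumes "positive_functional X \<Lambda>" "continuous_map X euclideanreal u" "continuous_map X euclideanreal v"
  shows "\<Lambda> (\<lambda>x. u x - v x) = \<Lambda> u - \<Lambda> v"
  using positive_functional_add[OF assms(1,2), of "\<lambda>x. - 1 * v x"] positive_functional_mult[OF assms(1,3), of "- 1"]
    assms(3) by simp

lemma positive_functional_nonneg:
  assumes "positive_functional X \<Lambda>" "continuous_map X euclideanreal u" "\<And>x. x \<in> topspace X \<Longrightarrow> 0 \<le> u x"
  shows "0 \<le> \<Lambda> u"
  using assms unfolding positive_functional_def by blast

lemma positive_functional_mono:
  assumes "positive_functional X \<Lambda>" "continuous_map X euclideanreal u" "continuous_map X euclideanreal v"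
    "\<And>x. x \<in> topspace X \<Longrightarrow> u x \<le> v x"
  shows "\<Lambda> u \<le> \<Lambda> v"
  using positive_functional_nonneg[OF assms(1), of "\<lambda>x. v x - u x"] positive_functional_diff[OF assms(1,3,2)] assms
  by (simp add: continuous_map_diff)

lemma positive_functional_abs_le:
  assumes "positive_functional X \<Lambda>" "continuous_map X euclideanreal u" "continuous_map X euclideanreal v"
    "\<And>x. x \<in> topspace X \<Longrightarrow> \<bar>u x\<bar> \<le> v x"
  shows "\<bar>\<Lambda> u\<bar> \<le> \<Lambda> v"
proof -
  have "\<Lambda> (\<lambda>x. - 1 * u x) \<le> \<Lambda> v"
    by (intro positive_functional_mono[OF assms(1)] continuous_map_real_mult_left assms(2,3))
       (use assms(4) in force)
  moreover have "\<Lambda> u \<le> \<Lambda> v"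
    by (intro positive_functional_mono[OF assms(1)] assms(2,3)) (use assms(4) in force)
  ultimately show ?thesis
    using positive_functional_mult[OF assms(1,2), of "- 1"] by simp
qed

text \<open>In terms of measures, this is the measure with density \<open>r\<close>.\<close>

lemma positive_functional_weight:
  assumes "positive_functional X \<Lambda>" "continuous_map X euclideanreal r" "\<And>x. x \<in> topspace X \<Longrightarrow> 0 \<le> r x"
  shows "positive_functional X (\<lambda>u. \<Lambda> (\<lambda>x. r x * u x))"
  unfolding positive_functional_def linear_on_def
proof (intro conjI ballI allI impI)
  fix u v assume uv: "u \<in> continuous_functions X" "v \<in> continuous_functions X"
  have "\<Lambda> (\<lambda>x. r x * u x + r x * v x) = \<Lambda> (\<lambda>x. r x * u x) + \<Lambda> (\<lambda>x. r x * v x)"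
    using uv assms(2) by (intro positive_functional_add[OF assms(1)] continuous_map_real_mult) auto
  then show "\<Lambda> (\<lambda>x. r x * (u + v) x) = \<Lambda> (\<lambda>x. r x * u x) + \<Lambda> (\<lambda>x. r x * v x)"
    by (simp add: plus_fun_def algebra_simps)
next
  fix c u assume u: "u \<in> continuous_functions X"
  have "\<Lambda> (\<lambda>x. c * (r x * u x)) = c * \<Lambda> (\<lambda>x. r x * u x)"
    using u assms(2) by (intro positive_functional_mult[OF assms(1)] continuous_map_real_mult) auto
  then show "\<Lambda> (\<lambda>x. r x * (c *\<^sub>R u) x) = c *\<^sub>R \<Lambda> (\<lambda>x. r x * u x)"
    by (simp add: scaleR_fun_def algebra_simps)
next
  fix u assume u: "u \<in> continuous_functions X" "\<forall>x\<in>topspace X. 0 \<le> u x"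
  show "0 \<le> \<Lambda> (\<lambda>x. r x * u x)"
    using u assms by (intro positive_functional_nonneg[OF assms(1)] continuous_map_real_mult) auto
qed

text \<open>The function \<open>u\<close> nearly minimises \<open>\<Lambda>\<close> among the nonnegative majorants of the indicator of \<open>F\<close>.
  Hence multiplying \<open>u\<close> by a factor that is \<open>1\<close> on \<open>F\<close> hardly changes \<open>\<Lambda> u\<close>, so that the part of \<open>u\<close>
  on which \<open>w\<close> is far from \<open>c\<close> is negligible.\<close>

lemma positive_functional_near_indicator:
  assumes \<Lambda>: "positive_functional X \<Lambda>" and \<eta>: "0 < \<eta>"
  obtains u where "continuous_map X euclideanreal u" "\<And>x. 0 \<le> u x \<and> u x \<le> 1" "\<And>x. x \<in> F \<Longrightarrow> u x = 1"
    "\<And>w c \<epsilon>. continuous_map X euclideanreal w \<Longrightarrow> (\<And>x. x \<in> topspace X \<Longrightarrow> \<bar>w x\<bar> \<le> 1) \<Longrightarrow> \<bar>c\<bar> \<le> 1 \<Longrightarrow> 0 \<le> \<epsilon> \<Longrightarrow>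
      (\<And>x. x \<in> F \<Longrightarrow> \<bar>w x - c\<bar> \<le> \<epsilon>) \<Longrightarrow> \<bar>\<Lambda> (\<lambda>x. u x * w x) - c * \<Lambda> u\<bar> \<le> \<epsilon> * \<Lambda> u + \<eta>"
proof -
  let ?C = "continuous_map X euclideanreal"
  \<comment> \<open>The infimum of \<open>\<Lambda>\<close> over \<open>K\<close> acts as an outer
    measure of the arbitrary set \<open>F\<close>.\<close>
  define K where "K = {k. ?C k \<and> (\<forall>x. 0 \<le> k x) \<and> (\<forall>x\<in>F. 1 \<le> k x)}"
  have "(\<lambda>x. 1) \<in> K" unfolding K_def by simp
  then have ne: "\<Lambda> ` K \<noteq> {}" by blast
  have bdd: "bdd_below (\<Lambda> ` K)"
    by (rule bdd_belowI[of _ 0]) (auto simp: K_def intro: positive_functional_nonneg[OF \<Lambda>])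
  obtain k where k: "k \<in> K" "\<Lambda> k < Inf (\<Lambda> ` K) + \<eta> / 2"
    using cInf_lessD[OF ne, of "Inf (\<Lambda> ` K) + \<eta> / 2"] \<eta> by auto
  define u where "u x = min 1 (k x)" for x
  have u: "?C u"
    unfolding u_def using k unfolding K_def by (intro continuous_map_real_min) auto
  have "\<Lambda> u \<le> \<Lambda> k"
    by (intro positive_functional_mono[OF \<Lambda> u]) (use k in \<open>auto simp: K_def u_def\<close>)
  then have min: "\<Lambda> u \<le> \<Lambda> k' + \<eta> / 2" if "k' \<in> K" for k'
    using k(2) cInf_lower[OF imageI[OF that] bdd] by linarith
  show ?thesis
  proof (rule that[OF u])
    show u01: "0 \<le> u x \<and> u x \<le> 1" for x using k unfolding K_def u_def by simp
    show u1: "u x = 1" if "x \<in> F" for x using k that unfolding K_def u_def by auto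
    fix w c \<epsilon> assume w: "?C w" "\<And>x. x \<in> topspace X \<Longrightarrow> \<bar>w x\<bar> \<le> 1" and c: "\<bar>c\<bar> \<le> 1" and \<epsilon>: "0 \<le> (\<epsilon>::real)"
      and wF: "\<And>x. x \<in> F \<Longrightarrow> \<bar>w x - c\<bar> \<le> \<epsilon>"
    \<comment> \<open>The excess of \<open>\<bar>w x - c\<bar>\<close> over the tolerance, which is
      0 on \<open>F\<close>. The cap 2 bounds the deviation on the space and keeps
      \<open>1 - g x / 2\<close> nonnegative.\<close>
    define g where "g x = min 2 (max 0 (\<bar>w x - c\<bar> - \<epsilon>))" for x
    have g: "?C g"
      unfolding g_def by (intro continuous_map_real_min continuous_map_real_max continuous_map_diff
          continuous_map_real_abs w(1)) simp_all
    have g02: "0 \<le> g x" "g x \<le> 2" for x unfolding g_def by auto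
    have ug: "?C (\<lambda>x. u x * g x)" by (intro continuous_map_real_mult u g)
    \<comment> \<open>This competitor of \<open>u\<close> cannot lower \<open>\<Lambda>\<close> by
      more than \<open>\<eta> / 2\<close>, so \<open>u * g\<close> has mass at most
      \<open>\<eta>\<close>.\<close>
    have "(\<lambda>x. u x - 1/2 * (u x * g x)) \<in> K"
    proof -
      have "0 \<le> u x * (1 - g x / 2)" for x using u01 g02[of x] by (intro mult_nonneg_nonneg) auto
      then have "0 \<le> u x - 1/2 * (u x * g x)" for x by (simp add: algebra_simps)
      moreover have "g x = 0" if "x \<in> F" for x using wF[OF that] by (simp add: g_def)
      ultimately show ?thesis
        unfolding K_def mem_Collect_eq using u1
        by (intro conjI continuous_map_diff continuous_map_real_mult_left u ug) auto
    qed
    from min[OF this] have "\<Lambda> (\<lambda>x. u x * g x) \<le> \<eta>"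
      using positive_functional_diff[OF \<Lambda> u continuous_map_real_mult_left[OF ug, of "1/2"]]
        positive_functional_mult[OF \<Lambda> ug, of "1/2"] by simp
    moreover have "\<bar>\<Lambda> (\<lambda>x. u x * w x - c * u x)\<bar> \<le> \<Lambda> (\<lambda>x. \<epsilon> * u x + u x * g x)"
    proof (rule positive_functional_abs_le[OF \<Lambda>])
      show "?C (\<lambda>x. u x * w x - c * u x)" "?C (\<lambda>x. \<epsilon> * u x + u x * g x)"
        by (intro continuous_map_diff continuous_map_add continuous_map_real_mult continuous_map_real_mult_left u w g)+
      fix x assume "x \<in> topspace X"
      then have "\<bar>w x - c\<bar> \<le> 2" using w(2)[of x] c by linarith
      then have "\<bar>w x - c\<bar> \<le> \<epsilon> + g x" unfolding g_def using \<epsilon> by auto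
      then have "u x * \<bar>w x - c\<bar> \<le> u x * (\<epsilon> + g x)" using u01 by (intro mult_left_mono) auto
      moreover have "\<bar>u x * w x - c * u x\<bar> = u x * \<bar>w x - c\<bar>"
        using u01[of x] by (metis abs_mult abs_of_nonneg mult.commute right_diff_distrib)
      ultimately show "\<bar>u x * w x - c * u x\<bar> \<le> \<epsilon> * u x + u x * g x"
        by (simp add: algebra_simps)
    qed
    moreover have "\<Lambda> (\<lambda>x. \<epsilon> * u x + u x * g x) = \<epsilon> * \<Lambda> u + \<Lambda> (\<lambda>x. u x * g x)"
      using positive_functional_add[OF \<Lambda> continuous_map_real_mult_left[OF u, of \<epsilon>] ug]
        positive_functional_mult[OF \<Lambda> u] by simp
    moreover have "\<Lambda> (\<lambda>x. u x * w x - c * u x) = \<Lambda> (\<lambda>x. u x * w x) - c * \<Lambda> u"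
      using positive_functional_diff[OF \<Lambda> continuous_map_real_mult[OF u w(1)] continuous_map_real_mult_left[OF u, of c]]
        positive_functional_mult[OF \<Lambda> u] by simp
    ultimately show "\<bar>\<Lambda> (\<lambda>x. u x * w x) - c * \<Lambda> u\<bar> \<le> \<epsilon> * \<Lambda> u + \<eta>"
      by linarith
  qed
qed

text \<open>The compactness step of Dini's theorem: the open sets \<open>U n\<close> increase with
  \<open>n\<close>, so a finite subcover reduces to its last member.\<close>

lemma decreasing_to_zero_uniform:
  assumes X: "compact_space X" and r: "\<And>n. continuous_map X euclideanreal (r n)"
    and dec: "\<And>n x. r (Suc n) x \<le> r n x" and lim: "\<And>x. x \<in> topspace X \<Longrightarrow> \<exists>n. r n x < (e::real)"
  obtains n where "\<And>x. x \<in> topspace X \<Longrightarrow> r n x < e"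
proof -
  define U where "U n = {x \<in> topspace X. r n x \<in> {..<e}}" for n
  have U: "openin X (U n)" for n
    unfolding U_def by (rule openin_continuous_map_preimage[OF r]) simp
  have mono: "r n x \<le> r m x" if "m \<le> n" for m n x
    using dec that by (rule lift_Suc_antimono_le)
  have "topspace X \<subseteq> \<Union>(range U)"
    using lim unfolding U_def by auto
  then obtain \<F> where \<F>: "finite \<F>" "\<F> \<subseteq> range U" "topspace X \<subseteq> \<Union>\<F>"
    using X U unfolding compact_space_alt by (metis (no_types, lifting) rangeE)
  then obtain N where N: "finite N" "\<F> = U ` N"
    by (meson finite_subset_image)
  obtain n where n: "\<And>m. m \<in> N \<Longrightarrow> m \<le> n"
    using N(1) by (meson finite_nat_set_iff_bounded_le)
  show ?thesis
  proof (rule that[of n])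
    fix x assume "x \<in> topspace X"
    then obtain m where "m \<in> N" "x \<in> U m" using \<F>(3) N(2) by blast
    then show "r n x < e" using mono[OF n, of m x] unfolding U_def by auto
  qed
qed

text \<open>The sets \<open>F n\<close> are peeled off one after the other: \<open>r i\<close> is
  the density left before step \<open>i\<close>, \<open>u i\<close> is nearly the indicator of
  \<open>F i\<close> for the functional weighted by \<open>r i\<close>, and the mass of
  \<open>r i * u i\<close> is put at \<open>p i\<close>. As \<open>u n\<close> equals 1 on
  \<open>F n\<close>, the remaining density vanishes at \<open>x\<close> once a set containing
  \<open>x\<close> has been treated, and by Dini it is uniformly small after finitely many
  steps.\<close>

lemma positive_functional_atoms:
  fixes F :: "nat \<Rightarrow> 'a set"
  assumes X: "compact_space X" and \<Lambda>: "positive_functional X \<Lambda>" and F: "topspace X \<subseteq> (\<Union>n. F n)"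
    and p: "\<And>n. p n \<in> topspace X" and \<epsilon>: "0 \<le> \<epsilon>" and \<delta>: "0 < \<delta>"
  shows "\<exists>m a. \<forall>w. continuous_map X euclideanreal w \<longrightarrow> (\<forall>x\<in>topspace X. \<bar>w x\<bar> \<le> 1) \<longrightarrow>
      (\<forall>n. \<forall>x\<in>F n. \<bar>w x - w (p n)\<bar> \<le> \<epsilon>) \<longrightarrow>
      \<bar>\<Lambda> w - (\<Sum>i<m. a i * w (p i))\<bar> \<le> \<epsilon> * \<Lambda> (\<lambda>x. 1) + \<delta>"
proof -
  let ?C = "continuous_map X euclideanreal"
  \<comment> \<open>The peeling errors \<open>\<eta> / 2 ^ Suc i\<close> sum to at most
    \<open>\<eta>\<close>, and the remaining density contributes
    \<open>\<eta> * \<Lambda> (\<lambda>x. 1)\<close>; together they make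
    \<open>\<delta>\<close>.\<close>
  define \<eta> where "\<eta> = \<delta> / (1 + \<Lambda> (\<lambda>x. 1))"
  have \<Lambda>1: "0 \<le> \<Lambda> (\<lambda>x. 1)"
    by (rule positive_functional_nonneg[OF \<Lambda>]) simp_all
  then have "0 < \<eta>" "\<eta> * (1 + \<Lambda> (\<lambda>x. 1)) = \<delta>"
    unfolding \<eta>_def using \<delta> by auto
  then have \<eta>: "0 < \<eta>" "\<eta> + \<eta> * \<Lambda> (\<lambda>x. 1) = \<delta>"
    by (simp_all add: distrib_left)
  define P where "P i r u \<longleftrightarrow> ?C u \<and> (\<forall>x. 0 \<le> u x \<and> u x \<le> 1) \<and> (\<forall>x\<in>F i. u x = 1) \<and>
      (\<forall>w. ?C w \<and> (\<forall>x\<in>topspace X. \<bar>w x\<bar> \<le> 1) \<and> (\<forall>x\<in>F i. \<bar>w x - w (p i)\<bar> \<le> \<epsilon>) \<longrightarrow>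
        \<bar>\<Lambda> (\<lambda>x. r x * (u x * w x)) - w (p i) * \<Lambda> (\<lambda>x. r x * u x)\<bar> \<le> \<epsilon> * \<Lambda> (\<lambda>x. r x * u x) + \<eta> / 2 ^ Suc i)"
    for i and r u :: "'a \<Rightarrow> real"
  have ex: "\<exists>u. P i r u" if r: "?C r" "\<And>x. 0 \<le> r x" for i r
  proof -
    have pos: "positive_functional X (\<lambda>u. \<Lambda> (\<lambda>x. r x * u x))"
      by (rule positive_functional_weight[OF \<Lambda> r])
    have "0 < \<eta> / 2 ^ Suc i" using \<eta> by simp
    show ?thesis
    proof (rule positive_functional_near_indicator[OF pos \<open>0 < \<eta> / 2 ^ Suc i\<close>, of "F i"])
      fix u assume u: "?C u" "\<And>x. 0 \<le> u x \<and> u x \<le> 1" "\<And>x. x \<in> F i \<Longrightarrow> u x = 1"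
        "\<And>w c \<epsilon>. ?C w \<Longrightarrow> (\<And>x. x \<in> topspace X \<Longrightarrow> \<bar>w x\<bar> \<le> 1) \<Longrightarrow> \<bar>c\<bar> \<le> 1 \<Longrightarrow> 0 \<le> \<epsilon> \<Longrightarrow>
        (\<And>x. x \<in> F i \<Longrightarrow> \<bar>w x - c\<bar> \<le> \<epsilon>) \<Longrightarrow>
        \<bar>\<Lambda> (\<lambda>x. r x * (u x * w x)) - c * \<Lambda> (\<lambda>x. r x * u x)\<bar> \<le> \<epsilon> * \<Lambda> (\<lambda>x. r x * u x) + \<eta> / 2 ^ Suc i"
      have "P i r u"
        unfolding P_def
      proof (intro conjI allI ballI impI u(1); (elim conjE)?)
        fix w assume "?C w" and w: "\<forall>x\<in>topspace X. \<bar>w x\<bar> \<le> 1" "\<forall>x\<in>F i. \<bar>w x - w (p i)\<bar> \<le> \<epsilon>"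
        then show "\<bar>\<Lambda> (\<lambda>x. r x * (u x * w x)) - w (p i) * \<Lambda> (\<lambda>x. r x * u x)\<bar> \<le> \<epsilon> * \<Lambda> (\<lambda>x. r x * u x) + \<eta> / 2 ^ Suc i"
          using p[of i] \<epsilon> by (intro u(4)) auto
      qed (use u(2,3) in auto)
      then show ?thesis by blast
    qed
  qed
  \<comment> \<open>The choice is made for every \<open>r\<close>, so that the recursion can be
    written down before its continuity and nonnegativity are known.\<close>
  define U where "U i r = (SOME u. P i r u)" for i r
  define r where "r = rec_nat (\<lambda>x. 1) (\<lambda>i r x. r x * (1 - U i r x))"
  have r0: "r 0 = (\<lambda>x. 1)" and rS: "r (Suc i) = (\<lambda>x. r i x * (1 - U i (r i) x))" for i
    unfolding r_def by simp_all
  define u where "u i = U i (r i)" for i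
  have PU: "P i s (U i s)" if "?C s" "\<And>x. 0 \<le> s x" for i s
    unfolding U_def using ex[OF that] by (rule someI_ex)
  have rC: "?C (r i) \<and> (\<forall>x. 0 \<le> r i x)" for i
  proof (induction i)
    case 0 then show ?case by (simp add: r0)
  next
    case (Suc i)
    then have "P i (r i) (U i (r i))" using PU by blast
    then have "?C (U i (r i))" "\<And>x. U i (r i) x \<le> 1" unfolding P_def by blast+
    then show ?case
      unfolding rS using Suc by (auto intro!: continuous_map_real_mult continuous_map_diff)
  qed
  have Pu: "P i (r i) (u i)" for i
    unfolding u_def using PU rC by blast
  have uC: "?C (u i)" and u01: "0 \<le> u i x" "u i x \<le> 1" and u1: "x \<in> F i \<Longrightarrow> u i x = 1" for i x
    using Pu[of i] unfolding P_def by blast+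
  have rS': "r (Suc i) x = r i x - r i x * u i x" for i x
    unfolding rS u_def by (simp add: algebra_simps)
  have dec: "r (Suc i) x \<le> r i x" for i x
    unfolding rS' using rC[of i] u01(1)[of i x] by simp
  have "\<exists>n. r n x < \<eta>" if x: "x \<in> topspace X" for x
  proof -
    obtain n where "x \<in> F n" using F x by blast
    then have "r (Suc n) x = 0" unfolding rS' using u1 by simp
    then show ?thesis using \<eta> by (intro exI[of _ "Suc n"]) simp
  qed
  then obtain m where m: "\<And>x. x \<in> topspace X \<Longrightarrow> r m x < \<eta>"
    using decreasing_to_zero_uniform[OF X, of r \<eta>] rC dec by blast
  define a where "a i = \<Lambda> (\<lambda>x. r i x * u i x)" for i
  have ruC: "?C (\<lambda>x. r i x * u i x)" for i
    using rC uC by (intro continuous_map_real_mult) auto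
  \<comment> \<open>Telescoping of \<open>r (Suc i) = r i - r i * u i\<close>, starting from the
    constant density 1.\<close>
  have split: "\<Lambda> w = (\<Sum>i<n. \<Lambda> (\<lambda>x. r i x * (u i x * w x))) + \<Lambda> (\<lambda>x. r n x * w x)" if w: "?C w" for w n
  proof (induction n)
    case 0 then show ?case by (simp add: r0)
  next
    case (Suc n)
    have "?C (\<lambda>x. r n x * w x)" "?C (\<lambda>x. r n x * (u n x * w x))"
      using rC uC w by (intro continuous_map_real_mult; auto)+
    then have "\<Lambda> (\<lambda>x. r n x * w x - r n x * (u n x * w x)) = \<Lambda> (\<lambda>x. r n x * w x) - \<Lambda> (\<lambda>x. r n x * (u n x * w x))"
      by (rule positive_functional_diff[OF \<Lambda>])
    moreover have "(\<lambda>x. r n x * w x - r n x * (u n x * w x)) = (\<lambda>x. r (Suc n) x * w x)"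
      by (simp add: rS' fun_eq_iff algebra_simps)
    ultimately show ?case using Suc by simp
  qed
  have suma: "(\<Sum>i<n. a i) \<le> \<Lambda> (\<lambda>x. 1)" for n
  proof -
    have "0 \<le> \<Lambda> (\<lambda>x. r n x * 1)"
      using rC by (intro positive_functional_nonneg[OF \<Lambda>]) auto
    then show ?thesis
      using split[of "\<lambda>x. 1" n] unfolding a_def by simp
  qed
  show ?thesis
  proof (rule exI[of _ m], rule exI[of _ a], intro allI impI)
    fix w assume w: "?C w" and w1: "\<forall>x\<in>topspace X. \<bar>w x\<bar> \<le> 1"
      and wF: "\<forall>n. \<forall>x\<in>F n. \<bar>w x - w (p n)\<bar> \<le> \<epsilon>"
    have step: "\<bar>\<Lambda> (\<lambda>x. r i x * (u i x * w x)) - a i * w (p i)\<bar> \<le> \<epsilon> * a i + \<eta> / 2 ^ Suc i" for i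
      using Pu[of i] w w1 wF unfolding P_def a_def by (simp add: mult.commute)
    have "\<bar>\<Lambda> (\<lambda>x. r m x * w x)\<bar> \<le> \<Lambda> (\<lambda>x. \<eta> * 1)"
    proof (rule positive_functional_abs_le[OF \<Lambda>])
      show "?C (\<lambda>x. r m x * w x)" using rC w by (intro continuous_map_real_mult) auto
      fix x assume x: "x \<in> topspace X"
      have "\<bar>r m x * w x\<bar> = r m x * \<bar>w x\<bar>" using rC[of m] by (simp add: abs_mult)
      also have "\<dots> \<le> \<eta> * 1" using m[OF x] bspec[OF w1 x] rC[of m] \<eta> by (intro mult_mono) auto
      finally show "\<bar>r m x * w x\<bar> \<le> \<eta> * 1" .
    qed simp
    also have "\<dots> = \<eta> * \<Lambda> (\<lambda>x. 1)" by (rule positive_functional_mult[OF \<Lambda>]) simp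
    finally have rest: "\<bar>\<Lambda> (\<lambda>x. r m x * w x)\<bar> \<le> \<eta> * \<Lambda> (\<lambda>x. 1)" .
    have geo: "(\<Sum>i<m. \<eta> / 2 ^ Suc i) \<le> \<eta>"
    proof -
      have "(\<Sum>i<n. \<eta> / 2 ^ Suc i) = \<eta> * (1 - 1 / 2 ^ n)" for n
        by (induction n) (auto simp: field_simps)
      then show ?thesis using \<eta> by simp
    qed
    have "\<bar>\<Sum>i<m. \<Lambda> (\<lambda>x. r i x * (u i x * w x)) - a i * w (p i)\<bar> \<le> (\<Sum>i<m. \<epsilon> * a i + \<eta> / 2 ^ Suc i)"
      by (rule order.trans[OF sum_abs sum_mono]) (rule step)
    also have "\<dots> = \<epsilon> * (\<Sum>i<m. a i) + (\<Sum>i<m. \<eta> / 2 ^ Suc i)"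
      by (simp add: sum.distrib sum_distrib_left)
    also have "\<dots> \<le> \<epsilon> * \<Lambda> (\<lambda>x. 1) + \<eta>"
      using suma \<epsilon> geo by (intro add_mono mult_left_mono)
    finally have "\<bar>(\<Sum>i<m. \<Lambda> (\<lambda>x. r i x * (u i x * w x))) - (\<Sum>i<m. a i * w (p i))\<bar> \<le> \<epsilon> * \<Lambda> (\<lambda>x. 1) + \<eta>"
      by (simp add: sum_subtractf)
    then show "\<bar>\<Lambda> w - (\<Sum>i<m. a i * w (p i))\<bar> \<le> \<epsilon> * \<Lambda> (\<lambda>x. 1) + \<delta>"
      using split[OF w, of m] rest \<eta>(2) by linarith
  qed
qed

section \<open>Elementary facts on norms, linear maps and continuous real functions\<close>

lemma norm_onD:
  assumes "norm_on V N"
  shows "subspace V" "v \<in> V \<Longrightarrow> 0 \<le> N v" "v \<in> V \<Longrightarrow> N v = 0 \<longleftrightarrow> v = 0"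
    "v \<in> V \<Longrightarrow> N (c *\<^sub>R v) = \<bar>c\<bar> * N v" "v \<in> V \<Longrightarrow> w \<in> V \<Longrightarrow> N (v + w) \<le> N v + N w"
  using assms unfolding norm_on_def by simp_all

lemma norm_on_zero: "norm_on V N \<Longrightarrow> N 0 = 0"
  by (simp add: norm_onD(3) norm_onD(1) subspace_0)

lemma norm_on_minus:
  assumes "norm_on V N" "v \<in> V"
  shows "N (- v) = N v"
  using norm_onD(4)[OF assms, of "- 1"] by simp

lemma linear_onD:
  assumes "linear_on V f"
  shows "v \<in> V \<Longrightarrow> w \<in> V \<Longrightarrow> f (v + w) = f v + f w" "v \<in> V \<Longrightarrow> f (c *\<^sub>R v) = c *\<^sub>R f v"
  using assms unfolding linear_on_def by simp_all

lemma linear_on_zero: "subspace V \<Longrightarrow> linear_on V f \<Longrightarrow> f 0 = 0"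
  using linear_onD(2)[of V f 0 0] subspace_0 by fastforce

lemma linear_on_minus: "linear_on V f \<Longrightarrow> v \<in> V \<Longrightarrow> f (- v) = - f v"
  using linear_onD(2)[of V f v "- 1"] by simp

lemma continuous_map_real_bounded:
  assumes "compact_space X" "continuous_map X euclideanreal u"
  obtains b where "0 \<le> b" "\<And>x. x \<in> topspace X \<Longrightarrow> \<bar>u x\<bar> \<le> b"
proof -
  have "compactin euclideanreal (u ` topspace X)"
    using assms by (intro image_compactin) (auto simp: compact_space_def)
  then have "bounded (u ` topspace X)"
    by (simp add: compact_imp_bounded)
  then obtain b where "\<And>x. x \<in> topspace X \<Longrightarrow> \<bar>u x\<bar> \<le> b"
    unfolding bounded_iff by auto
  then show ?thesis
    by (intro that[of "max 0 b"]) (auto simp: le_max_iff_disj)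
qed

lemma continuous_map_real_uniform_limit:
  fixes v :: "'a \<Rightarrow> real"
  assumes "\<And>e. 0 < e \<Longrightarrow> \<exists>u. continuous_map X euclideanreal u \<and> (\<forall>x\<in>topspace X. \<bar>u x - v x\<bar> < e)"
  shows "continuous_map X euclideanreal v"
proof -
  have "\<exists>u. continuous_map X euclideanreal u \<and> (\<forall>x\<in>topspace X. \<bar>u x - v x\<bar> < 1 / Suc n)" for n
    by (rule assms) simp
  then obtain u where u: "\<And>n. continuous_map X euclideanreal (u n)"
    "\<And>n x. x \<in> topspace X \<Longrightarrow> \<bar>u n x - v x\<bar> < 1 / Suc n"
    by metis
  have "continuous_map X Met_TC.mtopology v"
  proof (rule Met_TC.continuous_map_uniform_limit[of X u sequentially])
    show "\<forall>\<^sub>F n in sequentially. continuous_map X Met_TC.mtopology (u n)"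
      using u(1) by simp
    show "\<forall>\<^sub>F n in sequentially. \<forall>x\<in>topspace X. v x \<in> UNIV \<and> dist (u n x) (v x) < e" if e: "0 < e" for e
    proof -
      have "\<forall>\<^sub>F n in sequentially. 1 / Suc n < e"
        using e by (rule order_tendstoD(2)[OF LIMSEQ_Suc[OF lim_1_over_n]])
      then show ?thesis
        by (rule eventually_mono) (use u(2) in \<open>force simp: dist_real_def intro: less_trans\<close>)
    qed
  qed simp
  then show ?thesis by simp
qed

section \<open>Little Lipschitz spaces\<close>

definition lip_bound :: "'a topology \<Rightarrow> ('a \<Rightarrow> 'a \<Rightarrow> real) \<Rightarrow> ('a \<Rightarrow> real) \<Rightarrow> real \<Rightarrow> bool" where
  "lip_bound X \<rho> v K \<longleftrightarrow> 0 \<le> K \<and> (\<forall>x\<in>topspace X. \<bar>v x\<bar> \<le> K) \<and>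
     (\<forall>x\<in>topspace X. \<forall>y\<in>topspace X. \<bar>v x - v y\<bar> \<le> K * \<rho> x y)"

text \<open>The maximum of the sup norm and the Lipschitz constant. An infimum of common bounds
  avoids quotients by \<open>\<rho> x y\<close>, which may vanish for distinct points.\<close>

definition lip_norm :: "'a topology \<Rightarrow> ('a \<Rightarrow> 'a \<Rightarrow> real) \<Rightarrow> ('a \<Rightarrow> real) \<Rightarrow> real" where
  "lip_norm X \<rho> v = Inf {K. lip_bound X \<rho> v K}"

text \<open>The value 0 off the space makes 0 the only function of norm 0.\<close>

definition little_lip :: "'a topology \<Rightarrow> ('a \<Rightarrow> 'a \<Rightarrow> real) \<Rightarrow> ('a \<Rightarrow> real) set" where
  "little_lip X \<rho> = {v. continuous_map X euclideanreal v \<and> (\<forall>x. x \<notin> topspace X \<longrightarrow> v x = 0) \<and>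
     (\<forall>e>0. \<exists>r>0. \<forall>x\<in>topspace X. \<forall>y\<in>topspace X. \<rho> x y < r \<longrightarrow> \<bar>v x - v y\<bar> \<le> e * \<rho> x y)}"

lemma little_lipD:
  assumes "v \<in> little_lip X \<rho>"
  shows "continuous_map X euclideanreal v" "x \<notin> topspace X \<Longrightarrow> v x = 0"
    "0 < e \<Longrightarrow> \<exists>r>0. \<forall>x\<in>topspace X. \<forall>y\<in>topspace X. \<rho> x y < r \<longrightarrow> \<bar>v x - v y\<bar> \<le> e * \<rho> x y"
  using assms unfolding little_lip_def by blast+

lemma lip_boundD:
  assumes "lip_bound X \<rho> v K"
  shows "0 \<le> K" "x \<in> topspace X \<Longrightarrow> \<bar>v x\<bar> \<le> K"
    "x \<in> topspace X \<Longrightarrow> y \<in> topspace X \<Longrightarrow> \<bar>v x - v y\<bar> \<le> K * \<rho> x y"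
  using assms unfolding lip_bound_def by auto

text \<open>The last assumption is the only link between \<open>\<rho>\<close> and the topology; the
  gauge itself is in general discontinuous.\<close>

locale fragmenting_gauge =
  fixes X :: "'a topology" and \<rho> :: "'a \<Rightarrow> 'a \<Rightarrow> real"
  assumes compact: "compact_space X"
    and gauge_nonneg: "0 \<le> \<rho> x y"
    and fragments: "A \<subseteq> topspace X \<Longrightarrow> A \<noteq> {} \<Longrightarrow> 0 < e \<Longrightarrow>
      \<exists>U. openin X U \<and> U \<inter> A \<noteq> {} \<and> (\<forall>x\<in>U \<inter> A. \<forall>y\<in>U \<inter> A. \<rho> x y \<le> e)"
begin

abbreviation "S \<equiv> topspace X"
abbreviation "V \<equiv> little_lip X \<rho>"
abbreviation "N \<equiv> lip_norm X \<rho>"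

lemma lip_bound_mono: "lip_bound X \<rho> v K \<Longrightarrow> K \<le> K' \<Longrightarrow> lip_bound X \<rho> v K'"
  unfolding lip_bound_def using gauge_nonneg by (meson mult_right_mono order_trans)

lemma lip_bound_add:
  assumes "lip_bound X \<rho> v K" "lip_bound X \<rho> w L"
  shows "lip_bound X \<rho> (v + w) (K + L)"
  unfolding lip_bound_def
proof (intro conjI ballI)
  show "0 \<le> K + L" using assms[THEN lip_boundD(1)] by simp
  fix x assume x: "x \<in> S"
  show "\<bar>(v + w) x\<bar> \<le> K + L"
    using lip_boundD(2)[OF assms(1) x] lip_boundD(2)[OF assms(2) x] by (simp add: plus_fun_def)
  fix y assume "y \<in> S"
  then show "\<bar>(v + w) x - (v + w) y\<bar> \<le> (K + L) * \<rho> x y"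
    using lip_boundD(3)[OF assms(1) x, of y] lip_boundD(3)[OF assms(2) x, of y]
    by (simp add: plus_fun_def distrib_right)
qed

lemma lip_bound_scaleR:
  assumes "lip_bound X \<rho> v K"
  shows "lip_bound X \<rho> (c *\<^sub>R v) (\<bar>c\<bar> * K)"
  unfolding lip_bound_def
proof (intro conjI ballI)
  show "0 \<le> \<bar>c\<bar> * K" using lip_boundD(1)[OF assms] by simp
  fix x assume x: "x \<in> S"
  show "\<bar>(c *\<^sub>R v) x\<bar> \<le> \<bar>c\<bar> * K"
    using lip_boundD(2)[OF assms x] by (simp add: scaleR_fun_def abs_mult mult_left_mono)
  fix y assume "y \<in> S"
  then have "\<bar>c\<bar> * \<bar>v x - v y\<bar> \<le> \<bar>c\<bar> * (K * \<rho> x y)"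
    using lip_boundD(3)[OF assms x] by (intro mult_left_mono) auto
  then show "\<bar>(c *\<^sub>R v) x - (c *\<^sub>R v) y\<bar> \<le> \<bar>c\<bar> * K * \<rho> x y"
    by (simp add: scaleR_fun_def mult.assoc flip: right_diff_distrib abs_mult)
qed

lemma little_lip_bounded:
  assumes "v \<in> V"
  shows "\<exists>K. lip_bound X \<rho> v K"
proof -
  obtain b where b: "0 \<le> b" "\<And>x. x \<in> S \<Longrightarrow> \<bar>v x\<bar> \<le> b"
    using continuous_map_real_bounded[OF compact little_lipD(1)[OF assms]] by blast
  obtain r where r: "r > 0" "\<forall>x\<in>S. \<forall>y\<in>S. \<rho> x y < r \<longrightarrow> \<bar>v x - v y\<bar> \<le> 1 * \<rho> x y"
    using little_lipD(3)[OF assms zero_less_one] by blast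
  \<comment> \<open>Pairs at distance below \<open>r\<close> need the constant 1, the others
    \<open>2 * b / r\<close>; the summand \<open>max 1 b\<close> also covers the sup bound.\<close>
  define K where "K = max 1 b + 2 * b / r"
  have K: "1 \<le> K" "b \<le> K" "2 * b / r \<le> K"
    unfolding K_def using b(1) r(1) by (auto simp: add_increasing2)
  have "\<bar>v x - v y\<bar> \<le> K * \<rho> x y" if "x \<in> S" "y \<in> S" for x y
  proof (cases "\<rho> x y < r")
    case True
    then have "\<bar>v x - v y\<bar> \<le> 1 * \<rho> x y" using r(2) that by blast
    also have "\<dots> \<le> K * \<rho> x y" using K(1) gauge_nonneg by (rule mult_right_mono)
    finally show ?thesis .
  next
    case False
    have "\<bar>v x - v y\<bar> \<le> 2 * b" using b(2)[OF that(1)] b(2)[OF that(2)] by linarith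
    also have "\<dots> = 2 * b / r * r" using r(1) by simp
    also have "\<dots> \<le> K * \<rho> x y" using K r(1) False by (intro mult_mono) auto
    finally show ?thesis .
  qed
  then show ?thesis
    unfolding lip_bound_def using K b(2) by (meson order_trans zero_le_one)
qed

lemma lip_norm_le: "lip_bound X \<rho> v K \<Longrightarrow> N v \<le> K"
  unfolding lip_norm_def by (intro cInf_lower) (auto simp: lip_bound_def intro!: bdd_belowI[of _ 0])

text \<open>The infimum is attained because every inequality in \<open>lip_bound\<close> is a closed
  condition on \<open>K\<close>. At distance 0 any bound already forces equal values.\<close>

lemma lip_bound_norm:
  assumes "v \<in> V"
  shows "lip_bound X \<rho> v (N v)"
proof -
  have ne: "{K. lip_bound X \<rho> v K} \<noteq> {}" using little_lip_bounded[OF assms] by blast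
  show ?thesis
    unfolding lip_bound_def
  proof (intro conjI ballI)
    show "0 \<le> N v"
      unfolding lip_norm_def by (rule cInf_greatest[OF ne]) (simp add: lip_bound_def)
    fix x assume x: "x \<in> S"
    show "\<bar>v x\<bar> \<le> N v"
      unfolding lip_norm_def by (rule cInf_greatest[OF ne]) (use x in \<open>simp add: lip_bound_def\<close>)
    fix y assume y: "y \<in> S"
    show "\<bar>v x - v y\<bar> \<le> N v * \<rho> x y"
    proof (cases "\<rho> x y = 0")
      case True
      then show ?thesis using little_lip_bounded[OF assms] x y unfolding lip_bound_def by fastforce
    next
      case False
      then have pos: "0 < \<rho> x y" using gauge_nonneg[of x y] by simp
      have "\<bar>v x - v y\<bar> / \<rho> x y \<le> N v"
        unfolding lip_norm_def
        by (rule cInf_greatest[OF ne]) (use x y pos in \<open>simp add: lip_bound_def divide_le_eq\<close>)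
      then show ?thesis using pos by (simp add: divide_le_eq)
    qed
  qed
qed

lemma lip_norm_nonneg: "v \<in> V \<Longrightarrow> 0 \<le> N v"
  by (rule lip_boundD(1)[OF lip_bound_norm])

lemma abs_le_lip_norm: "v \<in> V \<Longrightarrow> x \<in> S \<Longrightarrow> \<bar>v x\<bar> \<le> N v"
  by (rule lip_boundD(2)[OF lip_bound_norm])

lemma subspace_little_lip: "subspace V"
  unfolding subspace_def
proof (intro conjI ballI allI)
  show "0 \<in> V"
    unfolding little_lip_def using gauge_nonneg by (auto simp: zero_fun_def intro!: exI[of _ 1])
  fix v w assume vw: "v \<in> V" "w \<in> V"
  have "\<exists>r>0. \<forall>x\<in>S. \<forall>y\<in>S. \<rho> x y < r \<longrightarrow> \<bar>(v + w) x - (v + w) y\<bar> \<le> e * \<rho> x y" if e: "0 < e" for e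
  proof -
    have e2: "0 < e / 2" using e by simp
    obtain r where r: "r > 0" "\<forall>x\<in>S. \<forall>y\<in>S. \<rho> x y < r \<longrightarrow> \<bar>v x - v y\<bar> \<le> e / 2 * \<rho> x y"
      using little_lipD(3)[OF vw(1) e2] by blast
    obtain r' where r': "r' > 0" "\<forall>x\<in>S. \<forall>y\<in>S. \<rho> x y < r' \<longrightarrow> \<bar>w x - w y\<bar> \<le> e / 2 * \<rho> x y"
      using little_lipD(3)[OF vw(2) e2] by blast
    have "\<bar>(v + w) x - (v + w) y\<bar> \<le> e * \<rho> x y" if "x \<in> S" "y \<in> S" "\<rho> x y < min r r'" for x y
    proof -
      have "\<bar>v x - v y\<bar> \<le> e / 2 * \<rho> x y" "\<bar>w x - w y\<bar> \<le> e / 2 * \<rho> x y"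
        using r r' that by auto
      then show ?thesis unfolding plus_fun_def by linarith
    qed
    then show ?thesis using r r' by (intro exI[of _ "min r r'"]) auto
  qed
  then show "v + w \<in> V"
    using little_lipD(1,2)[OF vw(1)] little_lipD(1,2)[OF vw(2)] unfolding little_lip_def
    by (auto simp: plus_fun_def intro: continuous_map_add)
next
  fix c and v assume v: "v \<in> V"
  have "\<exists>r>0. \<forall>x\<in>S. \<forall>y\<in>S. \<rho> x y < r \<longrightarrow> \<bar>(c *\<^sub>R v) x - (c *\<^sub>R v) y\<bar> \<le> e * \<rho> x y" if e: "0 < e" for e
  proof -
    have pos: "0 < e / (1 + \<bar>c\<bar>)" using e by simp
    obtain r where r: "r > 0" "\<forall>x\<in>S. \<forall>y\<in>S. \<rho> x y < r \<longrightarrow> \<bar>v x - v y\<bar> \<le> e / (1 + \<bar>c\<bar>) * \<rho> x y"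
      using little_lipD(3)[OF v pos] by blast
    have "\<bar>(c *\<^sub>R v) x - (c *\<^sub>R v) y\<bar> \<le> e * \<rho> x y" if "x \<in> S" "y \<in> S" "\<rho> x y < r" for x y
    proof -
      have "\<bar>(c *\<^sub>R v) x - (c *\<^sub>R v) y\<bar> = \<bar>c\<bar> * \<bar>v x - v y\<bar>"
        by (simp add: scaleR_fun_def flip: right_diff_distrib abs_mult)
      also have "\<dots> \<le> (1 + \<bar>c\<bar>) * (e / (1 + \<bar>c\<bar>) * \<rho> x y)"
        using r that by (intro mult_mono) auto
      also have "\<dots> = e * \<rho> x y" by simp
      finally show ?thesis .
    qed
    then show ?thesis using r by blast
  qed
  then show "c *\<^sub>R v \<in> V"
    using little_lipD(1,2)[OF v] unfolding little_lip_def
    by (auto simp: scaleR_fun_def intro: continuous_map_real_mult_left)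
qed

lemma norm_on_little_lip: "norm_on V N"
  unfolding norm_on_def
proof (intro conjI ballI allI)
  show "subspace V" by (rule subspace_little_lip)
  fix v assume v: "v \<in> V"
  show "0 \<le> N v" by (rule lip_norm_nonneg[OF v])
  show "N v = 0 \<longleftrightarrow> v = 0"
  proof
    assume "N v = 0"
    then show "v = 0"
      using abs_le_lip_norm[OF v] little_lipD(2)[OF v] by (auto simp: zero_fun_def fun_eq_iff)
  next
    assume "v = 0"
    then have "lip_bound X \<rho> v 0" unfolding lip_bound_def by (simp add: zero_fun_def)
    then show "N v = 0" using lip_norm_le lip_norm_nonneg[OF v] by (meson antisym)
  qed
  fix w assume w: "w \<in> V"
  show "N (v + w) \<le> N v + N w"
    by (intro lip_norm_le lip_bound_add lip_bound_norm v w)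
next
  fix c and v assume v: "v \<in> V"
  have le: "N (c *\<^sub>R v) \<le> \<bar>c\<bar> * N v" if "v \<in> V" for c v
    by (intro lip_norm_le lip_bound_scaleR lip_bound_norm that)
  show "N (c *\<^sub>R v) = \<bar>c\<bar> * N v"
  proof (cases "c = 0")
    case True
    then show ?thesis
      using le[OF v, of c] lip_norm_nonneg[OF subspace_scale[OF subspace_little_lip v, of c]] by simp
  next
    case False
    have "N ((1 / c) *\<^sub>R (c *\<^sub>R v)) \<le> \<bar>1 / c\<bar> * N (c *\<^sub>R v)"
      by (intro le subspace_scale[OF subspace_little_lip] v)
    then have "\<bar>c\<bar> * N v \<le> N (c *\<^sub>R v)" using False by (simp add: field_simps)
    then show ?thesis using le[OF v, of c] by simp
  qed
qed

text \<open>Bounds on \<open>s m - s n\<close> pass to the pointwise limit in \<open>n\<close>. The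
  limit then inherits the little-o condition from one \<open>s m\<close> that is close to it in the
  Lipschitz sense.\<close>

lemma banach_on_little_lip: "banach_on V N"
  unfolding banach_on_def
proof (intro conjI allI impI norm_on_little_lip; elim conjE)
  fix s :: "nat \<Rightarrow> 'a \<Rightarrow> real"
  assume sV: "\<forall>n. s n \<in> V" and cauchy: "\<forall>e>0. \<exists>M. \<forall>m\<ge>M. \<forall>n\<ge>M. N (s m - s n) < e"
  have diff: "s m - s n \<in> V" for m n
    using sV by (intro subspace_diff[OF subspace_little_lip]) auto
  have C: "Cauchy (\<lambda>n. s n x)" for x
  proof (cases "x \<in> S")
    case True
    show ?thesis
    proof (rule metric_CauchyI)
      fix e :: real assume "0 < e"
      then obtain M where M: "\<And>m n. m \<ge> M \<Longrightarrow> n \<ge> M \<Longrightarrow> N (s m - s n) < e" using cauchy by meson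
      have "dist (s m x) (s n x) < e" if "m \<ge> M" "n \<ge> M" for m n
        using abs_le_lip_norm[OF diff[of m n] True] M[OF that] by (simp add: dist_real_def fun_diff_def)
      then show "\<exists>M. \<forall>m\<ge>M. \<forall>n\<ge>M. dist (s m x) (s n x) < e" by blast
    qed
  next
    case False
    have "s n x = 0" for n by (rule little_lipD(2)[OF sV[rule_format] False])
    then show ?thesis by (simp add: Cauchy_def)
  qed
  define v where "v x = lim (\<lambda>n. s n x)" for x
  have v: "(\<lambda>n. s n x) \<longlonglongrightarrow> v x" for x
    unfolding v_def using C[of x] by (simp add: Cauchy_convergent_iff convergent_LIMSEQ_iff)
  \<comment> \<open>The estimate uses \<open>lip_bound\<close> because the norm is controlled only
    on \<open>V\<close>, and \<open>v\<close> is not yet known to be a member.\<close>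
  have approx: "\<exists>M. \<forall>m\<ge>M. lip_bound X \<rho> (s m - v) e" if e: "0 < e" for e
  proof -
    obtain M where M: "\<And>m n. m \<ge> M \<Longrightarrow> n \<ge> M \<Longrightarrow> N (s m - s n) < e" using cauchy e by meson
    have b: "lip_bound X \<rho> (s m - s n) e" if "m \<ge> M" "n \<ge> M" for m n
      using lip_bound_mono[OF lip_bound_norm[OF diff]] M[OF that] by simp
    have "lip_bound X \<rho> (s m - v) e" if m: "m \<ge> M" for m
      unfolding lip_bound_def
    proof (intro conjI ballI)
      show "0 \<le> e" using e by simp
      fix x assume x: "x \<in> S"
      have "(\<lambda>n. \<bar>s m x - s n x\<bar>) \<longlonglongrightarrow> \<bar>s m x - v x\<bar>"
        by (intro tendsto_intros v)
      moreover have "\<bar>s m x - s n x\<bar> \<le> e" if "n \<ge> M" for n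
        using lip_boundD(2)[OF b[OF m that] x] by simp
      ultimately show "\<bar>(s m - v) x\<bar> \<le> e"
        by (simp add: LIMSEQ_le_const2[OF _ exI[of _ M]])
      fix y assume y: "y \<in> S"
      have "(\<lambda>n. \<bar>(s m x - s n x) - (s m y - s n y)\<bar>) \<longlonglongrightarrow> \<bar>(s m x - v x) - (s m y - v y)\<bar>"
        by (intro tendsto_intros v)
      moreover have "\<bar>(s m x - s n x) - (s m y - s n y)\<bar> \<le> e * \<rho> x y" if "n \<ge> M" for n
        using lip_boundD(3)[OF b[OF m that] x y] by simp
      ultimately show "\<bar>(s m - v) x - (s m - v) y\<bar> \<le> e * \<rho> x y"
        by (simp add: LIMSEQ_le_const2[OF _ exI[of _ M]])
    qed
    then show ?thesis by blast
  qed
  have "v \<in> V"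
    unfolding little_lip_def mem_Collect_eq
  proof (intro conjI allI impI)
    show "continuous_map X euclideanreal v"
    proof (rule continuous_map_real_uniform_limit)
      fix e :: real assume "0 < e"
      then obtain m where m: "lip_bound X \<rho> (s m - v) (e / 2)" using approx[of "e / 2"] by auto
      have "\<bar>s m x - v x\<bar> < e" if "x \<in> S" for x
        using lip_boundD(2)[OF m that] \<open>0 < e\<close> by simp
      then show "\<exists>u. continuous_map X euclideanreal u \<and> (\<forall>x\<in>S. \<bar>u x - v x\<bar> < e)"
        using little_lipD(1)[OF sV[rule_format]] by blast
    qed
    show "v x = 0" if "x \<notin> S" for x
    proof -
      have "s n x = 0" for n by (rule little_lipD(2)[OF sV[rule_format] that])
      then show ?thesis using v[of x] by (simp add: LIMSEQ_const_iff)
    qed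
    fix e :: real assume "0 < e"
    then have e: "0 < e / 2" by simp
    obtain m where m: "lip_bound X \<rho> (s m - v) (e / 2)" using approx[OF e] by auto
    obtain r where r: "r > 0" "\<forall>x\<in>S. \<forall>y\<in>S. \<rho> x y < r \<longrightarrow> \<bar>s m x - s m y\<bar> \<le> e / 2 * \<rho> x y"
      using little_lipD(3)[OF sV[rule_format] e, of m] by blast
    have "\<bar>v x - v y\<bar> \<le> e * \<rho> x y" if "x \<in> S" "y \<in> S" "\<rho> x y < r" for x y
    proof -
      have "\<bar>s m x - s m y\<bar> \<le> e / 2 * \<rho> x y" using r that by blast
      moreover have "\<bar>(s m x - v x) - (s m y - v y)\<bar> \<le> e / 2 * \<rho> x y"
        using lip_boundD(3)[OF m that(1,2)] by simp
      ultimately show ?thesis by linarith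
    qed
    then show "\<exists>r>0. \<forall>x\<in>S. \<forall>y\<in>S. \<rho> x y < r \<longrightarrow> \<bar>v x - v y\<bar> \<le> e * \<rho> x y"
      using r by blast
  qed
  moreover have "(\<lambda>n. N (s n - v)) \<longlonglongrightarrow> 0"
  proof (rule LIMSEQ_I)
    fix e :: real assume "0 < e"
    then obtain M where M: "\<And>m. m \<ge> M \<Longrightarrow> lip_bound X \<rho> (s m - v) (e / 2)"
      using approx[of "e / 2"] by auto
    have "norm (N (s n - v) - 0) < e" if "n \<ge> M" for n
    proof -
      have "0 \<le> N (s n - v)"
        using sV \<open>v \<in> V\<close> by (intro lip_norm_nonneg subspace_diff[OF subspace_little_lip]) auto
      then show ?thesis using lip_norm_le[OF M[OF that]] \<open>0 < e\<close> by simp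
    qed
    then show "\<exists>M. \<forall>n\<ge>M. norm (N (s n - v) - 0) < e" by blast
  qed
  ultimately show "\<exists>v\<in>V. (\<lambda>n. N (s n - v)) \<longlonglongrightarrow> 0" by blast
qed

text \<open>The sum of a function with one that is sup-small but of norm \<open>1\<close>: the first is flat at the small
  scales of the gauge, the second at the large ones, so the bound hardly grows.\<close>

lemma lip_bound_gliding_hump:
  assumes s: "s \<in> V" "lip_bound X \<rho> s K" and \<kappa>: "0 < \<kappa>" "1 \<le> K"
  obtains \<eta> where "0 < \<eta>"
    "\<And>w. lip_bound X \<rho> w 1 \<Longrightarrow> (\<And>x. x \<in> S \<Longrightarrow> \<bar>w x\<bar> \<le> \<eta>) \<Longrightarrow> lip_bound X \<rho> (s + w) (K + \<kappa>)"
proof -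
  obtain r where r: "r > 0" "\<forall>x\<in>S. \<forall>y\<in>S. \<rho> x y < r \<longrightarrow> \<bar>s x - s y\<bar> \<le> \<kappa> * \<rho> x y"
    using little_lipD(3)[OF s(1) \<kappa>(1)] by blast
  \<comment> \<open>The first term keeps the sup bound. The second makes \<open>w\<close> vary by at
    most \<open>\<kappa> * r\<close>, hence by at most \<open>\<kappa> * \<rho> x y\<close> on pairs
    at distance at least \<open>r\<close>.\<close>
  define \<eta> where "\<eta> = min \<kappa> (\<kappa> * r / 2)"
  show ?thesis
  proof (rule that[of \<eta>])
    show "0 < \<eta>" unfolding \<eta>_def using r \<kappa> by simp
    fix w assume w: "lip_bound X \<rho> w 1" and small: "\<And>x. x \<in> S \<Longrightarrow> \<bar>w x\<bar> \<le> \<eta>"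
    show "lip_bound X \<rho> (s + w) (K + \<kappa>)"
      unfolding lip_bound_def
    proof (intro conjI ballI)
      show "0 \<le> K + \<kappa>" using \<kappa> by simp
      fix x assume x: "x \<in> S"
      have "\<bar>s x\<bar> \<le> K" "\<bar>w x\<bar> \<le> \<kappa>"
        using lip_boundD(2)[OF s(2) x] small[OF x] unfolding \<eta>_def by auto
      then show "\<bar>(s + w) x\<bar> \<le> K + \<kappa>" unfolding plus_fun_def by linarith
      fix y assume y: "y \<in> S"
      have "\<bar>s x - s y\<bar> + \<bar>w x - w y\<bar> \<le> (K + \<kappa>) * \<rho> x y"
      \<comment> \<open>Near pairs pay \<open>\<kappa>\<close> for \<open>s\<close> and 1 for
        \<open>w\<close>, which \<open>1 \<le> K\<close> absorbs; far pairs pay \<open>K\<close> for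
        \<open>s\<close> and \<open>\<kappa>\<close> for \<open>w\<close>.\<close>
      proof (cases "\<rho> x y < r")
        case True
        then have "\<bar>s x - s y\<bar> \<le> \<kappa> * \<rho> x y" using r x y by blast
        moreover have "\<bar>w x - w y\<bar> \<le> 1 * \<rho> x y" by (rule lip_boundD(3)[OF w x y])
        moreover have "1 * \<rho> x y \<le> K * \<rho> x y" using \<kappa>(2) gauge_nonneg by (rule mult_right_mono)
        ultimately show ?thesis by (simp add: distrib_right)
      next
        case False
        have "\<bar>w x - w y\<bar> \<le> \<kappa> * r"
          using small[OF x] small[OF y] unfolding \<eta>_def by linarith
        also have "\<dots> \<le> \<kappa> * \<rho> x y" using False \<kappa> by simp
        finally show ?thesis using lip_boundD(3)[OF s(2) x y] by (simp add: distrib_right)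
      qed
      then show "\<bar>(s + w) x - (s + w) y\<bar> \<le> (K + \<kappa>) * \<rho> x y"
        unfolding plus_fun_def by linarith
    qed
  qed
qed

section \<open>Functionals on subspaces, and their approximation by positive functionals\<close>

lemma functional_small_on_sup_small:
  assumes W: "subspace W" "W \<subseteq> V" and \<phi>: "linear_on W \<phi>" "\<And>w. w \<in> W \<Longrightarrow> \<bar>\<phi> w\<bar> \<le> C * N w"
    and \<delta>: "0 < (\<delta>::real)"
  obtains \<eta> where "0 < \<eta>"
    "\<And>w. w \<in> W \<Longrightarrow> lip_bound X \<rho> w 1 \<Longrightarrow> (\<And>x. x \<in> S \<Longrightarrow> \<bar>w x\<bar> \<le> \<eta>) \<Longrightarrow> \<phi> w \<le> \<delta>"
proof (rule ccontr)
  note obt = that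
  assume contra: "\<not> thesis"
  have ex: "\<exists>w\<in>W. lip_bound X \<rho> w 1 \<and> (\<forall>x\<in>S. \<bar>w x\<bar> \<le> \<eta>) \<and> \<delta> < \<phi> w" if "0 < \<eta>" for \<eta>
  proof (rule ccontr)
    assume "\<not> ?thesis"
    then have "\<phi> w \<le> \<delta>" if "w \<in> W" "lip_bound X \<rho> w 1" "\<And>x. x \<in> S \<Longrightarrow> \<bar>w x\<bar> \<le> \<eta>" for w
      using that by (meson not_le)
    then show False using contra obt[OF \<open>0 < \<eta>\<close>] by blast
  qed
  \<comment> \<open>Here \<open>s\<close> is a sum of \<open>m\<close> functions on each of which
    \<open>\<phi>\<close> exceeds \<open>\<delta>\<close>. The next one costs
    \<open>(1/2) ^ Suc m\<close>, so the bound starts at 1, as the gliding hump requires, and never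
    reaches 2, while \<open>\<phi> s\<close> grows without limit.\<close>
  have "\<exists>s\<in>W. lip_bound X \<rho> s (2 - (1/2) ^ m) \<and> m * \<delta> \<le> \<phi> s" for m
  proof (induction m)
    case 0
    have "lip_bound X \<rho> 0 (2 - (1/2) ^ 0)"
      unfolding lip_bound_def using gauge_nonneg by (simp add: zero_fun_def)
    moreover have "real 0 * \<delta> \<le> \<phi> 0" using linear_on_zero[OF W(1) \<phi>(1)] by simp
    ultimately show ?case using subspace_0[OF W(1)] by blast
  next
    case (Suc m)
    then obtain s where s: "s \<in> W" "lip_bound X \<rho> s (2 - (1/2) ^ m)" "m * \<delta> \<le> \<phi> s" by blast
    have "(1/2::real) ^ m \<le> 1" by (simp add: power_le_one)
    then have "0 < (1/2::real) ^ Suc m" "1 \<le> 2 - (1/2::real) ^ m" by simp_all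
    then obtain \<eta> where "0 < \<eta>" and \<eta>: "\<And>w. lip_bound X \<rho> w 1 \<Longrightarrow> (\<And>x. x \<in> S \<Longrightarrow> \<bar>w x\<bar> \<le> \<eta>) \<Longrightarrow>
        lip_bound X \<rho> (s + w) (2 - (1/2) ^ m + (1/2) ^ Suc m)"
      using lip_bound_gliding_hump[OF _ s(2)] s(1) W(2) by blast
    obtain w where w: "w \<in> W" "lip_bound X \<rho> w 1" "\<forall>x\<in>S. \<bar>w x\<bar> \<le> \<eta>" "\<delta> < \<phi> w"
      using ex[OF \<open>0 < \<eta>\<close>] by blast
    have "lip_bound X \<rho> (s + w) (2 - (1/2) ^ m + (1/2) ^ Suc m)" using \<eta> w by blast
    moreover have "2 - (1/2) ^ m + (1/2) ^ Suc m = 2 - (1/2::real) ^ Suc m" by simp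
    ultimately have "lip_bound X \<rho> (s + w) (2 - (1/2) ^ Suc m)" by metis
    moreover have "\<phi> (s + w) = \<phi> s + \<phi> w" by (rule linear_onD(1)[OF \<phi>(1) s(1) w(1)])
    then have "real (Suc m) * \<delta> \<le> \<phi> (s + w)" using s(3) w(4) by (simp add: distrib_right)
    moreover have "s + w \<in> W" by (rule subspace_add[OF W(1) s(1) w(1)])
    ultimately show ?case by blast
  qed
  then obtain s where s: "\<And>m. s m \<in> W" "\<And>m. lip_bound X \<rho> (s m) (2 - (1/2) ^ m)" "\<And>m::nat. m * \<delta> \<le> \<phi> (s m)"
    by metis
  have "m * \<delta> \<le> \<bar>C\<bar> * 2" for m :: nat
  proof -
    have "N (s m) \<le> 2" using lip_norm_le[OF s(2)[of m]] by (smt (verit) zero_le_power divide_nonneg_nonneg)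
    moreover have "0 \<le> N (s m)" using s(1) W(2) lip_norm_nonneg by blast
    ultimately have "C * N (s m) \<le> \<bar>C\<bar> * 2" by (intro mult_mono) auto
    then show ?thesis using s(3)[of m] \<phi>(2)[OF s(1)[of m]] by linarith
  qed
  moreover obtain m :: nat where "\<bar>C\<bar> * 2 / \<delta> < m" using reals_Archimedean2 by blast
  ultimately show False using \<delta> by (metis not_less pos_divide_less_eq)
qed

text \<open>The homogeneous form of the previous estimate. If \<open>b\<close> is small relative to
  the norm, rescaling to norm 1 gives the first summand; otherwise the norm is at most
  \<open>b / \<eta>\<close>, and the boundedness of \<open>\<phi>\<close> gives the second with
  \<open>M = \<bar>C\<bar> / \<eta>\<close>.\<close>

lemma functional_bound_split:
  assumes W: "subspace W" "W \<subseteq> V" and \<phi>: "linear_on W \<phi>" "\<And>w. w \<in> W \<Longrightarrow> \<bar>\<phi> w\<bar> \<le> C * N w"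
    and \<delta>: "0 < (\<delta>::real)"
  obtains M where "0 \<le> M"
    "\<And>w b. w \<in> W \<Longrightarrow> 0 \<le> b \<Longrightarrow> (\<And>x. x \<in> S \<Longrightarrow> \<bar>w x\<bar> \<le> b) \<Longrightarrow> \<phi> w \<le> \<delta> * N w + M * b"
proof -
  obtain \<eta> where \<eta>: "0 < \<eta>"
    "\<And>w. w \<in> W \<Longrightarrow> lip_bound X \<rho> w 1 \<Longrightarrow> (\<And>x. x \<in> S \<Longrightarrow> \<bar>w x\<bar> \<le> \<eta>) \<Longrightarrow> \<phi> w \<le> \<delta>"
    using functional_small_on_sup_small[OF W \<phi> \<delta>] by blast
  show ?thesis
  proof (rule that[of "\<bar>C\<bar> / \<eta>"])
    show "0 \<le> \<bar>C\<bar> / \<eta>" using \<eta>(1) by simp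
    fix w b assume w: "w \<in> W" and b: "0 \<le> b" "\<And>x. x \<in> S \<Longrightarrow> \<bar>w x\<bar> \<le> b"
    have wV: "w \<in> V" using w W by blast
    define t where "t = N w"
    have t0: "0 \<le> t" unfolding t_def by (rule lip_norm_nonneg[OF wV])
    show "\<phi> w \<le> \<delta> * N w + \<bar>C\<bar> / \<eta> * b"
    proof (cases "0 < t \<and> b \<le> \<eta> * t")
      case True
      then have t: "0 < t" by blast
      have "(1 / t) *\<^sub>R w \<in> W" by (rule subspace_scale[OF W(1) w])
      moreover have "lip_bound X \<rho> ((1 / t) *\<^sub>R w) 1"
        using lip_bound_scaleR[OF lip_bound_norm[OF wV], of "1 / t"] t unfolding t_def by simp
      moreover have "\<bar>((1 / t) *\<^sub>R w) x\<bar> \<le> \<eta>" if "x \<in> S" for x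
        using b(2)[OF that] True by (simp add: scaleR_fun_def divide_le_eq)
      ultimately have "\<phi> ((1 / t) *\<^sub>R w) \<le> \<delta>" by (rule \<eta>(2))
      moreover have "\<phi> ((1 / t) *\<^sub>R w) = (1 / t) *\<^sub>R \<phi> w" by (rule linear_onD(2)[OF \<phi>(1) w])
      ultimately have "\<phi> w \<le> \<delta> * t" using t by (simp add: divide_le_eq)
      moreover have "0 \<le> \<bar>C\<bar> / \<eta> * b" using \<eta>(1) b(1) by simp
      ultimately show ?thesis unfolding t_def by linarith
    next
      case False
      then have "\<eta> * t \<le> b" using t0 b(1) by (cases "t = 0") auto
      then have "t \<le> b / \<eta>" using \<eta>(1) by (simp add: field_simps)
      then have "C * t \<le> \<bar>C\<bar> * (b / \<eta>)" using t0 by (intro mult_mono) auto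
      moreover have "\<phi> w \<le> C * t" using \<phi>(2)[OF w] unfolding t_def by linarith
      moreover have "0 \<le> \<delta> * t" using \<delta> t0 by simp
      ultimately show ?thesis unfolding t_def by simp
    qed
  qed
qed

text \<open>The cone below encodes a functional on pairs \<open>(u\<^sub>1, u\<^sub>2)\<close> of continuous functions that is dominated by
  the positive part of \<open>max u\<^sub>1 u\<^sub>2\<close> and nearly equals \<open>\<phi> w\<close> at \<open>(w, -w)\<close>. Its two components
  are thus positive, and \<open>\<phi>\<close> is close to their difference.\<close>

lemma functional_approx_positive:
  assumes W: "subspace W" "W \<subseteq> V" and \<phi>: "linear_on W \<phi>" "\<And>w. w \<in> W \<Longrightarrow> \<bar>\<phi> w\<bar> \<le> C * N w"
    and \<delta>: "0 < (\<delta>::real)"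
  shows "\<exists>\<Lambda> \<Lambda>'. positive_functional X \<Lambda> \<and> positive_functional X \<Lambda>' \<and>
    (\<forall>w\<in>W. \<bar>\<phi> w - (\<Lambda> w - \<Lambda>' w)\<bar> \<le> \<delta> * N w)"
proof -
  let ?C = "continuous_functions X"
  obtain M where M: "0 \<le> M"
    "\<And>w b. w \<in> W \<Longrightarrow> 0 \<le> b \<Longrightarrow> (\<And>x. x \<in> S \<Longrightarrow> \<bar>w x\<bar> \<le> b) \<Longrightarrow> \<phi> w \<le> \<delta> * N w + M * b"
    using functional_bound_split[OF W \<phi> \<delta>] by blast
  note \<phi>add = linear_onD(1)[OF \<phi>(1)] and \<phi>neg = linear_on_minus[OF \<phi>(1)]
    and \<phi>0 = linear_on_zero[OF W(1) \<phi>(1)]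
  have \<phi>scale: "\<phi> (c *\<^sub>R w) = c * \<phi> w" if "w \<in> W" for c w
    using linear_onD(2)[OF \<phi>(1) that] by simp
  have W0: "0 \<in> W" by (rule subspace_0[OF W(1)])
  note norm = norm_on_little_lip
  note N0 = norm_on_zero[OF norm]
  have Nadd: "N (v + w) \<le> N v + N w" if "v \<in> W" "w \<in> W" for v w
    using norm_onD(5)[OF norm] that W(2) by (meson subsetD)
  have Nscale: "N (c *\<^sub>R w) = \<bar>c\<bar> * N w" if "w \<in> W" for c w
    using norm_onD(4)[OF norm] that W(2) by (meson subsetD)
  have Nneg: "N (- w) = N w" if "w \<in> W" for w using Nscale[OF that, of "-1"] by simp
  have WC: "w \<in> ?C" if "w \<in> W" for w using that W(2) little_lipD(1) by blast
  \<comment> \<open>Up to closure, the epigraph of a sublinear functional: the infimum of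
    \<open>M * b + \<phi> w + \<delta> * N w\<close> over all \<open>w\<close> and \<open>b\<close>
    such that \<open>b\<close> bounds \<open>u - w\<close> and \<open>u' + w\<close> from
    above.\<close>
  define R where "R = {((u, u'), t). u \<in> ?C \<and> u' \<in> ?C \<and>
    (\<exists>w\<in>W. \<exists>b\<ge>0. (\<forall>x\<in>S. u x - w x \<le> b \<and> u' x + w x \<le> b) \<and> M * b + \<phi> w + \<delta> * N w \<le> t)}"
  have RI: "((u, u'), t) \<in> R" if "u \<in> ?C" "u' \<in> ?C" "w \<in> W" "0 \<le> b"
    "\<And>x. x \<in> S \<Longrightarrow> u x - w x \<le> b" "\<And>x. x \<in> S \<Longrightarrow> u' x + w x \<le> b"
    "M * b + \<phi> w + \<delta> * N w \<le> t" for u u' w b t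
    unfolding R_def using that by (auto intro!: bexI[of _ w] exI[of _ b])
  have RE: "\<exists>u u' t w b. p = ((u, u'), t) \<and> u \<in> ?C \<and> u' \<in> ?C \<and> w \<in> W \<and> 0 \<le> b \<and>
      (\<forall>x\<in>S. u x - w x \<le> b) \<and> (\<forall>x\<in>S. u' x + w x \<le> b) \<and> M * b + \<phi> w + \<delta> * N w \<le> t" if "p \<in> R" for p
    using that unfolding R_def by blast
  have Cadd: "u + v \<in> ?C" if "u \<in> ?C" "v \<in> ?C" for u v
    by (rule subspace_add[OF subspace_continuous_functions that])
  have Cscale: "c *\<^sub>R u \<in> ?C" if "u \<in> ?C" for u c
    by (rule subspace_scale[OF subspace_continuous_functions that])
  have C0: "0 \<in> ?C" by (rule subspace_0[OF subspace_continuous_functions])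
  have "real_cone R"
    unfolding real_cone_def
  proof (intro conjI ballI allI impI)
    fix p q assume "p \<in> R" "q \<in> R"
    then obtain u u' t w b v v' s z d where
      p: "p = ((u, u'), t)" "u \<in> ?C" "u' \<in> ?C" "w \<in> W" "0 \<le> b" "\<forall>x\<in>S. u x - w x \<le> b"
        "\<forall>x\<in>S. u' x + w x \<le> b" "M * b + \<phi> w + \<delta> * N w \<le> t" and
      q: "q = ((v, v'), s)" "v \<in> ?C" "v' \<in> ?C" "z \<in> W" "0 \<le> d" "\<forall>x\<in>S. v x - z x \<le> d"
        "\<forall>x\<in>S. v' x + z x \<le> d" "M * d + \<phi> z + \<delta> * N z \<le> s"
      using RE by metis
    have "\<delta> * N (w + z) \<le> \<delta> * N w + \<delta> * N z"
      using mult_left_mono[OF Nadd[OF p(4) q(4)], of \<delta>] \<delta> by (simp add: distrib_left)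
    then have "M * (b + d) + \<phi> (w + z) + \<delta> * N (w + z) \<le> t + s"
      using p(8) q(8) by (simp add: \<phi>add[OF p(4) q(4)] distrib_left)
    moreover have "(u + v) x - (w + z) x \<le> b + d" "(u' + v') x + (w + z) x \<le> b + d" if "x \<in> S" for x
      using bspec[OF p(6) that] bspec[OF p(7) that] bspec[OF q(6) that] bspec[OF q(7) that]
      unfolding plus_fun_def by linarith+
    ultimately have "((u + v, u' + v'), t + s) \<in> R"
      using p q by (intro RI[of _ _ "w + z" "b + d"] Cadd subspace_add[OF W(1)]) auto
    then show "p + q \<in> R" unfolding p(1) q(1) by simp
  next
    fix c :: real and p assume c: "0 < c" and "p \<in> R"
    then obtain u u' t w b where
      p: "p = ((u, u'), t)" "u \<in> ?C" "u' \<in> ?C" "w \<in> W" "0 \<le> b" "\<forall>x\<in>S. u x - w x \<le> b"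
        "\<forall>x\<in>S. u' x + w x \<le> b" "M * b + \<phi> w + \<delta> * N w \<le> t"
      using RE by metis
    have "M * (c * b) + \<phi> (c *\<^sub>R w) + \<delta> * N (c *\<^sub>R w) = c * (M * b + \<phi> w + \<delta> * N w)"
      using c by (simp add: \<phi>scale[OF p(4)] Nscale[OF p(4)] algebra_simps)
    also have "\<dots> \<le> c * t" using p(8) c by simp
    finally have "M * (c * b) + \<phi> (c *\<^sub>R w) + \<delta> * N (c *\<^sub>R w) \<le> c * t" .
    moreover have "(c *\<^sub>R u) x - (c *\<^sub>R w) x \<le> c * b" "(c *\<^sub>R u') x + (c *\<^sub>R w) x \<le> c * b" if "x \<in> S" for x
      using mult_left_mono[OF bspec[OF p(6) that], of c] mult_left_mono[OF bspec[OF p(7) that], of c] c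
      by (simp_all add: scaleR_fun_def algebra_simps)
    ultimately have "((c *\<^sub>R u, c *\<^sub>R u'), c * t) \<in> R"
      using p c by (intro RI[of _ _ "c *\<^sub>R w" "c * b"] Cscale subspace_scale[OF W(1)]) auto
    then show "c *\<^sub>R p \<in> R" unfolding p(1) by simp
  qed
  moreover have "R \<subseteq> (?C \<times> ?C) \<times> UNIV" unfolding R_def by blast
  moreover have "((0, 0), t) \<in> R" if "0 \<le> t" for t
    using that by (intro RI[OF C0 C0 W0 order.refl]) (simp_all add: \<phi>0 N0)
  then have "(0, t) \<in> R" if "0 \<le> t" for t using that by (simp add: zero_prod_def)
  moreover have "\<exists>t. (p, t) \<in> R" if p: "p \<in> ?C \<times> ?C" for p
  proof -
    obtain u u' where u: "p = (u, u')" "u \<in> ?C" "u' \<in> ?C" using p by blast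
    obtain b where b: "0 \<le> b" "\<And>x. x \<in> S \<Longrightarrow> \<bar>u x\<bar> \<le> b"
      using continuous_map_real_bounded[OF compact] u(2) by blast
    obtain d where d: "0 \<le> d" "\<And>x. x \<in> S \<Longrightarrow> \<bar>u' x\<bar> \<le> d"
      using continuous_map_real_bounded[OF compact] u(3) by blast
    have "((u, u'), M * (b + d) + \<phi> 0 + \<delta> * N 0) \<in> R"
    proof (rule RI[OF u(2,3) W0, of "b + d"])
      show "u x - 0 x \<le> b + d" "u' x + 0 x \<le> b + d" if "x \<in> S" for x
        using b(2)[OF that] d(2)[OF that] b(1) d(1) unfolding zero_fun_def by linarith+
    qed (use b d in auto)
    then show ?thesis unfolding u(1) by blast
  qed
  \<comment> \<open>At the zero pair the constraints say that \<open>b\<close> bounds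
    \<open>\<bar>w\<bar>\<close>, so the consistency of the cone is the bound of
    \<open>functional_bound_split\<close> at \<open>- w\<close>.\<close>
  moreover have "0 \<le> t" if tR: "(0, t) \<in> R" for t
  proof -
    obtain u u' s w b where "(0, t) = ((u, u'), s)" and w: "w \<in> W" "0 \<le> b"
      "\<forall>x\<in>S. u x - w x \<le> b" "\<forall>x\<in>S. u' x + w x \<le> b" and t: "M * b + \<phi> w + \<delta> * N w \<le> s"
      using RE[OF tR] by metis
    then have u: "u = 0" "u' = 0" "s = t" by (simp_all add: zero_prod_def)
    have "\<bar>(- w) x\<bar> \<le> b" if "x \<in> S" for x
      using bspec[OF w(3) that] bspec[OF w(4) that] by (simp add: u fun_Compl_def abs_le_iff)
    then have "\<phi> (- w) \<le> \<delta> * N (- w) + M * b"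
      using w(1,2) by (intro M(2) subspace_neg[OF W(1)]) auto
    then show ?thesis using t by (simp add: u \<phi>neg[OF w(1)] Nneg[OF w(1)])
  qed
  ultimately obtain \<Lambda> where lin: "linear_on (?C \<times> ?C) \<Lambda>" and le: "\<And>p t. (p, t) \<in> R \<Longrightarrow> \<Lambda> p \<le> (t::real)"
    using linear_functional_of_cone[of "?C \<times> ?C" R] subspace_Times subspace_continuous_functions by metis
  note \<Lambda>add = linear_onD(1)[OF lin] and \<Lambda>scale = linear_onD(2)[OF lin] and \<Lambda>neg = linear_on_minus[OF lin]
  have nonneg: "0 \<le> \<Lambda> (u, u')" if "u \<in> ?C" "u' \<in> ?C" "\<And>x. x \<in> S \<Longrightarrow> 0 \<le> u x" "\<And>x. x \<in> S \<Longrightarrow> 0 \<le> u' x" for u u'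
  proof -
    \<comment> \<open>The choice \<open>w = 0\<close>, \<open>b = 0\<close> bounds
      \<open>\<Lambda>\<close> by 0 at pairs of functions that are nonpositive on the space.\<close>
    have "((- u, - u'), 0) \<in> R"
      using that by (intro RI[of _ _ 0 0] W0 subspace_neg[OF subspace_continuous_functions])
        (simp_all add: \<phi>0 N0 fun_Compl_def)
    then show ?thesis using le[of "(- u, - u')" 0] \<Lambda>neg[of "(u, u')"] that by simp
  qed
  show ?thesis
  proof (rule exI[of _ "\<lambda>u. \<Lambda> (u, 0)"], rule exI[of _ "\<lambda>u. \<Lambda> (0, u)"], intro conjI ballI)
    show "positive_functional X (\<lambda>u. \<Lambda> (u, 0))"
      unfolding positive_functional_def linear_on_def
    proof (intro conjI ballI allI impI)
      show "\<Lambda> (u + v, 0) = \<Lambda> (u, 0) + \<Lambda> (v, 0)" if "u \<in> ?C" "v \<in> ?C" for u v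
        using \<Lambda>add[of "(u, 0)" "(v, 0)"] that C0 by simp
      show "\<Lambda> (c *\<^sub>R u, 0) = c *\<^sub>R \<Lambda> (u, 0)" if "u \<in> ?C" for c u
        using \<Lambda>scale[of "(u, 0)" c] that C0 by simp
      show "0 \<le> \<Lambda> (u, 0)" if "u \<in> ?C" "\<forall>x\<in>S. 0 \<le> u x" for u
        using that C0 by (intro nonneg) (auto simp: zero_fun_def)
    qed
    show "positive_functional X (\<lambda>u. \<Lambda> (0, u))"
      unfolding positive_functional_def linear_on_def
    proof (intro conjI ballI allI impI)
      show "\<Lambda> (0, u + v) = \<Lambda> (0, u) + \<Lambda> (0, v)" if "u \<in> ?C" "v \<in> ?C" for u v
        using \<Lambda>add[of "(0, u)" "(0, v)"] that C0 by simp
      show "\<Lambda> (0, c *\<^sub>R u) = c *\<^sub>R \<Lambda> (0, u)" if "u \<in> ?C" for c u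
        using \<Lambda>scale[of "(0, u)" c] that C0 by simp
      show "0 \<le> \<Lambda> (0, u)" if "u \<in> ?C" "\<forall>x\<in>S. 0 \<le> u x" for u
        using that C0 by (intro nonneg) (auto simp: zero_fun_def)
    qed
    fix w assume w: "w \<in> W"
    \<comment> \<open>Subtracting \<open>(w, - w)\<close> leaves nothing, so \<open>b = 0\<close> is
      allowed; the lower estimate is the same one at \<open>- w\<close>.\<close>
    have upper: "\<Lambda> (w, - w) \<le> \<phi> w + \<delta> * N w" if "w \<in> W" for w
    proof -
      have "((w, - w), \<phi> w + \<delta> * N w) \<in> R"
        using WC[OF that] that by (intro RI[of _ _ w 0] subspace_neg[OF subspace_continuous_functions]) (simp_all add: fun_Compl_def)
      then show ?thesis by (rule le)
    qed
    have wC: "w \<in> ?C" "- w \<in> ?C" using WC w subspace_neg[OF W(1)] by blast+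
    have "\<Lambda> (w, - w) = \<Lambda> (w, 0) - \<Lambda> (0, w)"
      using \<Lambda>add[of "(w, 0)" "(0, - w)"] \<Lambda>neg[of "(0, w)"] wC C0 by simp
    moreover have "\<Lambda> (- w, w) = - \<Lambda> (w, - w)"
      using \<Lambda>neg[of "(w, - w)"] wC by simp
    ultimately show "\<bar>\<phi> w - (\<Lambda> (w, 0) - \<Lambda> (0, w))\<bar> \<le> \<delta> * N w"
      using upper[OF w] upper[OF subspace_neg[OF W(1) w]] \<phi>neg[OF w] Nneg[OF w] by simp
  qed
qed

section \<open>Separability of the dual of a separable subspace\<close>

lemma separable_countable_cover:
  assumes W: "W \<subseteq> V" "subspace W" and sep: "norm_separable W N" and e: "0 < e"
  obtains F :: "nat \<Rightarrow> 'a set" where "S \<subseteq> (\<Union>n. F n)"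
    "\<And>n x y w. x \<in> F n \<Longrightarrow> y \<in> F n \<Longrightarrow> w \<in> W \<Longrightarrow> N w \<le> 1 \<Longrightarrow> \<bar>w x - w y\<bar> \<le> e"
proof -
  note norm = norm_on_little_lip
  obtain D where D: "countable D" "D \<subseteq> W" "\<forall>v\<in>W. \<forall>e>0. \<exists>d\<in>D. N (v - d) < e"
    using sep unfolding norm_separable_def by blast
  \<comment> \<open>Approximants of functions in the unit ball may leave it, but they stay in the
    ball of radius 2.\<close>
  define D' where "D' = {d \<in> D. N d \<le> 2}"
  have "0 \<in> W" by (rule subspace_0[OF W(2)])
  then obtain d0 where d0: "d0 \<in> D" "N (0 - d0) < 1"
    using D(3) zero_less_one by blast
  have dV: "d \<in> V" if "d \<in> D" for d using that D(2) W(1) by blast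
  have "N d0 < 1" using d0(2) norm_on_minus[OF norm dV[OF d0(1)]] by simp
  then have ne: "D' \<noteq> {}" unfolding D'_def using d0(1) by auto
  have cD': "countable D'" unfolding D'_def using D(1) by (simp add: countable_subset)
  define f where "f = from_nat_into D'"
  have rf: "range f = D'" unfolding f_def by (rule range_from_nat_into[OF ne cD'])
  have f: "f n \<in> V" "N (f n) \<le> 2" for n
  proof -
    have "f n \<in> D'" using rf by blast
    then show "f n \<in> V" "N (f n) \<le> 2" unfolding D'_def using dV by auto
  qed
  \<comment> \<open>Functions of norm at most 2 oscillate at most twice as much as
    \<open>\<rho>\<close>, so a fragment for the gauge serves all of them at once.\<close>
  have frag: "equifragmented X (range f)"
  proof (rule equifragmentedI)
    fix A and r :: real assume A: "A \<subseteq> S" "A \<noteq> {}" and r: "0 < r"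
    then obtain U where U: "openin X U" "U \<inter> A \<noteq> {}" "\<forall>x\<in>U \<inter> A. \<forall>y\<in>U \<inter> A. \<rho> x y \<le> r / 2"
      using fragments[OF A, of "r / 2"] by auto
    have "\<bar>f n x - f n y\<bar> \<le> r" if "x \<in> U \<inter> A" "y \<in> U \<inter> A" for n x y
    proof -
      have "\<bar>f n x - f n y\<bar> \<le> N (f n) * \<rho> x y"
        using that A by (intro lip_boundD(3)[OF lip_bound_norm[OF f(1)]]) auto
      also have "\<dots> \<le> 2 * (r / 2)"
        using f(2) U(3) that r gauge_nonneg by (intro mult_mono) auto
      finally show ?thesis by simp
    qed
    then show "\<exists>U. openin X U \<and> U \<inter> A \<noteq> {} \<and> (\<forall>f\<in>range f. \<forall>x\<in>U \<inter> A. \<forall>y\<in>U \<inter> A. \<bar>f x - f y\<bar> \<le> r)"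
      using U(1,2) by blast
  qed
  have "0 < e / 2" using e by simp
  obtain \<C> where \<C>: "countable \<C>" "S \<subseteq> \<Union>\<C>"
    and small: "\<And>C n x y. C \<in> \<C> \<Longrightarrow> x \<in> C \<Longrightarrow> y \<in> C \<Longrightarrow> \<bar>f n x - f n y\<bar> \<le> e / 2"
    using equifragmented_countable_cover[OF compact little_lipD(1)[OF f(1)] frag \<open>0 < e / 2\<close>] by metis
  \<comment> \<open>The extra empty set provides an enumeration even if \<open>\<C>\<close> is
    empty.\<close>
  define F where "F n = from_nat_into (insert {} \<C>) n \<inter> S" for n
  have range: "range (from_nat_into (insert {} \<C>)) = insert {} \<C>"
    by (rule range_from_nat_into) (use \<C>(1) in auto)
  show ?thesis
  proof (rule that[of F])
    show "S \<subseteq> (\<Union>n. F n)"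
    proof
      fix x assume x: "x \<in> S"
      then obtain C where "C \<in> \<C>" "x \<in> C" using \<C>(2) by blast
      moreover obtain n where "from_nat_into (insert {} \<C>) n = C"
        using range \<open>C \<in> \<C>\<close> by (metis insertI2 rangeE)
      ultimately show "x \<in> (\<Union>n. F n)" unfolding F_def using x by blast
    qed
    fix n x y w assume xy: "x \<in> F n" "y \<in> F n" and w: "w \<in> W" "N w \<le> 1"
    let ?C = "from_nat_into (insert {} \<C>) n"
    have C': "x \<in> ?C" "y \<in> ?C" "x \<in> S" "y \<in> S"
      using xy unfolding F_def by auto
    have "?C \<in> insert {} \<C>" using rangeI[of "from_nat_into (insert {} \<C>)" n] unfolding range .
    then have "?C \<in> \<C>" using C'(1) by (metis empty_iff insertE)
    note C = this C'
    \<comment> \<open>The approximant varies by \<open>e / 2\<close> on the piece and is off by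
      \<open>e / 4\<close> at each of the two points; \<open>\<eta> \<le> 1\<close> keeps it in the
      ball of radius 2.\<close>
    define \<eta> where "\<eta> = min 1 (e / 4)"
    have \<eta>: "0 < \<eta>" "\<eta> \<le> 1" "\<eta> \<le> e / 4" unfolding \<eta>_def using e by auto
    obtain d where d: "d \<in> D" "N (w - d) < \<eta>" using D(3) w(1) \<eta>(1) by blast
    have wV: "w \<in> V" using w(1) W(1) by blast
    have wd: "w - d \<in> V" by (rule subspace_diff[OF subspace_little_lip wV dV[OF d(1)]])
    have "d = w + - (w - d)" by simp
    then have "N d \<le> N w + N (- (w - d))"
      using norm_onD(5)[OF norm wV subspace_neg[OF subspace_little_lip wd]] by metis
    then have "N d \<le> 2" using norm_on_minus[OF norm wd] w(2) d(2) \<eta>(2) by linarith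
    then obtain m where m: "f m = d" using rf d(1) unfolding D'_def by (metis (mono_tags, lifting) mem_Collect_eq rangeE)
    have "\<bar>(w - d) x\<bar> \<le> \<eta>" "\<bar>(w - d) y\<bar> \<le> \<eta>"
      using abs_le_lip_norm[OF wd C(4)] abs_le_lip_norm[OF wd C(5)] d(2) by linarith+
    moreover have "\<bar>d x - d y\<bar> \<le> e / 2" using small[OF C(1-3), of m] m by simp
    ultimately show "\<bar>w x - w y\<bar> \<le> e" using \<eta>(3) unfolding fun_diff_def by linarith
  qed
qed

text \<open>The fineness \<open>k\<close> has to depend on \<open>\<phi>\<close>, since
  concentrating a positive functional in atoms costs an error proportional to its total mass. Both
  functionals use the same points \<open>p k i\<close>, so their atoms merge into one sum; rational
  weights keep these sums countable in number.\<close>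

lemma functional_approx_atoms:
  fixes F :: "nat \<Rightarrow> nat \<Rightarrow> 'a set"
  assumes W: "W \<subseteq> V" "subspace W" and \<phi>: "linear_on W \<phi>" "\<And>w. w \<in> W \<Longrightarrow> \<bar>\<phi> w\<bar> \<le> C * N w"
    and F: "\<And>k. S \<subseteq> (\<Union>n. F k n)"
      "\<And>k n x w. x \<in> F k n \<Longrightarrow> w \<in> W \<Longrightarrow> N w \<le> 1 \<Longrightarrow> \<bar>w x - w (p k n)\<bar> \<le> inverse (Suc k)"
    and p: "\<And>k n. p k n \<in> S" and e: "0 < (e::real)"
  shows "\<exists>k m c. \<forall>w\<in>W. N w \<le> 1 \<longrightarrow> \<bar>\<phi> w - (\<Sum>i<m. real_of_rat (c i) * w (p k i))\<bar> < e"
proof -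
  \<comment> \<open>Five errors of at most \<open>e / 6\<close> occur: the passage to
    \<open>\<Lambda> - \<Lambda>'\<close>, the oscillation on the pieces, one remainder for each
    functional, and the rounding of the weights.\<close>
  have e6: "0 < e / 6" using e by simp
  obtain \<Lambda> \<Lambda>' where pos: "positive_functional X \<Lambda>" "positive_functional X \<Lambda>'"
    and \<phi>\<Lambda>: "\<forall>w\<in>W. \<bar>\<phi> w - (\<Lambda> w - \<Lambda>' w)\<bar> \<le> e / 6 * N w"
    using functional_approx_positive[OF W(2,1) \<phi> e6] by metis
  define L where "L = \<Lambda> (\<lambda>x. 1) + \<Lambda>' (\<lambda>x. 1)"
  have L: "0 \<le> L"
    unfolding L_def
    by (intro add_nonneg_nonneg positive_functional_nonneg[OF pos(1)] positive_functional_nonneg[OF pos(2)]) simp_all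
  obtain k where k: "inverse (Suc k) < e / 6 / (1 + L)"
    using reals_Archimedean[of "e / 6 / (1 + L)"] e6 L by auto
  have kL: "inverse (Suc k) * L \<le> e / 6"
  proof -
    have "inverse (Suc k) * L \<le> e / 6 / (1 + L) * L" using k L by (intro mult_right_mono) auto
    also have "\<dots> \<le> e / 6" using e L by (simp add: field_simps)
    finally show ?thesis .
  qed
  have k0: "0 \<le> inverse (real (Suc k))" by simp
  obtain m a where a: "\<forall>w. continuous_map X euclideanreal w \<longrightarrow> (\<forall>x\<in>S. \<bar>w x\<bar> \<le> 1) \<longrightarrow>
      (\<forall>n. \<forall>x\<in>F k n. \<bar>w x - w (p k n)\<bar> \<le> inverse (Suc k)) \<longrightarrow>
      \<bar>\<Lambda> w - (\<Sum>i<m. a i * w (p k i))\<bar> \<le> inverse (Suc k) * \<Lambda> (\<lambda>x. 1) + e / 6"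
    using positive_functional_atoms[where F = "F k" and p = "p k", OF compact pos(1) F(1)[of k] p[of k] k0 e6]
    by (elim exE)
  obtain m' a' where a': "\<forall>w. continuous_map X euclideanreal w \<longrightarrow> (\<forall>x\<in>S. \<bar>w x\<bar> \<le> 1) \<longrightarrow>
      (\<forall>n. \<forall>x\<in>F k n. \<bar>w x - w (p k n)\<bar> \<le> inverse (Suc k)) \<longrightarrow>
      \<bar>\<Lambda>' w - (\<Sum>i<m'. a' i * w (p k i))\<bar> \<le> inverse (Suc k) * \<Lambda>' (\<lambda>x. 1) + e / 6"
    using positive_functional_atoms[where F = "F k" and p = "p k", OF compact pos(2) F(1)[of k] p[of k] k0 e6]
    by (elim exE)
  define n where "n = max m m'"
  define b where "b i = (if i < m then a i else 0) - (if i < m' then a' i else 0)" for i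
  have bsum: "(\<Sum>i<n. b i * w i) = (\<Sum>i<m. a i * w i) - (\<Sum>i<m'. a' i * w i)" for w :: "nat \<Rightarrow> real"
  proof -
    have "(\<Sum>i<n. (if i < m then a i else 0) * w i) = (\<Sum>i<m. a i * w i)"
      by (rule sum.mono_neutral_cong_right) (auto simp: n_def)
    moreover have "(\<Sum>i<n. (if i < m' then a' i else 0) * w i) = (\<Sum>i<m'. a' i * w i)"
      by (rule sum.mono_neutral_cong_right) (auto simp: n_def)
    ultimately show ?thesis
      unfolding b_def left_diff_distrib sum_subtractf by simp
  qed
  \<comment> \<open>On functions bounded by 1 the \<open>n\<close> rounding errors add up to at most
    \<open>e / 6\<close>; \<open>Suc n\<close> also covers \<open>n = 0\<close>.\<close>
  have "\<exists>q. \<bar>b i - real_of_rat q\<bar> < e / 6 / Suc n" for i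
  proof -
    have "b i - e / 6 / Suc n < b i + e / 6 / Suc n" using e by simp
    then obtain q where "b i - e / 6 / Suc n < real_of_rat q" "real_of_rat q < b i + e / 6 / Suc n"
      using of_rat_dense by blast
    then show ?thesis by (intro exI[of _ q]) (auto simp: abs_less_iff)
  qed
  then obtain c where c: "\<And>i. \<bar>b i - real_of_rat (c i)\<bar> < e / 6 / Suc n" by metis
  show ?thesis
  proof (rule exI[of _ k], rule exI[of _ n], rule exI[of _ c], intro ballI impI)
    fix w assume w: "w \<in> W" "N w \<le> 1"
    have wV: "w \<in> V" using w W by blast
    have w1: "\<bar>w x\<bar> \<le> 1" if "x \<in> S" for x using abs_le_lip_norm[OF wV that] w(2) by simp
    have "\<bar>\<phi> w - (\<Lambda> w - \<Lambda>' w)\<bar> \<le> e / 6"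
      using bspec[OF \<phi>\<Lambda> w(1)] mult_left_mono[OF w(2) less_imp_le[OF e6]] by linarith
    moreover have "\<bar>\<Lambda> w - (\<Sum>i<m. a i * w (p k i))\<bar> \<le> inverse (Suc k) * \<Lambda> (\<lambda>x. 1) + e / 6"
      using a little_lipD(1)[OF wV] w1 F(2)[OF _ w] by blast
    moreover have "\<bar>\<Lambda>' w - (\<Sum>i<m'. a' i * w (p k i))\<bar> \<le> inverse (Suc k) * \<Lambda>' (\<lambda>x. 1) + e / 6"
      using a' little_lipD(1)[OF wV] w1 F(2)[OF _ w] by blast
    moreover have "inverse (Suc k) * \<Lambda> (\<lambda>x. 1) + inverse (Suc k) * \<Lambda>' (\<lambda>x. 1) \<le> e / 6"
      using kL unfolding L_def by (simp add: distrib_left)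
    moreover have "\<bar>(\<Sum>i<n. b i * w (p k i)) - (\<Sum>i<n. real_of_rat (c i) * w (p k i))\<bar> \<le> e / 6"
    proof -
      have "\<bar>\<Sum>i<n. (b i - real_of_rat (c i)) * w (p k i)\<bar> \<le> (\<Sum>i<n. e / 6 / Suc n * 1)"
      proof (rule order.trans[OF sum_abs sum_mono])
        fix i assume "i \<in> {..<n}"
        show "\<bar>(b i - real_of_rat (c i)) * w (p k i)\<bar> \<le> e / 6 / Suc n * 1"
          unfolding abs_mult using c[of i] w1[OF p[of k i]] by (intro mult_mono) auto
      qed
      also have "\<dots> \<le> e / 6" using e by (simp add: field_simps)
      finally show ?thesis by (simp add: left_diff_distrib sum_subtractf)
    qed
    ultimately show "\<bar>\<phi> w - (\<Sum>i<n. real_of_rat (c i) * w (p k i))\<bar> < e"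
      using e unfolding bsum by linarith
  qed
qed

lemma dual_norm_le:
  assumes "subspace W" "\<And>w. w \<in> W \<Longrightarrow> N w \<le> 1 \<Longrightarrow> \<bar>\<phi> w\<bar> \<le> e"
  shows "dual_norm W N \<phi> \<le> e"
proof -
  have "0 \<in> {v \<in> W. N v \<le> 1}"
    using subspace_0[OF assms(1)] norm_on_zero[OF norm_on_little_lip] by simp
  then show ?thesis
    unfolding dual_norm_def using assms(2) by (intro cSUP_least) auto
qed

lemma dual_separable:
  assumes W: "W \<subseteq> V" "subspace W" and sep: "norm_separable W N"
  shows "norm_separable (dual_on W N) (dual_norm W N)"
proof (cases "S = {}")
  \<comment> \<open>The empty space has no point to carry atoms, but then \<open>W\<close> and its
    dual are trivial.\<close>
  case True
  have W0: "v = 0" if "v \<in> W" for v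
  proof
    show "v x = 0 x" for x
      using little_lipD(2)[of v X \<rho> x] that W(1) True by auto
  qed
  have "\<phi> = (\<lambda>v. 0)" if "\<phi> \<in> dual_on W N" for \<phi>
  proof
    fix v
    have "linear_on W \<phi>" "v \<notin> W \<Longrightarrow> \<phi> v = 0" using that unfolding dual_on_def by blast+
    then show "\<phi> v = 0" using linear_on_zero[OF W(2)] W0 by metis
  qed
  then have "dual_on W N \<subseteq> {\<lambda>v. 0}" by blast
  moreover have "(\<lambda>v. 0) \<in> dual_on W N"
    unfolding dual_on_def linear_on_def using norm_onD(2)[OF norm_on_little_lip] W(1)
    by (auto intro!: exI[of _ 0])
  moreover have "dual_norm W N (\<lambda>v. 0) \<le> 0" by (rule dual_norm_le[OF W(2)]) simp
  then have "dual_norm W N ((\<lambda>v. 0) - (\<lambda>v. 0)) < e" if "0 < e" for e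
    unfolding fun_diff_def using that by simp
  ultimately show ?thesis
    unfolding norm_separable_def by (intro exI[of _ "{\<lambda>v. 0}"]) blast
next
  case False
  then obtain x0 where x0: "x0 \<in> S" by blast
  have "\<exists>F. S \<subseteq> (\<Union>n::nat. F n) \<and>
      (\<forall>n. \<forall>x\<in>F n. \<forall>y\<in>F n. \<forall>w\<in>W. N w \<le> 1 \<longrightarrow> \<bar>w x - w y\<bar> \<le> inverse (Suc k))" for k
  proof -
    have "0 < inverse (real (Suc k))" by simp
    from separable_countable_cover[OF W sep this] show ?thesis by metis
  qed
  then obtain F where F: "\<And>k. S \<subseteq> (\<Union>n::nat. F k n)"
    "\<And>k. \<forall>n. \<forall>x\<in>F k n. \<forall>y\<in>F k n. \<forall>w\<in>W. N w \<le> 1 \<longrightarrow> \<bar>w x - w y\<bar> \<le> inverse (Suc k)"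
    by metis
  define G where "G k n = F k n \<inter> S" for k n
  \<comment> \<open>An empty piece gets the default \<open>x0\<close>: all \<open>p k n\<close> must
    lie in the space, while only nonempty pieces impose a condition on them.\<close>
  define p where "p k n = (if G k n = {} then x0 else SOME x. x \<in> G k n)" for k n
  have pG: "p k n \<in> G k n" if "G k n \<noteq> {}" for k n
    unfolding p_def using that by (simp add: some_in_eq)
  have pS: "p k n \<in> S" for k n
    using pG[of k n] x0 unfolding G_def p_def by (cases "F k n \<inter> S = {}") auto
  have G: "S \<subseteq> (\<Union>n. G k n)" for k using F(1)[of k] unfolding G_def by blast
  have Gp: "\<bar>w x - w (p k n)\<bar> \<le> inverse (Suc k)" if "x \<in> G k n" "w \<in> W" "N w \<le> 1" for k n x w
  proof -
    have "p k n \<in> F k n" "x \<in> F k n" using pG[of k n] that(1) unfolding G_def by blast+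
    then show ?thesis using F(2)[of k] that(2,3) by blast
  qed
  \<comment> \<open>A list carries both the number of atoms and their weights, so the index type is
    countable.\<close>
  define \<psi> where "\<psi> = (\<lambda>(k, cs) w. if w \<in> W then \<Sum>i<length cs. real_of_rat (cs ! i) * w (p k i) else 0)"
  have \<psi>W: "\<psi> (k, cs) w = (\<Sum>i<length cs. real_of_rat (cs ! i) * w (p k i))" if "w \<in> W" for k cs w
    unfolding \<psi>_def using that by simp
  have \<psi>: "\<psi> (k, cs) \<in> dual_on W N" for k cs
    unfolding dual_on_def mem_Collect_eq
  proof (intro conjI allI impI)
    show "\<psi> (k, cs) v = 0" if "v \<notin> W" for v unfolding \<psi>_def using that by simp
    show "linear_on W (\<psi> (k, cs))"
      unfolding linear_on_def
    proof (intro conjI ballI allI)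
      show "\<psi> (k, cs) (v + w) = \<psi> (k, cs) v + \<psi> (k, cs) w" if "v \<in> W" "w \<in> W" for v w
        using that subspace_add[OF W(2) that] by (simp add: \<psi>W sum.distrib distrib_left)
      show "\<psi> (k, cs) (c *\<^sub>R v) = c *\<^sub>R \<psi> (k, cs) v" if "v \<in> W" for c v
        using that subspace_scale[OF W(2) that, of c]
        by (simp add: \<psi>W scaleR_fun_def sum_distrib_left mult.left_commute)
    qed
    have "\<bar>\<psi> (k, cs) v\<bar> \<le> (\<Sum>i<length cs. \<bar>real_of_rat (cs ! i)\<bar>) * N v" if "v \<in> W" for v
    proof -
      have "\<bar>\<psi> (k, cs) v\<bar> \<le> (\<Sum>i<length cs. \<bar>real_of_rat (cs ! i)\<bar> * N v)"
        unfolding \<psi>W[OF that]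
      proof (rule order.trans[OF sum_abs sum_mono])
        show "\<bar>real_of_rat (cs ! i) * v (p k i)\<bar> \<le> \<bar>real_of_rat (cs ! i)\<bar> * N v" for i
          unfolding abs_mult using that W(1) by (intro mult_left_mono abs_le_lip_norm pS) auto
      qed
      then show ?thesis by (simp add: sum_distrib_right)
    qed
    then show "\<exists>C. \<forall>v\<in>W. \<bar>\<psi> (k, cs) v\<bar> \<le> C * N v" by blast
  qed
  have "\<exists>d\<in>range \<psi>. dual_norm W N (\<phi> - d) < e" if \<phi>: "\<phi> \<in> dual_on W N" and e: "0 < e" for \<phi> e
  proof -
    have lin: "linear_on W \<phi>" using \<phi> unfolding dual_on_def by blast
    obtain C where C: "\<And>w. w \<in> W \<Longrightarrow> \<bar>\<phi> w\<bar> \<le> C * N w" using \<phi> unfolding dual_on_def by blast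
    have e2: "0 < e / 2" using e by simp
    have "\<exists>k m c. \<forall>w\<in>W. N w \<le> 1 \<longrightarrow> \<bar>\<phi> w - (\<Sum>i<m. real_of_rat (c i) * w (p k i))\<bar> < e / 2"
      by (rule functional_approx_atoms[OF W lin C G Gp pS e2])
    then obtain k m c where c: "\<forall>w\<in>W. N w \<le> 1 \<longrightarrow> \<bar>\<phi> w - (\<Sum>i<m. real_of_rat (c i) * w (p k i))\<bar> < e / 2"
      by (elim exE)
    have "dual_norm W N (\<phi> - \<psi> (k, map c [0..<m])) \<le> e / 2"
    proof (rule dual_norm_le[OF W(2)])
      fix w assume w: "w \<in> W" "N w \<le> 1"
      have "\<psi> (k, map c [0..<m]) w = (\<Sum>i<m. real_of_rat (c i) * w (p k i))"
        unfolding \<psi>W[OF w(1)] by simp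
      then show "\<bar>(\<phi> - \<psi> (k, map c [0..<m])) w\<bar> \<le> e / 2" using c w by fastforce
    qed
    then show ?thesis using e by (intro bexI[of _ "\<psi> (k, map c [0..<m])"]) auto
  qed
  moreover have "range \<psi> \<subseteq> dual_on W N" using \<psi> by auto
  moreover have "countable (range \<psi>)" by simp
  ultimately show ?thesis unfolding norm_separable_def by blast
qed

theorem asplund_on_little_lip: "asplund_on V N"
  unfolding asplund_on_def
proof (intro conjI allI impI banach_on_little_lip)
  fix W assume W: "W \<subseteq> V \<and> banach_on W N \<and> norm_separable W N"
  then have "subspace W" unfolding banach_on_def norm_on_def by blast
  then show "norm_separable (dual_on W N) (dual_norm W N)" using W dual_separable by blast
qed

end

section \<open>Fragmentation and compact uniformities\<close>

lemma compact_Hausdorff_separated: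
  assumes "compact_space X" "Hausdorff_space X" "x \<in> topspace X" "y \<in> topspace X" "x \<noteq> y"
  obtains f where "continuous_map X euclideanreal f" "f x \<noteq> f y"
proof -
  have "completely_regular_space X"
    using assms(1,2) by (simp add: compact_Hausdorff_or_regular_imp_normal_space normal_imp_completely_regular_space)
  moreover have "closedin X {y}"
    using assms(2,4) by (rule closedin_Hausdorff_singleton)
  ultimately obtain f where "continuous_map X euclideanreal f" "f x = 0" "f ` {y} \<subseteq> {1}"
    unfolding completely_regular_space_alt using assms(3,5) by (metis DiffI singletonD)
  then show ?thesis by (intro that[of f]) auto
qed

text \<open>Fragmentation and HNS can be verified on any such family, which permits families adapted
  to the space: evaluations on the enveloping semigroup, vectors of a representing Banach space,
  functions of one coordinate on a product.\<close>

definition separating :: "'a topology \<Rightarrow> ('a \<Rightarrow> real) set \<Rightarrow> bool" where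
  "separating X \<Phi> \<longleftrightarrow> (\<forall>f\<in>\<Phi>. continuous_map X euclideanreal f) \<and>
     (\<forall>x\<in>topspace X. \<forall>y\<in>topspace X. x \<noteq> y \<longrightarrow> (\<exists>f\<in>\<Phi>. f x \<noteq> f y))"

lemma separating_continuous_functions:
  assumes "compact_space X" "Hausdorff_space X"
  shows "separating X (continuous_functions X)"
  unfolding separating_def using compact_Hausdorff_separated[OF assms] by (metis continuous_functionsD continuous_functionsI)

lemma separating_subtopology:
  assumes "separating X \<Phi>"
  shows "separating (subtopology X Y) \<Phi>"
  using assms unfolding separating_def by (auto intro: continuous_map_from_subtopology)

lemma continuous_map_abs_diff:
  assumes "continuous_map X euclideanreal f"
  shows "continuous_map (prod_topology X X) euclideanreal (\<lambda>p. \<bar>f (fst p) - f (snd p)\<bar>)"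
proof -
  have "continuous_map (prod_topology X X) euclideanreal (f \<circ> fst)"
    "continuous_map (prod_topology X X) euclideanreal (f \<circ> snd)"
    by (rule continuous_map_compose[OF continuous_map_fst assms] continuous_map_compose[OF continuous_map_snd assms])+
  then show ?thesis
    unfolding o_def by (intro continuous_map_real_abs continuous_map_diff)
qed

text \<open>The complement of an open neighbourhood of the diagonal is compact and is covered by the
  open sets on which some \<open>f\<close> differs by more than some \<open>inverse (Suc n)\<close>.
  A finite subcover supplies the functions, and its largest \<open>n\<close> the tolerance.\<close>

lemma entourage_contains_function_entourage:
  assumes X: "compact_space X" and \<Phi>: "separating X \<Phi>"
    and \<epsilon>: "\<epsilon> \<in> diagonal_nhds X"
  shows "\<exists>\<Psi> e. finite \<Psi> \<and> \<Psi> \<subseteq> \<Phi> \<and> 0 < (e::real) \<and>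
    (\<forall>x\<in>topspace X. \<forall>y\<in>topspace X. (\<forall>f\<in>\<Psi>. \<bar>f x - f y\<bar> \<le> e) \<longrightarrow> (x, y) \<in> \<epsilon>)"
proof -
  let ?S = "topspace X" and ?P = "prod_topology X X"
  obtain U where U: "openin ?P U" "Id_on ?S \<subseteq> U" "U \<subseteq> \<epsilon>"
    using \<epsilon> unfolding diagonal_nhds_def by blast
  define Q where "Q = (\<lambda>(f, n::nat). {p \<in> topspace ?P. \<bar>f (fst p) - f (snd p)\<bar> \<in> {inverse (Suc n)<..}})"
  have Q: "openin ?P (Q (f, n))" if "f \<in> \<Phi>" for f n
    unfolding Q_def case_prod_conv
    by (rule openin_continuous_map_preimage[OF continuous_map_abs_diff]) (use \<Phi> that in \<open>auto simp: separating_def\<close>)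
  have "compactin ?P (topspace ?P - U)"
  proof (rule closedin_compact_space)
    show "compact_space ?P" using X by (simp add: compact_space_prod_topology)
    show "closedin ?P (topspace ?P - U)" using U(1) by blast
  qed
  moreover have "\<exists>n. p \<in> Q (f, n)" if "p \<in> topspace ?P" "f (fst p) \<noteq> f (snd p)" for f p
  proof -
    obtain n where "inverse (Suc n) < \<bar>f (fst p) - f (snd p)\<bar>"
      using reals_Archimedean[of "\<bar>f (fst p) - f (snd p)\<bar>"] \<open>f (fst p) \<noteq> f (snd p)\<close> by auto
    then show ?thesis using that unfolding Q_def by auto
  qed
  then have "topspace ?P - U \<subseteq> \<Union>(Q ` (\<Phi> \<times> UNIV))"
  proof (intro subsetI)
    fix p assume p: "p \<in> topspace ?P - U"
    then have "fst p \<in> ?S" "snd p \<in> ?S" by auto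
    moreover have "fst p \<noteq> snd p"
    proof
      assume "fst p = snd p"
      then have "p \<in> Id_on ?S" using p by (cases p) auto
      then show False using U(2) p by blast
    qed
    ultimately obtain f where f: "f \<in> \<Phi>" "f (fst p) \<noteq> f (snd p)" using \<Phi> unfolding separating_def by metis
    then obtain n where "p \<in> Q (f, n)"
      using \<open>\<And>p f. p \<in> topspace ?P \<Longrightarrow> f (fst p) \<noteq> f (snd p) \<Longrightarrow> \<exists>n. p \<in> Q (f, n)\<close> p by blast
    then show "p \<in> \<Union>(Q ` (\<Phi> \<times> UNIV))" using f(1) by blast
  qed
  moreover have "\<forall>W\<in>Q ` (\<Phi> \<times> UNIV). openin ?P W" using Q by auto
  ultimately obtain \<F> where \<F>: "finite \<F>" "\<F> \<subseteq> Q ` (\<Phi> \<times> UNIV)" "topspace ?P - U \<subseteq> \<Union>\<F>"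
    unfolding compactin_def by meson
  then obtain J where J: "finite J" "J \<subseteq> \<Phi> \<times> UNIV" "\<F> = Q ` J"
    by (meson finite_subset_image)
  obtain m where m: "\<And>n. n \<in> snd ` J \<Longrightarrow> n \<le> m"
    using J(1) by (meson finite_imageI finite_nat_set_iff_bounded_le)
  show ?thesis
  proof (rule exI[of _ "fst ` J"], rule exI[of _ "inverse (Suc m)"], intro conjI ballI impI)
    show "finite (fst ` J)" "fst ` J \<subseteq> \<Phi>" using J by auto
    show "0 < inverse (real (Suc m))" by simp
    fix x y assume xy: "x \<in> ?S" "y \<in> ?S" and small: "\<forall>f\<in>fst ` J. \<bar>f x - f y\<bar> \<le> inverse (Suc m)"
    have "(x, y) \<in> U"
    proof (rule ccontr)
      assume "(x, y) \<notin> U"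
      then obtain f n where fn: "(f, n) \<in> J" "(x, y) \<in> Q (f, n)"
        using \<F>(3) J(3) xy by auto
      then have "inverse (Suc n) < \<bar>f x - f y\<bar>" unfolding Q_def by simp
      moreover have "f \<in> fst ` J" "n \<in> snd ` J" using fn(1) by (auto intro: rev_image_eqI)
      then have "\<bar>f x - f y\<bar> \<le> inverse (Suc m)" "inverse (real (Suc m)) \<le> inverse (Suc n)"
        using small m[of n] by (auto simp: le_imp_inverse_le)
      ultimately show False by linarith
    qed
    then show "(x, y) \<in> \<epsilon>" using U(3) by blast
  qed
qed

lemma function_entourage:
  assumes "continuous_map X euclideanreal f" "0 < (e::real)"
  shows "{(x, y) \<in> topspace X \<times> topspace X. \<bar>f x - f y\<bar> \<le> e} \<in> diagonal_nhds X"
proof -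
  let ?U = "{p \<in> topspace (prod_topology X X). \<bar>f (fst p) - f (snd p)\<bar> \<in> {..<e}}"
  have "openin (prod_topology X X) ?U"
    by (rule openin_continuous_map_preimage[OF continuous_map_abs_diff[OF assms(1)]]) simp
  moreover have "Id_on (topspace X) \<subseteq> ?U" using assms(2) by auto
  moreover have "?U \<subseteq> {(x, y) \<in> topspace X \<times> topspace X. \<bar>f x - f y\<bar> \<le> e}" by auto
  ultimately show ?thesis unfolding diagonal_nhds_def by blast
qed

text \<open>An entourage is controlled by finitely many functions, and finitely many equifragmented
  families have a common fragment.\<close>

lemma fragmented_family_of_functions:
  assumes X: "compact_space X" "Hausdorff_space X" and \<Phi>: "separating X \<Phi>"
    and F: "\<And>p z. p \<in> F \<Longrightarrow> z \<in> topspace Z \<Longrightarrow> p z \<in> topspace X"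
    and frag: "\<And>f. f \<in> \<Phi> \<Longrightarrow> equifragmented Z ((\<lambda>p z. f (p z)) ` F)"
  shows "fragmented_family Z (compact_uniformity X) F"
  unfolding fragmented_family_def compact_uniformity_eq[OF X]
proof (intro allI impI; elim conjE)
  fix A \<epsilon> assume A: "A \<subseteq> topspace Z" "A \<noteq> {}" and \<epsilon>: "\<epsilon> \<in> diagonal_nhds X"
  obtain \<Psi> e where \<Psi>: "finite \<Psi>" "\<Psi> \<subseteq> \<Phi>" "0 < (e::real)"
    and small: "\<forall>x\<in>topspace X. \<forall>y\<in>topspace X. (\<forall>f\<in>\<Psi>. \<bar>f x - f y\<bar> \<le> e) \<longrightarrow> (x, y) \<in> \<epsilon>"
    using entourage_contains_function_entourage[OF X(1) \<Phi> \<epsilon>] by metis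
  have "equifragmented Z (\<Union>f\<in>\<Psi>. (\<lambda>p z. f (p z)) ` F)"
    using \<Psi>(1,2) frag by (intro equifragmented_finite_UN) auto
  then obtain U where U: "openin Z U" "U \<inter> A \<noteq> {}"
    and Us: "\<And>h x y. h \<in> (\<Union>f\<in>\<Psi>. (\<lambda>p z. f (p z)) ` F) \<Longrightarrow> x \<in> U \<inter> A \<Longrightarrow> y \<in> U \<inter> A \<Longrightarrow> \<bar>h x - h y\<bar> \<le> e"
    using equifragmentedD[OF _ A \<Psi>(3)] by metis
  have "p ` (U \<inter> A) \<times> p ` (U \<inter> A) \<subseteq> \<epsilon>" if p: "p \<in> F" for p
  proof clarify
    fix x y assume xy: "x \<in> U" "x \<in> A" "y \<in> U" "y \<in> A"
    show "(p x, p y) \<in> \<epsilon>"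
    proof (rule small[rule_format])
      show "p x \<in> topspace X" "p y \<in> topspace X" using F[OF p] A xy by auto
      fix f assume "f \<in> \<Psi>"
      then show "\<bar>f (p x) - f (p y)\<bar> \<le> e" using Us[of "\<lambda>z. f (p z)" x y] p xy by auto
    qed
  qed
  then show "\<exists>U. openin Z U \<and> U \<inter> A \<noteq> {} \<and> (\<forall>f\<in>F. f ` (U \<inter> A) \<times> f ` (U \<inter> A) \<subseteq> \<epsilon>)"
    using U by blast
qed

lemma fragmented_family_imp_equifragmented:
  assumes X: "compact_space X" "Hausdorff_space X" and f: "continuous_map X euclideanreal f"
    and frag: "fragmented_family Z (compact_uniformity X) F"
  shows "equifragmented Z ((\<lambda>p z. f (p z)) ` F)"
proof (rule equifragmentedI)
  fix A and e :: real assume A: "A \<subseteq> topspace Z" "A \<noteq> {}" and e: "0 < e"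
  obtain U where U: "openin Z U" "U \<inter> A \<noteq> {}"
    "\<forall>p\<in>F. p ` (U \<inter> A) \<times> p ` (U \<inter> A) \<subseteq> {(x, y) \<in> topspace X \<times> topspace X. \<bar>f x - f y\<bar> \<le> e}"
    using frag function_entourage[OF f e] A
    unfolding fragmented_family_def compact_uniformity_eq[OF X] by meson
  have "\<bar>h x - h y\<bar> \<le> e" if h: "h \<in> (\<lambda>p z. f (p z)) ` F" "x \<in> U \<inter> A" "y \<in> U \<inter> A" for h x y
  proof -
    obtain p where p: "p \<in> F" "h = (\<lambda>z. f (p z))" using h(1) by blast
    have "(p x, p y) \<in> p ` (U \<inter> A) \<times> p ` (U \<inter> A)" using h(2,3) by blast
    then have "(p x, p y) \<in> {(x, y) \<in> topspace X \<times> topspace X. \<bar>f x - f y\<bar> \<le> e}"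
      using U(3) p(1) by blast
    then show ?thesis unfolding p(2) by simp
  qed
  then show "\<exists>U. openin Z U \<and> U \<inter> A \<noteq> {} \<and> (\<forall>f\<in>(\<lambda>p z. f (p z)) ` F. \<forall>x\<in>U \<inter> A. \<forall>y\<in>U \<inter> A. \<bar>f x - f y\<bar> \<le> e)"
    using U(1,2) by blast
qed

lemma closure_of_meets_open:
  "p \<in> T closure_of A \<Longrightarrow> openin T U \<Longrightarrow> p \<in> U \<Longrightarrow> \<exists>a\<in>A. a \<in> U"
  unfolding in_closure_of by blast

text \<open>Two functions at once, since \<open>equifragmented_pointwise_closure\<close> asks for
  approximation at two points; \<open>u\<close> and \<open>v\<close> are evaluations there.\<close>

lemma closure_of_approx:
  assumes p: "p \<in> T closure_of A" and u: "continuous_map T euclideanreal u" "continuous_map T euclideanreal v"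
    and e: "0 < (e::real)"
  shows "\<exists>a\<in>A. \<bar>u p - u a\<bar> < e \<and> \<bar>v p - v a\<bar> < e"
proof -
  have pT: "p \<in> topspace T" using p by (simp add: in_closure_of)
  let ?U = "{a \<in> topspace T. u a \<in> ball (u p) e} \<inter> {a \<in> topspace T. v a \<in> ball (v p) e}"
  have "openin T ?U"
    by (intro openin_Int openin_continuous_map_preimage[OF u(1)] openin_continuous_map_preimage[OF u(2)]) simp_all
  moreover have "p \<in> ?U" using pT e by simp
  ultimately obtain a where "a \<in> A" "a \<in> ?U" using closure_of_meets_open[OF p] by meson
  then show ?thesis by (auto simp: dist_real_def)
qed

section \<open>Hereditary non-sensitivity\<close>

definition orbit_functions :: "('g \<Rightarrow> 'x \<Rightarrow> 'x) \<Rightarrow> ('x \<Rightarrow> real) \<Rightarrow> ('x \<Rightarrow> real) set" where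
  "orbit_functions act f = range (\<lambda>g x. f (act g x))"

lemma compact_G_systemD:
  assumes "compact_G_system act X"
  shows "compact_space X" "Hausdorff_space X"
    "continuous_map (prod_topology euclidean X) X (\<lambda>(g, x). act g x)"
    "x \<in> topspace X \<Longrightarrow> act 0 x = x"
    "x \<in> topspace X \<Longrightarrow> act (g + h) x = act g (act h x)"
  using assms unfolding compact_G_system_def by simp_all

lemma compact_G_system_continuous_act:
  assumes "compact_G_system act X"
  shows "continuous_map X X (act g)"
proof -
  have "continuous_map X (prod_topology euclidean X) (\<lambda>x. (g, x))"
    by (simp add: continuous_map_pairedI)
  from continuous_map_compose[OF this compact_G_systemD(3)[OF assms]]
  show ?thesis by (simp add: o_def)
qed

lemma compact_G_system_act_in:
  assumes "compact_G_system act X" "x \<in> topspace X"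
  shows "act g x \<in> topspace X"
  using compact_G_system_continuous_act[OF assms(1), of g] assms(2) by (auto simp: continuous_map_def)

text \<open>Non-sensitivity is applied to the closure of the orbit of \<open>A\<close>. The open set
  it yields meets the orbit, hence some translate of \<open>A\<close>, and is carried back to
  \<open>A\<close>; uniformity over the whole group absorbs the translating element.\<close>

lemma HNS_imp_equifragmented:
  assumes X: "compact_G_system act X" and hns: "HNS act X" and f: "continuous_map X euclideanreal f"
  shows "equifragmented X (orbit_functions act f)"
proof (rule equifragmentedI)
  fix A and e :: real assume A: "A \<subseteq> topspace X" "A \<noteq> {}" and e: "0 < e"
  define B where "B = (\<Union>g. act g ` A)"
  define Y where "Y = X closure_of B"
  note cpt = compact_G_systemD(1)[OF X] and haus = compact_G_systemD(2)[OF X]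
  have B: "B \<subseteq> topspace X" "B \<noteq> {}"
    unfolding B_def using A compact_G_system_act_in[OF X] by auto
  have BY: "B \<subseteq> Y" unfolding Y_def by (rule closure_of_subset[OF B(1)])
  have Y: "closedin X Y" unfolding Y_def by simp
  have "G_invariant act Y"
    unfolding G_invariant_def
  proof (intro allI ballI)
    fix g y assume "y \<in> Y"
    have "act g ` B \<subseteq> B"
    proof
      fix b assume "b \<in> act g ` B"
      then obtain h a where "a \<in> A" "b = act g (act h a)" unfolding B_def by blast
      then have "b = act (g + h) a" using compact_G_systemD(5)[OF X, of a g h] A by auto
      then show "b \<in> B" unfolding B_def using \<open>a \<in> A\<close> by blast
    qed
    then have "X closure_of (act g ` B) \<subseteq> Y" unfolding Y_def by (rule closure_of_mono)
    then show "act g y \<in> Y"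
      using continuous_map_image_closure_subset[OF compact_G_system_continuous_act[OF X], of g B] \<open>y \<in> Y\<close>
      unfolding Y_def by blast
  qed
  then have ns: "not_sensitive act (subtopology X Y) (compact_uniformity (subtopology X Y))"
    using hns Y BY B(2) unfolding HNS_def by blast
  have YS: "topspace (subtopology X Y) = Y" using closedin_subset[OF Y] by auto
  have sub: "compact_space (subtopology X Y)" "Hausdorff_space (subtopology X Y)"
    using Y cpt haus by (auto simp: closedin_compact_space compact_space_subtopology Hausdorff_space_subtopology)
  have ent: "{(x, y) \<in> topspace (subtopology X Y) \<times> topspace (subtopology X Y). \<bar>f x - f y\<bar> \<le> e}
      \<in> compact_uniformity (subtopology X Y)"
    unfolding compact_uniformity_eq[OF sub] using f e
    by (intro function_entourage continuous_map_from_subtopology)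
  obtain U where U: "openin (subtopology X Y) U" "U \<noteq> {}"
    "\<forall>x\<in>U. \<forall>y\<in>U. \<forall>g. (act g x, act g y) \<in> {(x, y) \<in> topspace (subtopology X Y) \<times> topspace (subtopology X Y). \<bar>f x - f y\<bar> \<le> e}"
    using bspec[OF ns[unfolded not_sensitive_def] ent] by (elim exE conjE)
  obtain W where W: "openin X W" "U = W \<inter> Y" using U(1) unfolding openin_subtopology by blast
  then have "W \<inter> B \<noteq> {}" using U(2) unfolding Y_def by (metis Int_commute disjoint_iff in_closure_of)
  then obtain g a where ga: "a \<in> A" "act g a \<in> W" unfolding B_def by blast
  let ?O = "{x \<in> topspace X. act g x \<in> W}"
  have "openin X ?O"
    by (rule openin_continuous_map_preimage[OF compact_G_system_continuous_act[OF X] W(1)])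
  moreover have "?O \<inter> A \<noteq> {}" using ga A by blast
  moreover have "\<bar>h x - h y\<bar> \<le> e" if h: "h \<in> orbit_functions act f" "x \<in> ?O \<inter> A" "y \<in> ?O \<inter> A" for h x y
  proof -
    obtain k where k: "h = (\<lambda>x. f (act k x))" using h(1) unfolding orbit_functions_def by blast
    have "act g x \<in> U" "act g y \<in> U"
      using h(2,3) BY unfolding W(2) B_def by auto
    \<comment> \<open>The group is not commutative; \<open>g\<close> is cancelled on the right by
      \<open>(k - g) + g = k\<close>.\<close>
    then have "\<bar>f (act (k - g) (act g x)) - f (act (k - g) (act g y))\<bar> \<le> e" using U(3) by blast
    moreover have "act (k - g) (act g z) = act k z" if "z \<in> topspace X" for z
      using compact_G_systemD(5)[OF X that, of "k - g" g] by simp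
    ultimately show ?thesis unfolding k using h(2,3) by simp
  qed
  ultimately show "\<exists>U. openin X U \<and> U \<inter> A \<noteq> {} \<and>
      (\<forall>f\<in>orbit_functions act f. \<forall>x\<in>U \<inter> A. \<forall>y\<in>U \<inter> A. \<bar>f x - f y\<bar> \<le> e)" by blast
qed

text \<open>The set to be fragmented is the subsystem \<open>Y\<close> itself; its invariance keeps
  all translates of the piece in \<open>Y\<close>, where the entourage lives.\<close>

lemma HNS_of_functions:
  assumes X: "compact_G_system act X" and \<Phi>: "separating X \<Phi>"
    and frag: "\<And>f. f \<in> \<Phi> \<Longrightarrow> equifragmented X (orbit_functions act f)"
  shows "HNS act X"
  unfolding HNS_def not_sensitive_def
proof (intro allI impI ballI; elim conjE)
  fix Y \<epsilon> assume Y: "closedin X Y" "Y \<noteq> {}" "G_invariant act Y"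
    and \<epsilon>: "\<epsilon> \<in> compact_uniformity (subtopology X Y)"
  let ?Y = "subtopology X Y"
  have YS: "topspace ?Y = Y" "Y \<subseteq> topspace X" using closedin_subset[OF Y(1)] by auto
  have sub: "compact_space ?Y" "Hausdorff_space ?Y"
    using Y compact_G_systemD(1,2)[OF X]
    by (auto simp: closedin_compact_space compact_space_subtopology Hausdorff_space_subtopology)
  have \<epsilon>': "\<epsilon> \<in> diagonal_nhds ?Y" using \<epsilon> unfolding compact_uniformity_eq[OF sub] .
  obtain \<Psi> e where \<Psi>: "finite \<Psi>" "\<Psi> \<subseteq> \<Phi>" "0 < (e::real)"
    and small: "\<forall>x\<in>topspace ?Y. \<forall>y\<in>topspace ?Y. (\<forall>f\<in>\<Psi>. \<bar>f x - f y\<bar> \<le> e) \<longrightarrow> (x, y) \<in> \<epsilon>"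
    using entourage_contains_function_entourage[OF sub(1) separating_subtopology[OF \<Phi>] \<epsilon>'] by metis
  have "equifragmented X (\<Union>f\<in>\<Psi>. orbit_functions act f)"
    using \<Psi>(1,2) frag by (intro equifragmented_finite_UN) auto
  then obtain U where U: "openin X U" "U \<inter> Y \<noteq> {}"
    and Us: "\<And>h x y. h \<in> (\<Union>f\<in>\<Psi>. orbit_functions act f) \<Longrightarrow> x \<in> U \<inter> Y \<Longrightarrow> y \<in> U \<inter> Y \<Longrightarrow> \<bar>h x - h y\<bar> \<le> e"
    using equifragmentedD[OF _ YS(2) Y(2) \<Psi>(3)] by metis
  have "(act g x, act g y) \<in> \<epsilon>" if xy: "x \<in> U \<inter> Y" "y \<in> U \<inter> Y" for x y g
  proof (rule small[rule_format])
    show "act g x \<in> topspace ?Y" "act g y \<in> topspace ?Y"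
      using xy Y(3) unfolding YS G_invariant_def by auto
    fix f assume "f \<in> \<Psi>"
    then show "\<bar>f (act g x) - f (act g y)\<bar> \<le> e"
      using Us[of "\<lambda>x. f (act g x)" x y] xy unfolding orbit_functions_def by blast
  qed
  moreover have "openin ?Y (U \<inter> Y)" using U(1) unfolding openin_subtopology by blast
  ultimately show "\<exists>U. openin ?Y U \<and> U \<noteq> {} \<and> (\<forall>x\<in>U. \<forall>y\<in>U. \<forall>g. (act g x, act g y) \<in> \<epsilon>)"
    using U(2) by (intro exI[of _ "U \<inter> Y"]) blast
qed

lemma HNS_iff_equifragmented:
  assumes "compact_G_system act X"
  shows "HNS act X \<longleftrightarrow> (\<forall>f. continuous_map X euclideanreal f \<longrightarrow> equifragmented X (orbit_functions act f))"
proof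
  assume "HNS act X"
  then show "\<forall>f. continuous_map X euclideanreal f \<longrightarrow> equifragmented X (orbit_functions act f)"
    using HNS_imp_equifragmented[OF assms] by blast
next
  assume fr: "\<forall>f. continuous_map X euclideanreal f \<longrightarrow> equifragmented X (orbit_functions act f)"
  show "HNS act X"
    using fr by (intro HNS_of_functions[OF assms separating_continuous_functions]) (auto intro: compact_G_systemD[OF assms])
qed

text \<open>\<open>translation\<close> cuts \<open>act\<close> down to an extensional function, so
  the two families agree on the space.\<close>

lemma equifragmented_translations_iff:
  "equifragmented X ((\<lambda>p x. f (p x)) ` range (translation act X)) \<longleftrightarrow> equifragmented X (orbit_functions act f)"
proof
  assume "equifragmented X ((\<lambda>p x. f (p x)) ` range (translation act X))"
  then show "equifragmented X (orbit_functions act f)"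
    by (rule equifragmented_pullback[OF _ continuous_map_id[unfolded id_def]])
      (auto simp: orbit_functions_def translation_def)
next
  assume "equifragmented X (orbit_functions act f)"
  then show "equifragmented X ((\<lambda>p x. f (p x)) ` range (translation act X))"
    by (rule equifragmented_pullback[OF _ continuous_map_id[unfolded id_def]])
      (auto simp: orbit_functions_def translation_def)
qed

lemma HNS_iff_fragmented_translations:
  assumes X: "compact_G_system act X"
  shows "HNS act X \<longleftrightarrow> fragmented_family X (compact_uniformity X) (range (translation act X))"
proof
  assume hns: "HNS act X"
  show "fragmented_family X (compact_uniformity X) (range (translation act X))"
  proof (rule fragmented_family_of_functions[OF compact_G_systemD(1,2)[OF X] separating_continuous_functions[OF compact_G_systemD(1,2)[OF X]]])
    show "p z \<in> topspace X" if "p \<in> range (translation act X)" "z \<in> topspace X" for p z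
      using that compact_G_system_act_in[OF X] by (auto simp: translation_def)
    show "equifragmented X ((\<lambda>p z. f (p z)) ` range (translation act X))"
      if "f \<in> continuous_functions X" for f
      using continuous_functionsD[OF that] HNS_imp_equifragmented[OF X hns] unfolding equifragmented_translations_iff by blast
  qed
next
  assume fr: "fragmented_family X (compact_uniformity X) (range (translation act X))"
  show "HNS act X"
    unfolding HNS_iff_equifragmented[OF X]
    using fragmented_family_imp_equifragmented[OF compact_G_systemD(1,2)[OF X] _ fr]
    unfolding equifragmented_translations_iff by blast
qed

section \<open>The enveloping semigroup\<close>

locale G_system =
  fixes act :: "'g::topological_group_add \<Rightarrow> 'x \<Rightarrow> 'x" and X :: "'x topology"
  assumes system: "compact_G_system act X"
begin

abbreviation "S \<equiv> topspace X"
abbreviation "P \<equiv> product_topology (\<lambda>_. X) S"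
abbreviation "T \<equiv> range (translation act X)"
abbreviation "E \<equiv> enveloping_topology act X"

lemmas compact = compact_G_systemD(1)[OF system] and Hausdorff = compact_G_systemD(2)[OF system]
  and continuous_act = compact_G_system_continuous_act[OF system]
  and act_in = compact_G_system_act_in[OF system]

lemma topspace_E: "topspace E = enveloping_semigroup act X"
  unfolding enveloping_topology_def topspace_subtopology enveloping_semigroup_def
  using closure_of_subset_topspace by (metis Int_absorb1)

lemma closedin_E: "closedin P (topspace E)"
  unfolding topspace_E enveloping_semigroup_def by simp

lemma E_subtopology: "E = subtopology P (topspace E)"
  using topspace_E unfolding enveloping_topology_def by simp

lemma compact_E: "compact_space E"
proof -
  have "compact_space P" using compact by (simp add: compact_space_product_topology)
  then show ?thesis
    using closedin_E by (subst E_subtopology) (simp add: closedin_compact_space compact_space_subtopology)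
qed

lemma Hausdorff_E: "Hausdorff_space E"
proof -
  have "Hausdorff_space P" using Hausdorff by (simp add: Hausdorff_space_product_topology)
  then show ?thesis by (subst E_subtopology) (simp add: Hausdorff_space_subtopology)
qed

lemma translation_in_P: "translation act X g \<in> topspace P"
  unfolding topspace_product_topology translation_def using act_in by auto

lemma translations_subset_E: "T \<subseteq> topspace E"
  unfolding topspace_E enveloping_semigroup_def using translation_in_P by (intro closure_of_subset) auto

lemma E_closure: "topspace E = E closure_of T"
proof -
  have "E closure_of T = topspace E \<inter> P closure_of (topspace E \<inter> T)"
    by (subst E_subtopology) (rule closure_of_subtopology)
  also have "topspace E \<inter> T = T" using translations_subset_E by blast
  also have "P closure_of T = topspace E" unfolding topspace_E enveloping_semigroup_def ..
  finally show ?thesis by simp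
qed

lemma E_in: "p \<in> topspace E \<Longrightarrow> x \<in> S \<Longrightarrow> p x \<in> S"
  using closedin_subset[OF closedin_E] by (auto simp: PiE_iff)

lemma E_extensional: "p \<in> topspace E \<Longrightarrow> p \<in> extensional S"
  using closedin_subset[OF closedin_E] by (auto simp: PiE_iff)

lemma continuous_map_eval: "x \<in> S \<Longrightarrow> continuous_map E X (\<lambda>p. p x)"
  by (subst E_subtopology) (rule continuous_map_from_subtopology[OF continuous_map_product_projection])

lemma continuous_map_into_E:
  assumes "f ` topspace Z \<subseteq> topspace E" "\<And>x. x \<in> S \<Longrightarrow> continuous_map Z X (\<lambda>z. f z x)"
  shows "continuous_map Z E f"
proof -
  have "continuous_map Z P f"
    unfolding continuous_map_componentwise using assms E_extensional by blast
  then show ?thesis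
    using assms(1) by (subst E_subtopology) (auto simp: continuous_map_in_subtopology)
qed

lemma compose_translations: "compose S (translation act X g) (translation act X h) = translation act X (g + h)"
  unfolding compose_def translation_def
  using act_in compact_G_systemD(5)[OF system] by (auto simp: fun_eq_iff restrict_def)

lemma P_in: "p \<in> topspace P \<Longrightarrow> x \<in> S \<Longrightarrow> p x \<in> S"
  by (auto simp: PiE_iff)

lemma compose_translation_E:
  assumes q: "q \<in> topspace E"
  shows "compose S (translation act X g) q \<in> topspace E"
proof -
  let ?c = "compose S (translation act X g)"
  have "continuous_map P P ?c"
    unfolding continuous_map_componentwise
  proof (intro conjI ballI)
    show "?c ` topspace P \<subseteq> extensional S" by (auto simp: compose_def)
    fix x assume x: "x \<in> S"
    have "continuous_map P X (act g \<circ> (\<lambda>q. q x))"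
      by (rule continuous_map_compose[OF continuous_map_product_projection[OF x] continuous_act])
    then show "continuous_map P X (\<lambda>q. ?c q x)"
      by (rule continuous_map_eq) (use x P_in in \<open>auto simp: compose_def translation_def\<close>)
  qed
  then have "?c ` (P closure_of T) \<subseteq> P closure_of (?c ` T)"
    by (rule continuous_map_image_closure_subset)
  also have "\<dots> \<subseteq> P closure_of T"
    by (rule closure_of_mono) (auto simp: compose_translations)
  finally show ?thesis using q unfolding topspace_E enveloping_semigroup_def by blast
qed

lemma continuous_map_compose_right:
  assumes q: "q \<in> topspace P"
  shows "continuous_map P P (\<lambda>p. compose S p q)"
  unfolding continuous_map_componentwise
proof (intro conjI ballI)
  show "(\<lambda>p. compose S p q) ` topspace P \<subseteq> extensional S" by (auto simp: compose_def)
  fix x assume x: "x \<in> S"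
  show "continuous_map P X (\<lambda>p. compose S p q x)"
    using continuous_map_product_projection[OF P_in[OF q x]] x by (simp add: compose_def)
qed

text \<open>Right multiplication is continuous for every element of the product, left multiplication
  for translations. So there are two passages to the closure: in the right factor with a translation
  on the left, then in the left factor.\<close>

lemma compose_E:
  assumes p: "p \<in> topspace E" and q: "q \<in> topspace E"
  shows "compose S p q \<in> topspace E"
proof -
  have qP: "q \<in> topspace P" using q closedin_subset[OF closedin_E] by blast
  have "(\<lambda>p. compose S p q) ` (P closure_of T) \<subseteq> P closure_of ((\<lambda>p. compose S p q) ` T)"
    by (rule continuous_map_image_closure_subset[OF continuous_map_compose_right[OF qP]])
  also have "\<dots> \<subseteq> topspace E"
    by (rule closure_of_minimal[OF _ closedin_E]) (use compose_translation_E[OF q] in auto)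
  finally show ?thesis using p unfolding topspace_E enveloping_semigroup_def by blast
qed

lemma enveloping_action_apply:
  "x \<in> S \<Longrightarrow> p \<in> topspace E \<Longrightarrow> enveloping_action act X g p x = act g (p x)"
  using E_in by (simp add: enveloping_action_def compose_def translation_def)

lemma enveloping_action_in: "p \<in> topspace E \<Longrightarrow> enveloping_action act X g p \<in> topspace E"
  unfolding enveloping_action_def by (rule compose_translation_E)

lemma E_eqI: "p \<in> topspace E \<Longrightarrow> q \<in> topspace E \<Longrightarrow> (\<And>x. x \<in> S \<Longrightarrow> p x = q x) \<Longrightarrow> p = q"
  using E_extensional by (metis extensionalityI)

text \<open>Joint continuity is checked coordinatewise: evaluation at \<open>x\<close> turns the
  action on \<open>E\<close> into the jointly continuous action on \<open>X\<close>.\<close>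

lemma E_system: "compact_G_system (enveloping_action act X) E"
  unfolding compact_G_system_def
proof (intro conjI compact_E Hausdorff_E ballI allI)
  show "continuous_map (prod_topology euclidean E) E (\<lambda>(g, p). enveloping_action act X g p)"
  proof (rule continuous_map_into_E)
    show "(\<lambda>(g, p). enveloping_action act X g p) ` topspace (prod_topology euclidean E) \<subseteq> topspace E"
      using enveloping_action_in by auto
    fix x assume x: "x \<in> S"
    have "continuous_map (prod_topology euclidean E) X ((\<lambda>p. p x) \<circ> snd)"
      by (rule continuous_map_compose[OF continuous_map_snd continuous_map_eval[OF x]])
    then have "continuous_map (prod_topology euclidean E) (prod_topology euclidean X) (\<lambda>z. (fst z, snd z x))"
      by (intro continuous_map_pairedI continuous_map_fst) (simp add: o_def)
    from continuous_map_compose[OF this compact_G_systemD(3)[OF system]]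
    show "continuous_map (prod_topology euclidean E) X (\<lambda>z. (case z of (g, p) \<Rightarrow> enveloping_action act X g p) x)"
      by (rule continuous_map_eq) (use x in \<open>auto simp: enveloping_action_apply\<close>)
  qed
  fix p assume p: "p \<in> topspace E"
  show "enveloping_action act X 0 p = p"
    by (rule E_eqI[OF enveloping_action_in[OF p] p])
      (use p E_in compact_G_systemD(4)[OF system] in \<open>auto simp: enveloping_action_apply\<close>)
  fix g h
  show "enveloping_action act X (g + h) p = enveloping_action act X g (enveloping_action act X h p)"
    by (rule E_eqI[OF enveloping_action_in[OF p] enveloping_action_in[OF enveloping_action_in[OF p]]])
      (use p E_in enveloping_action_in compact_G_systemD(5)[OF system] in \<open>auto simp: enveloping_action_apply\<close>)
qed

lemma E_right_topological: "compact_right_topological_semigroup (compose S) E"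
  unfolding compact_right_topological_semigroup_def
proof (intro conjI compact_E Hausdorff_E ballI compose_E; assumption?)
  fix p q r assume "p \<in> topspace E" "q \<in> topspace E" "r \<in> topspace E"
  then show "compose S (compose S p q) r = compose S p (compose S q r)"
    using E_in by (auto simp: compose_def restrict_def fun_eq_iff)
next
  fix q assume q: "q \<in> topspace E"
  then have qP: "q \<in> topspace P" using closedin_subset[OF closedin_E] by blast
  show "continuous_map E E (\<lambda>p. compose S p q)"
  proof (rule continuous_map_into_E)
    show "(\<lambda>p. compose S p q) ` topspace E \<subseteq> topspace E" using compose_E q by blast
    show "continuous_map E X (\<lambda>p. compose S p q x)" if x: "x \<in> S" for x
      using continuous_map_eval[OF E_in[OF q x]] x by (simp add: compose_def)
  qed
qed

text \<open>The enveloping semigroup is the pointwise closure of the translations, and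
  equifragmentation survives pointwise limits.\<close>

lemma fragmented_translations_iff_E:
  "fragmented_family X (compact_uniformity X) T \<longleftrightarrow>
   fragmented_family X (compact_uniformity X) (enveloping_semigroup act X)"
proof
  assume "fragmented_family X (compact_uniformity X) (enveloping_semigroup act X)"
  then show "fragmented_family X (compact_uniformity X) T"
    using translations_subset_E unfolding topspace_E fragmented_family_def by (meson subsetD)
next
  assume fr: "fragmented_family X (compact_uniformity X) T"
  show "fragmented_family X (compact_uniformity X) (enveloping_semigroup act X)"
  proof (rule fragmented_family_of_functions[OF compact Hausdorff separating_continuous_functions[OF compact Hausdorff]])
    show "p x \<in> S" if "p \<in> enveloping_semigroup act X" "x \<in> S" for p x
      using that E_in unfolding topspace_E by blast
    fix f assume f: "f \<in> continuous_functions X"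
    show "equifragmented X ((\<lambda>p z. f (p z)) ` enveloping_semigroup act X)"
    proof (rule equifragmented_pointwise_closure)
      show "equifragmented X ((\<lambda>p z. f (p z)) ` T)"
        by (rule fragmented_family_imp_equifragmented[OF compact Hausdorff continuous_functionsD[OF f] fr])
      fix h x y and e :: real
      assume "h \<in> (\<lambda>p z. f (p z)) ` enveloping_semigroup act X" and x: "x \<in> S" and y: "y \<in> S" and e: "0 < e"
      then obtain p where p: "p \<in> E closure_of T" "h = (\<lambda>z. f (p z))"
        unfolding topspace_E[symmetric] E_closure[symmetric] by blast
      have "continuous_map E euclideanreal (\<lambda>p. f (p z))" if "z \<in> S" for z
        using continuous_map_compose[OF continuous_map_eval[OF that] continuous_functionsD[OF f]] by (simp add: o_def)
      then obtain a where a: "a \<in> T" "\<bar>f (p x) - f (a x)\<bar> < e" "\<bar>f (p y) - f (a y)\<bar> < e"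
        using closure_of_approx[OF p(1) _ _ e] x y by blast
      then show "\<exists>f\<in>(\<lambda>p z. f (p z)) ` T. \<bar>h x - f x\<bar> < e \<and> \<bar>h y - f y\<bar> < e"
        unfolding p(2) by (intro bexI[of _ "\<lambda>z. f (a z)"]) auto
    qed
  qed
qed

definition evaluation_functions :: "(('x \<Rightarrow> 'x) \<Rightarrow> real) set" where
  "evaluation_functions = {\<lambda>p. f (p x) |f x. f \<in> continuous_functions X \<and> x \<in> S}"

lemma separating_evaluation_functions: "separating E evaluation_functions"
  unfolding separating_def
proof (intro conjI ballI impI)
  fix u assume "u \<in> evaluation_functions"
  then obtain f x where "f \<in> continuous_functions X" "x \<in> S" "u = (\<lambda>p. f (p x))"
    unfolding evaluation_functions_def by blast
  then show "continuous_map E euclideanreal u"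
    using continuous_map_compose[OF continuous_map_eval continuous_functionsD] by (simp add: o_def)
next
  fix p q assume pq: "p \<in> topspace E" "q \<in> topspace E" "p \<noteq> q"
  then obtain x where x: "x \<in> S" "p x \<noteq> q x" using E_eqI by blast
  then obtain f where "f \<in> continuous_functions X" "f (p x) \<noteq> f (q x)"
    using separating_continuous_functions[OF compact Hausdorff] E_in[OF pq(1) x(1)] E_in[OF pq(2) x(1)]
    unfolding separating_def by metis
  moreover from this have "(\<lambda>p. f (p x)) \<in> evaluation_functions"
    unfolding evaluation_functions_def using x(1) by blast
  ultimately show "\<exists>u\<in>evaluation_functions. u p \<noteq> u q"
    by (intro bexI[of _ "\<lambda>p. f (p x)"])
qed

text \<open>Evaluation at \<open>x\<close> is equivariant, so the orbit of
  \<open>\<lambda>p. f (p x)\<close> on \<open>E\<close> is pulled back from the orbit of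
  \<open>f\<close> on \<open>X\<close>.\<close>

lemma HNS_imp_HNS_E:
  assumes hns: "HNS act X"
  shows "HNS (enveloping_action act X) E"
proof (rule HNS_of_functions[OF E_system separating_evaluation_functions])
  fix u assume "u \<in> evaluation_functions"
  then obtain f x where fx: "f \<in> continuous_functions X" "x \<in> S" "u = (\<lambda>p. f (p x))"
    unfolding evaluation_functions_def by blast
  have "equifragmented X (orbit_functions act f)"
    using HNS_imp_equifragmented[OF system hns] fx(1) by blast
  then show "equifragmented E (orbit_functions (enveloping_action act X) u)"
  proof (rule equifragmented_pullback[OF _ continuous_map_eval[OF fx(2)]])
    fix h assume "h \<in> orbit_functions (enveloping_action act X) u"
    then obtain g where "h = (\<lambda>p. u (enveloping_action act X g p))" unfolding orbit_functions_def by blast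
    then have "\<forall>p\<in>topspace E. h p = f (act g (p x))"
      unfolding fx(3) using enveloping_action_apply[OF fx(2)] by simp
    then show "\<exists>f\<in>orbit_functions act f. \<forall>p\<in>topspace E. h p = f (p x)"
      unfolding orbit_functions_def by (intro bexI[of _ "\<lambda>x. f (act g x)"]) auto
  qed
qed

text \<open>Acting by \<open>g\<close> is left multiplication by a translation. Since the semigroup
  is right topological, left multiplications by arbitrary elements are pointwise limits of these, so
  both families are fragmented together.\<close>

lemma HNS_E_iff_F_semigroup: "HNS (enveloping_action act X) E \<longleftrightarrow> F_semigroup (compose S) E"
proof
  assume hns: "HNS (enveloping_action act X) E"
  have "fragmented_family E (compact_uniformity E) (compose S ` topspace E)"
  proof (rule fragmented_family_of_functions[OF compact_E Hausdorff_E separating_evaluation_functions])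
    show "l q \<in> topspace E" if "l \<in> compose S ` topspace E" "q \<in> topspace E" for l q
    proof -
      obtain p where "p \<in> topspace E" "l = compose S p" using \<open>l \<in> _\<close> by (rule imageE)
      then show ?thesis using compose_E \<open>q \<in> topspace E\<close> by simp
    qed
    fix u assume u: "u \<in> evaluation_functions"
    then obtain f x where fx: "f \<in> continuous_functions X" "x \<in> S" "u = (\<lambda>p. f (p x))"
      unfolding evaluation_functions_def by blast
    have uc: "continuous_map E euclideanreal u"
      using u separating_evaluation_functions unfolding separating_def by blast
    show "equifragmented E ((\<lambda>l q. u (l q)) ` (compose S ` topspace E))"
    proof (rule equifragmented_pointwise_closure[OF HNS_imp_equifragmented[OF E_system hns uc]])
      fix h q r and e :: real
      assume "h \<in> (\<lambda>l q. u (l q)) ` (compose S ` topspace E)"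
        and q: "q \<in> topspace E" and r: "r \<in> topspace E" and e: "0 < e"
      then obtain p where p: "p \<in> E closure_of T" "h = (\<lambda>q. u (compose S p q))"
        unfolding E_closure[symmetric] by blast
      have "continuous_map E euclideanreal (\<lambda>p. u (compose S p q))" if "q \<in> topspace E" for q
        using E_right_topological that continuous_map_compose[OF _ uc, of E "\<lambda>p. compose S p q"]
        unfolding compact_right_topological_semigroup_def by (simp add: o_def)
      then obtain g where "\<bar>u (compose S p q) - u (compose S (translation act X g) q)\<bar> < e"
        "\<bar>u (compose S p r) - u (compose S (translation act X g) r)\<bar> < e"
        using closure_of_approx[OF p(1) _ _ e] q r by blast
      then show "\<exists>f\<in>orbit_functions (enveloping_action act X) u. \<bar>h q - f q\<bar> < e \<and> \<bar>h r - f r\<bar> < e"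
        unfolding p(2) orbit_functions_def enveloping_action_def
        by (intro bexI[of _ "\<lambda>q. u (compose S (translation act X g) q)"]) auto
    qed
  qed
  then show "F_semigroup (compose S) E"
    unfolding F_semigroup_def using E_right_topological by blast
next
  assume F: "F_semigroup (compose S) E"
  then have fr: "fragmented_family E (compact_uniformity E) (compose S ` topspace E)"
    unfolding F_semigroup_def by blast
  show "HNS (enveloping_action act X) E"
  proof (rule HNS_of_functions[OF E_system separating_continuous_functions[OF compact_E Hausdorff_E]])
    fix u assume "u \<in> continuous_functions E"
    then have "equifragmented E ((\<lambda>l q. u (l q)) ` (compose S ` topspace E))"
      using fragmented_family_imp_equifragmented[OF compact_E Hausdorff_E _ fr] by blast
    then show "equifragmented E (orbit_functions (enveloping_action act X) u)"
    proof (rule equifragmented_subset)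
      show "orbit_functions (enveloping_action act X) u \<subseteq> (\<lambda>l q. u (l q)) ` (compose S ` topspace E)"
        unfolding orbit_functions_def enveloping_action_def using translations_subset_E by blast
    qed
  qed
qed

text \<open>Evaluation at a point with dense orbit makes \<open>X\<close> a factor of the enveloping semigroup.\<close>

lemma point_transitive_HNS_E_imp_HNS:
  assumes pt: "point_transitive act X" and hns: "HNS (enveloping_action act X) E"
  shows "HNS act X"
  unfolding HNS_iff_equifragmented[OF system]
proof (intro allI impI)
  fix f assume f: "continuous_map X euclideanreal f"
  obtain x where x: "x \<in> S" "X closure_of range (\<lambda>g. act g x) = S"
    using pt unfolding point_transitive_def by blast
  note ev = continuous_map_eval[OF x(1)]
  have "compactin X ((\<lambda>p. p x) ` topspace E)"
    using compact_E ev by (intro image_compactin) (auto simp: compact_space_def)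
  then have "closedin X ((\<lambda>p. p x) ` topspace E)"
    by (rule compactin_imp_closedin[OF Hausdorff])
  moreover have "range (\<lambda>g. act g x) \<subseteq> (\<lambda>p. p x) ` topspace E"
  proof clarify
    fix g
    have "translation act X g \<in> topspace E" "act g x = translation act X g x"
      using translations_subset_E x(1) by (auto simp: translation_def)
    then show "act g x \<in> (\<lambda>p. p x) ` topspace E" by blast
  qed
  \<comment> \<open>The image is compact, hence closed, and contains a dense orbit.\<close>
  ultimately have onto: "S \<subseteq> (\<lambda>p. p x) ` topspace E"
    using closure_of_minimal x(2) by metis
  have "continuous_map E euclideanreal (\<lambda>p. f (p x))"
    using continuous_map_compose[OF ev f] by (simp add: o_def)
  then have "equifragmented E (orbit_functions (enveloping_action act X) (\<lambda>p. f (p x)))"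
    by (rule HNS_imp_equifragmented[OF E_system hns])
  then have "equifragmented E ((\<lambda>f p. f (p x)) ` orbit_functions act f)"
    by (rule equifragmented_pullback[OF _ continuous_map_id[unfolded id_def]])
      (use x(1) in \<open>auto simp: orbit_functions_def enveloping_action_apply\<close>)
  then show "equifragmented X (orbit_functions act f)"
    by (rule equifragmented_quotient[OF compact_E Hausdorff ev onto])
qed

end

section \<open>Radon--Nikodym systems are hereditarily non-sensitive\<close>

lemma uncountable_bool_sequences: "uncountable (UNIV :: (nat \<Rightarrow> bool) set)"
proof
  assume "countable (UNIV :: (nat \<Rightarrow> bool) set)"
  then have "range (from_nat_into (UNIV :: (nat \<Rightarrow> bool) set)) = UNIV"
    by (intro range_from_nat_into) auto
  then obtain n where "from_nat_into UNIV n = (\<lambda>k. \<not> from_nat_into (UNIV :: (nat \<Rightarrow> bool) set) k k)"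
    by (metis (mono_tags, lifting) UNIV_I rangeE)
  then show False by metis
qed

text \<open>One branching of the scheme: values within \<open>e / 3\<close> of \<open>f x\<close>
  and of \<open>f y\<close> leave a gap of \<open>e / 3\<close>. Closures have to be separated as
  well, because branch points are known only to lie in closures; closed balls of values achieve
  this.\<close>

lemma not_fragmented_splitting:
  assumes F: "\<And>f. f \<in> F \<Longrightarrow> continuous_map X euclideanreal f" and A: "A \<subseteq> topspace X" and e: "0 < (e::real)"
    and big: "\<And>U. openin X U \<Longrightarrow> U \<inter> A \<noteq> {} \<Longrightarrow> \<exists>f\<in>F. \<exists>x\<in>U \<inter> A. \<exists>y\<in>U \<inter> A. e < \<bar>f x - f y\<bar>"
    and U: "openin X U" "U \<inter> A \<noteq> {}"
  shows "\<exists>f U'. f \<in> F \<and> (\<forall>b. openin X (U' b) \<and> U' b \<inter> A \<noteq> {} \<and> U' b \<subseteq> U) \<and>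
    (\<forall>x\<in>X closure_of U' True. \<forall>y\<in>X closure_of U' False. e / 3 \<le> \<bar>f x - f y\<bar>)"
proof -
  obtain f x y where f: "f \<in> F" and xy: "x \<in> U \<inter> A" "y \<in> U \<inter> A" "e < \<bar>f x - f y\<bar>"
    using big[OF U] by blast
  define p where "p b = (if b then x else y)" for b
  define U' where "U' b = U \<inter> {z \<in> topspace X. f z \<in> ball (f (p b)) (e / 3)}" for b
  have cl: "\<bar>f z - f (p b)\<bar> \<le> e / 3" if z: "z \<in> X closure_of U' b" for z b
  proof -
    let ?C = "{z \<in> topspace X. f z \<in> cball (f (p b)) (e / 3)}"
    have "closedin X ?C"
      by (rule closedin_continuous_map_preimage[OF F[OF f]]) simp
    moreover have "U' b \<subseteq> ?C" unfolding U'_def by auto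
    ultimately have "X closure_of U' b \<subseteq> ?C" by (rule closure_of_minimal[rotated])
    then have "z \<in> ?C" using z by blast
    then show ?thesis by (simp add: dist_real_def abs_minus_commute)
  qed
  show ?thesis
  proof (rule exI[of _ f], rule exI[of _ U'], intro conjI allI ballI f)
    fix b
    show "openin X (U' b)"
      unfolding U'_def by (intro openin_Int U openin_continuous_map_preimage[OF F[OF f]]) simp
    have "p b \<in> U' b \<inter> A" unfolding U'_def p_def using xy A e by auto
    then show "U' b \<inter> A \<noteq> {}" by blast
    show "U' b \<subseteq> U" unfolding U'_def by blast
  next
    fix u v assume "u \<in> X closure_of U' True" "v \<in> X closure_of U' False"
    then have "\<bar>f u - f x\<bar> \<le> e / 3" "\<bar>f v - f y\<bar> \<le> e / 3"
      using cl[of u True] cl[of v False] unfolding p_def by auto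
    then show "e / 3 \<le> \<bar>f u - f v\<bar>" using xy(3) by linarith
  qed
qed

text \<open>Each node of a binary tree contributes one function, each branch one point by
  compactness; two branches are told apart by the function at the node where they part.\<close>

lemma not_equifragmented_imp_uncountable_separated:
  assumes X: "compact_space X" and F: "\<And>f. f \<in> F \<Longrightarrow> continuous_map X euclideanreal f"
    and nfr: "\<not> equifragmented X F"
  shows "\<exists>D r Q. countable D \<and> D \<subseteq> F \<and> (0::real) < r \<and> uncountable Q \<and> Q \<subseteq> topspace X \<and>
    (\<forall>x\<in>Q. \<forall>y\<in>Q. x \<noteq> y \<longrightarrow> (\<exists>f\<in>D. r \<le> \<bar>f x - f y\<bar>))"
proof -
  obtain A e where A: "A \<subseteq> topspace X" "A \<noteq> {}" and e: "0 < (e::real)"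
    and nU: "\<not> (\<exists>U. openin X U \<and> U \<inter> A \<noteq> {} \<and> (\<forall>f\<in>F. \<forall>x\<in>U \<inter> A. \<forall>y\<in>U \<inter> A. \<bar>f x - f y\<bar> \<le> e))"
    using nfr unfolding equifragmented_def by blast
  have big: "\<exists>f\<in>F. \<exists>x\<in>U \<inter> A. \<exists>y\<in>U \<inter> A. e < \<bar>f x - f y\<bar>" if "openin X U" "U \<inter> A \<noteq> {}" for U
    using nU that by (meson not_le)
  \<comment> \<open>The implication makes the choice functions total, so that they can drive the
    recursion.\<close>
  have "\<forall>U. \<exists>f U'. openin X U \<and> U \<inter> A \<noteq> {} \<longrightarrow>
      f \<in> F \<and> (\<forall>b. openin X (U' b) \<and> U' b \<inter> A \<noteq> {} \<and> U' b \<subseteq> U) \<and>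
      (\<forall>x\<in>X closure_of U' True. \<forall>y\<in>X closure_of U' False. e / 3 \<le> \<bar>f x - f y\<bar>)"
    using not_fragmented_splitting[OF F A(1) e big] by metis
  then obtain \<phi> V where \<phi>V: "\<And>U. openin X U \<and> U \<inter> A \<noteq> {} \<longrightarrow>
      \<phi> U \<in> F \<and> (\<forall>b. openin X (V U b) \<and> V U b \<inter> A \<noteq> {} \<and> V U b \<subseteq> U) \<and>
      (\<forall>x\<in>X closure_of V U True. \<forall>y\<in>X closure_of V U False. e / 3 \<le> \<bar>\<phi> U x - \<phi> U y\<bar>)"
    by metis
  \<comment> \<open>The newest bit stands at the head of the list, so prefixes of a branch are
    stored in reverse.\<close>
  define T where "T = rec_list (topspace X) (\<lambda>b bs W. V W b)"
  have T0: "T [] = topspace X" and TC: "T (b # bs) = V (T bs) b" for b bs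
    unfolding T_def by simp_all
  have T: "openin X (T s) \<and> T s \<inter> A \<noteq> {}" for s
  proof (induction s)
    case Nil
    then show ?case using A unfolding T0 by blast
  next
    case (Cons b s)
    then show ?case unfolding TC using \<phi>V[of "T s"] by blast
  qed
  have sub: "T (b # s) \<subseteq> T s" for b s unfolding TC using \<phi>V[of "T s"] T[of s] by blast
  have \<phi>F: "\<phi> (T s) \<in> F" for s using \<phi>V[of "T s"] T[of s] by blast
  have apart: "e / 3 \<le> \<bar>\<phi> (T s) x - \<phi> (T s) y\<bar>"
    if "x \<in> X closure_of T (b # s)" "y \<in> X closure_of T (c # s)" "b \<noteq> c" for s x y b c
  proof -
    have tf: "e / 3 \<le> \<bar>\<phi> (T s) x - \<phi> (T s) y\<bar>"
      if "x \<in> X closure_of V (T s) True" "y \<in> X closure_of V (T s) False" for x y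
      using \<phi>V[of "T s"] T[of s] that by blast
    show ?thesis
      using that tf[of x y] tf[of y x] unfolding TC by (cases b; cases c) (simp_all add: abs_minus_commute)
  qed
  define pre where "pre \<sigma> n = rev (map \<sigma> [0..<n])" for \<sigma> :: "nat \<Rightarrow> bool" and n
  have preS: "pre \<sigma> (Suc n) = \<sigma> n # pre \<sigma> n" for \<sigma> n unfolding pre_def by simp
  have "\<exists>x. \<forall>n. x \<in> X closure_of T (pre \<sigma> n)" for \<sigma>
  proof -
    have "(\<Inter>n. X closure_of T (pre \<sigma> n)) \<noteq> {}"
    proof (rule compact_space_imp_nest[OF X])
      show "closedin X (X closure_of T (pre \<sigma> n))" for n by simp
      show "X closure_of T (pre \<sigma> n) \<noteq> {}" for n
        using T[of "pre \<sigma> n"] closure_of_subset[of "T (pre \<sigma> n)" X] openin_subset by blast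
      show "decseq (\<lambda>n. X closure_of T (pre \<sigma> n))"
        unfolding decseq_Suc_iff preS using sub by (intro allI closure_of_mono)
    qed
    then show ?thesis by blast
  qed
  then obtain x where x: "\<And>\<sigma> n. x \<sigma> \<in> X closure_of T (pre \<sigma> n)" by metis
  have sep: "\<exists>s. e / 3 \<le> \<bar>\<phi> (T s) (x \<sigma>) - \<phi> (T s) (x \<tau>)\<bar>" if ne: "\<sigma> \<noteq> \<tau>" for \<sigma> \<tau>
  proof -
    obtain m where "\<sigma> m \<noteq> \<tau> m" using ne by blast
    then obtain n where n: "\<sigma> n \<noteq> \<tau> n" "\<And>k. k < n \<Longrightarrow> \<sigma> k = \<tau> k"
      using exists_least_iff[of "\<lambda>n. \<sigma> n \<noteq> \<tau> n"] by blast
    have "pre \<sigma> n = pre \<tau> n" unfolding pre_def using n(2) by simp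
    then show ?thesis
      using apart[of "x \<sigma>" "\<sigma> n" "pre \<sigma> n" "x \<tau>" "\<tau> n"] x[of \<sigma> "Suc n"] x[of \<tau> "Suc n"] n(1)
      unfolding preS by auto
  qed
  have "inj x"
  proof (rule injI, rule ccontr)
    fix \<sigma> \<tau> assume "x \<sigma> = x \<tau>" "\<sigma> \<noteq> \<tau>"
    then show False using sep[of \<sigma> \<tau>] e by auto
  qed
  then have "uncountable (range x)"
    using uncountable_bool_sequences countable_image_inj_on by blast
  moreover have "range x \<subseteq> topspace X"
    using x closure_of_subset_topspace by fastforce
  moreover have "\<exists>f\<in>range (\<lambda>s. \<phi> (T s)). e / 3 \<le> \<bar>f u - f v\<bar>" if uv: "u \<in> range x" "v \<in> range x" "u \<noteq> v" for u v
  proof -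
    obtain \<sigma> \<tau> where "u = x \<sigma>" "v = x \<tau>" using uv(1,2) by blast
    then obtain s where "e / 3 \<le> \<bar>\<phi> (T s) u - \<phi> (T s) v\<bar>" using sep[of \<sigma> \<tau>] uv(3) by blast
    then show ?thesis by (intro bexI[of _ "\<phi> (T s)"]) auto
  qed
  moreover have "countable (range (\<lambda>s. \<phi> (T s)))" by simp
  moreover have "range (\<lambda>s. \<phi> (T s)) \<subseteq> F" using \<phi>F by blast
  ultimately show ?thesis
    using e by (intro exI[of _ "range (\<lambda>s. \<phi> (T s))"] exI[of _ "e / 3"] exI[of _ "range x"] conjI ballI impI) simp_all
qed

section \<open>Closed spans and restricted functionals\<close>

lemma banach_on_complete:
  assumes "banach_on V N" "\<And>n::nat. s n \<in> V" "\<forall>e>0. \<exists>M. \<forall>m\<ge>M. \<forall>n\<ge>M. N (s m - s n) < e"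
  shows "\<exists>v\<in>V. (\<lambda>n. N (s n - v)) \<longlonglongrightarrow> 0"
  using assms unfolding banach_on_def by simp

definition closed_span :: "'v::real_vector set \<Rightarrow> ('v \<Rightarrow> real) \<Rightarrow> 'v set \<Rightarrow> 'v set" where
  "closed_span V N B = {v \<in> V. \<forall>e>0. \<exists>s\<in>span B. N (v - s) < e}"

lemma norm_on_diff_triangle:
  assumes N: "norm_on V N" and uvw: "u \<in> V" "v \<in> V" "w \<in> V"
  shows "N (u - w) \<le> N (u - v) + N (v - w)"
proof -
  note s = norm_onD(1)[OF N]
  have "u - w = (u - v) + (v - w)" by simp
  then show ?thesis
    using norm_onD(5)[OF N subspace_diff[OF s uvw(1,2)] subspace_diff[OF s uvw(2,3)]] by simp
qed

lemma norm_on_diff_commute: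
  assumes N: "norm_on V N" and "u \<in> V" "v \<in> V"
  shows "N (u - v) = N (v - u)"
  using norm_on_minus[OF N subspace_diff[OF norm_onD(1)[OF N] assms(2,3)]] by simp

context
  fixes V :: "'v::real_vector set" and N B
  assumes banach: "banach_on V N" and BV: "B \<subseteq> V"
begin

lemma norm_V: "norm_on V N"
  using banach unfolding banach_on_def by blast

lemma span_subset_V: "span B \<subseteq> V"
  by (rule span_minimal[OF BV norm_onD(1)[OF norm_V]])

lemma span_subset_closed_span: "span B \<subseteq> closed_span V N B"
proof
  fix v assume v: "v \<in> span B"
  moreover have "N (v - v) = 0" using norm_on_zero[OF norm_V] by simp
  ultimately show "v \<in> closed_span V N B"
    unfolding closed_span_def using span_subset_V by (auto intro: bexI[of _ v])
qed

lemma closed_span_subset_V: "closed_span V N B \<subseteq> V"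
  unfolding closed_span_def by blast

lemma subspace_closed_span: "subspace (closed_span V N B)"
  unfolding subspace_def
proof (intro conjI ballI allI)
  note s = norm_onD(1)[OF norm_V]
  show "0 \<in> closed_span V N B" using span_subset_closed_span span_zero by blast
  fix v w assume vw: "v \<in> closed_span V N B" "w \<in> closed_span V N B"
  then have V: "v \<in> V" "w \<in> V" using closed_span_subset_V by auto
  have "\<exists>t\<in>span B. N (v + w - t) < e" if e: "0 < e" for e
  proof -
    obtain t where t: "t \<in> span B" "N (v - t) < e / 2"
      using vw(1) half_gt_zero[OF e] unfolding closed_span_def by blast
    obtain u where u: "u \<in> span B" "N (w - u) < e / 2"
      using vw(2) half_gt_zero[OF e] unfolding closed_span_def by blast
    have "v - t \<in> V" "w - u \<in> V" using t u V span_subset_V by (auto intro: subspace_diff[OF s])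
    then have "N ((v - t) + (w - u)) \<le> N (v - t) + N (w - u)" by (rule norm_onD(5)[OF norm_V])
    moreover have "(v - t) + (w - u) = v + w - (t + u)" by simp
    ultimately have "N (v + w - (t + u)) < e" using t u by simp
    then show ?thesis using span_add[OF t(1) u(1)] by blast
  qed
  then show "v + w \<in> closed_span V N B"
    unfolding closed_span_def using subspace_add[OF s V] by blast
next
  note s = norm_onD(1)[OF norm_V]
  fix c v assume v: "v \<in> closed_span V N B"
  then have V: "v \<in> V" using closed_span_subset_V by auto
  have "\<exists>t\<in>span B. N (c *\<^sub>R v - t) < e" if e: "0 < e" for e
  proof -
    have "0 < e / (1 + \<bar>c\<bar>)" using e by simp
    then obtain t where t: "t \<in> span B" "N (v - t) < e / (1 + \<bar>c\<bar>)"
      using v unfolding closed_span_def by blast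
    have vt: "v - t \<in> V" using t V span_subset_V by (auto intro: subspace_diff[OF s])
    have "N (c *\<^sub>R v - c *\<^sub>R t) = \<bar>c\<bar> * N (v - t)"
      using norm_onD(4)[OF norm_V vt] by (simp add: scaleR_diff_right)
    also have "\<dots> \<le> (1 + \<bar>c\<bar>) * N (v - t)"
      using norm_onD(2)[OF norm_V vt] by (intro mult_right_mono) auto
    also have "\<dots> < e" using t(2) by (simp add: field_simps)
    finally show ?thesis using span_scale[OF t(1)] by blast
  qed
  then show "c *\<^sub>R v \<in> closed_span V N B"
    unfolding closed_span_def using subspace_scale[OF s V] by blast
qed

lemma banach_on_closed_span: "banach_on (closed_span V N B) N"
  unfolding banach_on_def
proof (intro conjI allI impI; (elim conjE)?)
  let ?W = "closed_span V N B"
  show "norm_on ?W N"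
    using norm_onD[OF norm_V] closed_span_subset_V subspace_closed_span unfolding norm_on_def by (meson subsetD)
  fix s :: "nat \<Rightarrow> 'v"
  assume sW: "\<forall>n. s n \<in> ?W" and cauchy: "\<forall>e>0. \<exists>M. \<forall>m\<ge>M. \<forall>n\<ge>M. N (s m - s n) < e"
  have sV: "s n \<in> V" for n using sW closed_span_subset_V by blast
  obtain v where v: "v \<in> V" "(\<lambda>n. N (s n - v)) \<longlonglongrightarrow> 0"
    using banach_on_complete[OF banach sV cauchy] by (elim bexE)
  have "\<exists>t\<in>span B. N (v - t) < e" if e: "0 < e" for e
  proof -
    have "\<forall>\<^sub>F n in sequentially. N (s n - v) < e / 2"
      using order_tendstoD(2)[OF v(2), of "e / 2"] e by simp
    then obtain n where n: "N (s n - v) < e / 2"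
      using eventually_happens'[OF sequentially_bot] by blast
    obtain t where t: "t \<in> span B" "N (s n - t) < e / 2"
      using sW half_gt_zero[OF e] unfolding closed_span_def by blast
    have "t \<in> V" using t(1) span_subset_V by blast
    then have "N (v - t) \<le> N (v - s n) + N (s n - t)"
      by (rule norm_on_diff_triangle[OF norm_V v(1) sV])
    then show ?thesis using n t norm_on_diff_commute[OF norm_V v(1) sV, of n] by (intro bexI[of _ t]) auto
  qed
  then have "v \<in> ?W" unfolding closed_span_def using v(1) by blast
  with v(2) show "\<exists>v\<in>?W. (\<lambda>n. N (s n - v)) \<longlonglongrightarrow> 0" by (rule bexI)
qed

lemma norm_separable_closed_span:
  assumes "countable B"
  shows "norm_separable (closed_span V N B) N"
proof -
  note s = norm_onD(1)[OF norm_V]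
  define comb where "comb l = (\<Sum>(q, a)\<leftarrow>l. real_of_rat q *\<^sub>R a)" for l :: "(rat \<times> 'v) list"
  define D where "D = comb ` lists (UNIV \<times> B)"
  have "countable D" unfolding D_def using assms by (intro countable_image countable_lists) auto
  have comb_span: "comb l \<in> span B" if "l \<in> lists (UNIV \<times> B)" for l
    using that by (induction l) (auto simp: comb_def intro: span_add span_scale span_base span_zero)
  have "v \<in> V \<and> (\<forall>e>0. \<exists>d\<in>D. N (v - d) < e)" if "v \<in> span B" for v
    using that
  proof (induction rule: span_induct_alt)
    case base
    have "0 = comb []" unfolding comb_def by simp
    then have "0 \<in> D" unfolding D_def by blast
    then show ?case using norm_on_zero[OF norm_V] subspace_0[OF s] by (auto intro: bexI[of _ 0])
  next
    case (step c a y)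
    have aV: "a \<in> V" using step.hyps BV by blast
    have "\<exists>d\<in>D. N (c *\<^sub>R a + y - d) < e" if e: "0 < e" for e
    proof -
      obtain l where l: "l \<in> lists (UNIV \<times> B)" "N (y - comb l) < e / 2"
        using step.IH half_gt_zero[OF e] unfolding D_def by blast
      have Na: "0 \<le> N a" by (rule norm_onD(2)[OF norm_V aV])
      \<comment> \<open>The summand 1 avoids division by 0 and makes \<open>r * N a < e / 2\<close>
        strict.\<close>
      define r where "r = e / 2 / (1 + N a)"
      have r: "0 < r" "r * N a < e / 2"
        unfolding r_def using e Na by (auto simp: field_simps)
      obtain q where q: "c - r < real_of_rat q" "real_of_rat q < c"
        using of_rat_dense[of "c - r" c] r by auto
      have yV: "y - comb l \<in> V"
        using step.IH comb_span[OF l(1)] span_subset_V by (intro subspace_diff[OF s]) auto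
      have "(c *\<^sub>R a + y) - comb ((q, a) # l) = (c - real_of_rat q) *\<^sub>R a + (y - comb l)"
        unfolding comb_def by (simp add: scaleR_diff_left)
      then have "N ((c *\<^sub>R a + y) - comb ((q, a) # l)) \<le> N ((c - real_of_rat q) *\<^sub>R a) + N (y - comb l)"
        using norm_onD(5)[OF norm_V subspace_scale[OF s aV] yV] by metis
      also have "N ((c - real_of_rat q) *\<^sub>R a) = \<bar>c - real_of_rat q\<bar> * N a" by (rule norm_onD(4)[OF norm_V aV])
      also have "\<bar>c - real_of_rat q\<bar> * N a \<le> r * N a" using q Na by (intro mult_right_mono) auto
      finally have "N ((c *\<^sub>R a + y) - comb ((q, a) # l)) < e" using r(2) l(2) by linarith
      moreover have "(q, a) # l \<in> lists (UNIV \<times> B)" using l(1) step.hyps by auto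
      ultimately show ?thesis unfolding D_def by blast
    qed
    then show ?case using step.IH subspace_add[OF s subspace_scale[OF s aV]] by blast
  qed
  then have dense: "\<exists>d\<in>D. N (v - d) < e" if "v \<in> span B" "0 < e" for v e
    using that by blast
  have "\<exists>d\<in>D. N (v - d) < e" if v: "v \<in> closed_span V N B" and e: "0 < e" for v e
  proof -
    obtain t where t: "t \<in> span B" "N (v - t) < e / 2"
      using v half_gt_zero[OF e] unfolding closed_span_def by blast
    obtain d where d: "d \<in> D" "N (t - d) < e / 2" using dense[OF t(1) half_gt_zero[OF e]] by blast
    have "d \<in> V" "t \<in> V" "v \<in> V"
      using d(1) t(1) v comb_span span_subset_V closed_span_subset_V unfolding D_def by auto
    then have "N (v - d) \<le> N (v - t) + N (t - d)" by (intro norm_on_diff_triangle[OF norm_V])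
    then show ?thesis using t(2) d by (intro bexI[of _ d]) auto
  qed
  moreover have "D \<subseteq> closed_span V N B"
    using comb_span span_subset_closed_span unfolding D_def by blast
  ultimately show ?thesis using \<open>countable D\<close> unfolding norm_separable_def by blast
qed

end

lemma dual_on_bound:
  assumes N: "norm_on W N" and \<phi>: "\<phi> \<in> dual_on W N" and w: "w \<in> W"
  shows "\<bar>\<phi> w\<bar> \<le> dual_norm W N \<phi> * N w"
proof (cases "w = 0")
  case True
  then show ?thesis
    using linear_on_zero[OF norm_onD(1)[OF N]] \<phi> norm_on_zero[OF N] unfolding dual_on_def by auto
next
  case False
  have lin: "linear_on W \<phi>" using \<phi> unfolding dual_on_def by blast
  obtain C where C: "\<And>v. v \<in> W \<Longrightarrow> \<bar>\<phi> v\<bar> \<le> C * N v" using \<phi> unfolding dual_on_def by blast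
  have Nw: "0 < N w" using norm_onD(2,3)[OF N w] False by fastforce
  have bdd: "bdd_above ((\<lambda>v. \<bar>\<phi> v\<bar>) ` {v \<in> W. N v \<le> 1})"
  proof (rule bdd_aboveI2)
    fix v assume v: "v \<in> {v \<in> W. N v \<le> 1}"
    have "C * N v \<le> \<bar>C\<bar> * 1" using v norm_onD(2)[OF N] by (intro mult_mono) auto
    then show "\<bar>\<phi> v\<bar> \<le> \<bar>C\<bar>" using C v by fastforce
  qed
  have u: "(1 / N w) *\<^sub>R w \<in> {v \<in> W. N v \<le> 1}"
    using subspace_scale[OF norm_onD(1)[OF N] w] norm_onD(4)[OF N w] Nw by simp
  have "\<bar>\<phi> ((1 / N w) *\<^sub>R w)\<bar> \<le> dual_norm W N \<phi>"
    unfolding dual_norm_def by (rule cSUP_upper[OF u bdd])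
  moreover have "\<phi> ((1 / N w) *\<^sub>R w) = (1 / N w) *\<^sub>R \<phi> w" by (rule linear_onD(2)[OF lin w])
  ultimately show ?thesis using Nw by (simp add: abs_mult divide_le_eq)
qed

lemma dual_on_restrict:
  assumes "\<phi> \<in> dual_on V N" "W \<subseteq> V" and W: "subspace W"
  shows "(\<lambda>v. if v \<in> W then \<phi> v else 0) \<in> dual_on W N"
  unfolding dual_on_def mem_Collect_eq
proof (intro conjI allI impI)
  have lin: "linear_on V \<phi>" using assms(1) unfolding dual_on_def by blast
  show "linear_on W (\<lambda>v. if v \<in> W then \<phi> v else 0)"
    unfolding linear_on_def
    using assms(2) linear_onD[OF lin] subspace_add[OF W] subspace_scale[OF W] by (auto simp: subset_iff)
  show "\<exists>C. \<forall>v\<in>W. \<bar>if v \<in> W then \<phi> v else 0\<bar> \<le> C * N v"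
    using assms unfolding dual_on_def by auto
qed simp

lemma dual_on_diff:
  assumes N: "norm_on W N" and "\<phi> \<in> dual_on W N" "\<psi> \<in> dual_on W N"
  shows "\<phi> - \<psi> \<in> dual_on W N"
  unfolding dual_on_def mem_Collect_eq
proof (intro conjI allI impI)
  have lin: "linear_on W \<phi>" "linear_on W \<psi>" and off: "v \<notin> W \<Longrightarrow> \<phi> v = 0" "v \<notin> W \<Longrightarrow> \<psi> v = 0" for v
    using assms(2,3) unfolding dual_on_def by blast+
  show "(\<phi> - \<psi>) v = 0" if "v \<notin> W" for v using off[OF that] by simp
  show "linear_on W (\<phi> - \<psi>)"
    unfolding linear_on_def using linear_onD[OF lin(1)] linear_onD[OF lin(2)] by (simp add: algebra_simps)
  obtain C where C: "\<forall>v\<in>W. \<bar>\<phi> v\<bar> \<le> C * N v" using assms(2) unfolding dual_on_def by blast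
  obtain C' where C': "\<forall>v\<in>W. \<bar>\<psi> v\<bar> \<le> C' * N v" using assms(3) unfolding dual_on_def by blast
  have "\<bar>(\<phi> - \<psi>) v\<bar> \<le> (C + C') * N v" if "v \<in> W" for v
    using bspec[OF C that] bspec[OF C' that] by (simp add: distrib_right)
  then show "\<exists>C. \<forall>v\<in>W. \<bar>(\<phi> - \<psi>) v\<bar> \<le> C * N v" by blast
qed

text \<open>Up to the factor \<open>R\<close>, the claim is that the dual norm fragments
  \<open>\<alpha>\<close> on \<open>X\<close>: a common oscillation bound over a ball of vectors
  bounds the norm of differences of functionals.\<close>

lemma asplund_equifragmented:
  assumes asp: "asplund_on V N" and X: "compact_space X"
    and \<alpha>: "\<And>x. x \<in> topspace X \<Longrightarrow> \<alpha> x \<in> dual_on V N"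
    and cont: "\<And>v. v \<in> V \<Longrightarrow> continuous_map X euclideanreal (\<lambda>x. \<alpha> x v)"
    and R: "0 < R"
  shows "equifragmented X ((\<lambda>v x. \<alpha> x v) ` {v \<in> V. N v \<le> R})"
proof (rule ccontr)
  assume nfr: "\<not> ?thesis"
  have banach: "banach_on V N" using asp unfolding asplund_on_def by blast
  obtain D r Q where D: "countable D" "D \<subseteq> (\<lambda>v x. \<alpha> x v) ` {v \<in> V. N v \<le> R}" and r: "0 < r"
    and Q: "uncountable Q" "Q \<subseteq> topspace X"
    and sep: "\<forall>x\<in>Q. \<forall>y\<in>Q. x \<noteq> y \<longrightarrow> (\<exists>f\<in>D. r \<le> \<bar>f x - f y\<bar>)"
    using not_equifragmented_imp_uncountable_separated[OF X _ nfr] cont by fastforce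
  obtain B where B: "countable B" "B \<subseteq> {v \<in> V. N v \<le> R}" "D = (\<lambda>v x. \<alpha> x v) ` B"
    using D by (meson countable_subset_image)
  have BV: "B \<subseteq> V" using B(2) by blast
  define W where "W = closed_span V N B"
  have W: "W \<subseteq> V" "banach_on W N" "norm_separable W N" "B \<subseteq> W"
    unfolding W_def using closed_span_subset_V[OF banach BV] banach_on_closed_span[OF banach BV]
      norm_separable_closed_span[OF banach BV B(1)] span_subset_closed_span[OF banach BV] span_superset
    by blast+
  then have "norm_separable (dual_on W N) (dual_norm W N)"
    using asp unfolding asplund_on_def by blast
  then obtain E where E: "countable E" "E \<subseteq> dual_on W N"
    "\<forall>\<phi>\<in>dual_on W N. \<forall>e>0. \<exists>d\<in>E. dual_norm W N (\<phi> - d) < e"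
    unfolding norm_separable_def by blast
  have normW: "norm_on W N" using W(2) unfolding banach_on_def by blast
  define \<beta> where "\<beta> x = (\<lambda>v. if v \<in> W then \<alpha> x v else 0)" for x
  have \<beta>: "\<beta> x \<in> dual_on W N" if "x \<in> Q" for x
    unfolding \<beta>_def using \<alpha> that Q(2) W(1) norm_onD(1)[OF normW] by (intro dual_on_restrict[of _ V]) auto
  \<comment> \<open>On \<open>B\<close>, where norms are at most \<open>R\<close>, a functional and
    its approximant differ by at most \<open>r / 4\<close>. Two points with the same approximant
    would then be less than \<open>r\<close> apart on \<open>B\<close>.\<close>
  define \<delta> where "\<delta> = r / (4 * R)"
  have \<delta>: "0 < \<delta>" unfolding \<delta>_def using r R by simp
  have "\<forall>x\<in>Q. \<exists>d\<in>E. dual_norm W N (\<beta> x - d) < \<delta>" using E(3) \<beta> \<delta> by blast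
  then obtain d where d: "\<And>x. x \<in> Q \<Longrightarrow> d x \<in> E" "\<And>x. x \<in> Q \<Longrightarrow> dual_norm W N (\<beta> x - d x) < \<delta>" by metis
  have close: "\<bar>\<alpha> x v - d x v\<bar> \<le> r / 4" if x: "x \<in> Q" and v: "v \<in> B" for x v
  proof -
    have vW: "v \<in> W" and vR: "N v \<le> R" using v W(4) B(2) by auto
    have N0: "0 \<le> N v" by (rule norm_onD(2)[OF normW vW])
    have "\<beta> x - d x \<in> dual_on W N" using \<beta>[OF x] d(1)[OF x] E(2) by (intro dual_on_diff[OF normW]) auto
    then have "\<bar>(\<beta> x - d x) v\<bar> \<le> dual_norm W N (\<beta> x - d x) * N v" by (rule dual_on_bound[OF normW _ vW])
    also have "\<dots> \<le> \<delta> * R"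
      using d(2)[OF x] vR N0 \<delta> by (intro mult_mono) auto
    also have "\<dots> = r / 4" unfolding \<delta>_def using R by simp
    finally show ?thesis unfolding \<beta>_def using vW by simp
  qed
  have "inj_on d Q"
  proof (rule inj_onI, rule ccontr)
    fix x y assume xy: "x \<in> Q" "y \<in> Q" "d x = d y" "x \<noteq> y"
    then obtain v where v: "v \<in> B" "r \<le> \<bar>\<alpha> x v - \<alpha> y v\<bar>" using sep B(3) by blast
    then show False
      using close[OF xy(1) v(1)] close[OF xy(2) v(1)] r unfolding xy(3) by linarith
  qed
  moreover have "countable (d ` Q)" using E(1) d(1) by (meson countable_subset image_subsetI)
  ultimately show False using Q(1) countable_image_inj_on by blast
qed

text \<open>As \<open>h g\<close> is isometric, the orbit of the function given by \<open>v\<close>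
  consists of functions given by vectors of the same norm, and a ball of vectors is
  equifragmented.\<close>

lemma RN_in_imp_HNS:
  assumes "RN_in TYPE('v::real_vector) act X"
  shows "HNS act X"
proof -
  obtain V :: "'v set" and N h \<alpha> where X: "compact_G_system act X" and asp: "asplund_on V N"
    and h: "strongly_continuous_cohom V N h" and emb: "embedding_map X (weak_star V N) \<alpha>"
    and eq: "\<forall>g. \<forall>x\<in>topspace X. \<forall>v\<in>V. \<alpha> (act g x) v = \<alpha> x (h g v)"
    using assms unfolding RN_in_def by blast
  have \<alpha>c: "continuous_map X (weak_star V N) \<alpha>"
    using homeomorphic_imp_continuous_map[OF emb[unfolded embedding_map_def]]
    unfolding continuous_map_in_subtopology by blast
  then have \<alpha>d: "\<alpha> x \<in> dual_on V N" if "x \<in> topspace X" for x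
    using that unfolding weak_star_def continuous_map_in_subtopology by blast
  have cont: "continuous_map X euclideanreal (\<lambda>x. \<alpha> x v)" for v
    using \<alpha>c unfolding weak_star_def continuous_map_in_subtopology continuous_map_componentwise_UNIV by blast
  have hV: "h g v \<in> V" "N (h g v) = N v" if "v \<in> V" for g v
    using h that unfolding strongly_continuous_cohom_def Iso_on_def by (auto simp: bij_betw_def)
  define \<Phi> where "\<Phi> = (\<lambda>v x. \<alpha> x v) ` V"
  show ?thesis
  proof (rule HNS_of_functions[OF X, of \<Phi>])
    show "separating X \<Phi>"
      unfolding separating_def
    proof (intro conjI ballI impI)
      show "continuous_map X euclideanreal f" if "f \<in> \<Phi>" for f using that cont unfolding \<Phi>_def by blast
      fix x y assume xy: "x \<in> topspace X" "y \<in> topspace X" "x \<noteq> y"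
      have "inj_on \<alpha> (topspace X)"
        using emb unfolding embedding_map_def by (simp add: homeomorphic_eq_everything_map)
      then have "\<alpha> x \<noteq> \<alpha> y" using xy by (meson inj_onD)
      then obtain v where v: "\<alpha> x v \<noteq> \<alpha> y v" by blast
      then have "v \<in> V" using \<alpha>d[OF xy(1)] \<alpha>d[OF xy(2)] unfolding dual_on_def by force
      then have "(\<lambda>x. \<alpha> x v) \<in> \<Phi>" unfolding \<Phi>_def by (rule imageI)
      then show "\<exists>f\<in>\<Phi>. f x \<noteq> f y" using v by (intro bexI[of _ "\<lambda>x. \<alpha> x v"])
    qed
    fix f assume "f \<in> \<Phi>"
    then obtain v where v: "v \<in> V" "f = (\<lambda>x. \<alpha> x v)" unfolding \<Phi>_def by blast
    \<comment> \<open>The radius has to be positive, also for \<open>v = 0\<close>.\<close>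
    have "0 < \<bar>N v\<bar> + 1" by simp
    then have fr: "equifragmented X ((\<lambda>v x. \<alpha> x v) ` {w \<in> V. N w \<le> \<bar>N v\<bar> + 1})"
      using \<alpha>d cont by (intro asplund_equifragmented[OF asp compact_G_systemD(1)[OF X]])
    show "equifragmented X (orbit_functions act f)"
    proof (rule equifragmented_pullback[OF fr continuous_map_id[unfolded id_def]])
      fix u assume "u \<in> orbit_functions act f"
      then obtain g where g: "u = (\<lambda>x. \<alpha> (act g x) v)" unfolding orbit_functions_def v(2) by blast
      have "h g v \<in> {w \<in> V. N w \<le> \<bar>N v\<bar> + 1}" using hV[OF v(1)] by simp
      moreover have "\<forall>x\<in>topspace X. u x = \<alpha> x (h g v)" using eq v(1) unfolding g by blast
      ultimately show "\<exists>f\<in>(\<lambda>v x. \<alpha> x v) ` {w \<in> V. N w \<le> \<bar>N v\<bar> + 1}. \<forall>x\<in>topspace X. u x = f x"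
        by (intro bexI[of _ "\<lambda>x. \<alpha> x (h g v)"]) auto
    qed
  qed
qed

text \<open>Functions of a single coordinate separate the points of the product, and their orbits
  are pulled back from orbits in one factor.\<close>

lemma RN_app_in_imp_HNS:
  assumes "RN_app_in TYPE('i) TYPE('y) TYPE('v::real_vector) act X"
  shows "HNS act X"
proof -
  obtain I :: "'i set" and Y :: "'i \<Rightarrow> 'y topology" and a Z \<theta> where
    X: "compact_G_system act X" and RN: "\<forall>i\<in>I. RN_in TYPE('v) (a i) (Y i)"
    and \<theta>: "homeomorphic_map X (subtopology (product_topology Y I) Z) \<theta>"
    and eq: "\<forall>g. \<forall>x\<in>topspace X. \<theta> (act g x) = product_action I a g (\<theta> x)"
    using assms unfolding RN_app_in_def by blast
  have \<theta>c: "continuous_map X (product_topology Y I) \<theta>"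
    using homeomorphic_imp_continuous_map[OF \<theta>] unfolding continuous_map_in_subtopology by blast
  have inj: "inj_on \<theta> (topspace X)"
    using \<theta> by (simp add: homeomorphic_eq_everything_map)
  have comp: "continuous_map X (Y i) (\<lambda>x. \<theta> x i)" if "i \<in> I" for i
    using \<theta>c that unfolding continuous_map_componentwise by blast
  have Yi: "compact_G_system (a i) (Y i)" if "i \<in> I" for i
    using RN that unfolding RN_in_def by blast
  have ext: "\<theta> x \<in> extensional I" if "x \<in> topspace X" for x
    using \<theta>c that unfolding continuous_map_componentwise by blast
  define \<Phi> where "\<Phi> = {\<lambda>x. f (\<theta> x i) |f i. i \<in> I \<and> f \<in> continuous_functions (Y i)}"
  show ?thesis
  proof (rule HNS_of_functions[OF X, of \<Phi>])
    show "separating X \<Phi>"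
      unfolding separating_def
    proof (intro conjI ballI impI)
      fix u assume "u \<in> \<Phi>"
      then obtain f i where fi: "i \<in> I" "f \<in> continuous_functions (Y i)" "u = (\<lambda>x. f (\<theta> x i))"
        unfolding \<Phi>_def by blast
      then show "continuous_map X euclideanreal u"
        using continuous_map_compose[OF comp[OF fi(1)] continuous_functionsD[OF fi(2)]] by (simp add: o_def)
    next
      fix x y assume xy: "x \<in> topspace X" "y \<in> topspace X" "x \<noteq> y"
      then have "\<theta> x \<noteq> \<theta> y" using inj by (meson inj_onD)
      then obtain i where i: "i \<in> I" "\<theta> x i \<noteq> \<theta> y i"
        using ext[OF xy(1)] ext[OF xy(2)] by (meson extensionalityI)
      have "\<theta> x i \<in> topspace (Y i)" "\<theta> y i \<in> topspace (Y i)"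
        using comp[OF i(1)] xy by (auto simp: continuous_map_def)
      then obtain f where f: "f \<in> continuous_functions (Y i)" "f (\<theta> x i) \<noteq> f (\<theta> y i)"
        using separating_continuous_functions[OF compact_G_systemD(1,2)[OF Yi[OF i(1)]]] i(2)
        unfolding separating_def by metis
      then have "(\<lambda>x. f (\<theta> x i)) \<in> \<Phi>" unfolding \<Phi>_def using i(1) by blast
      then show "\<exists>f\<in>\<Phi>. f x \<noteq> f y" using f(2) by (intro bexI[of _ "\<lambda>x. f (\<theta> x i)"])
    qed
    fix u assume "u \<in> \<Phi>"
    then obtain f i where fi: "i \<in> I" "f \<in> continuous_functions (Y i)" "u = (\<lambda>x. f (\<theta> x i))"
      unfolding \<Phi>_def by blast
    have "HNS (a i) (Y i)" using RN fi(1) RN_in_imp_HNS by blast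
    then have fr: "equifragmented (Y i) (orbit_functions (a i) f)"
      using HNS_imp_equifragmented[OF Yi[OF fi(1)]] fi(2) by blast
    show "equifragmented X (orbit_functions act u)"
    proof (rule equifragmented_pullback[OF fr comp[OF fi(1)]])
      fix w assume "w \<in> orbit_functions act u"
      then obtain g where g: "w = (\<lambda>x. f (\<theta> (act g x) i))" unfolding orbit_functions_def fi(3) by blast
      have "w x = f (a i g (\<theta> x i))" if "x \<in> topspace X" for x
        unfolding g using eq that fi(1) by (simp add: product_action_def)
      then show "\<exists>f\<in>orbit_functions (a i) f. \<forall>x\<in>topspace X. w x = f (\<theta> x i)"
        unfolding orbit_functions_def by (intro bexI[of _ "\<lambda>y. f (a i g y)"]) auto
    qed
  qed
qed

section \<open>Hereditarily non-sensitive systems are approximable\<close>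

locale fragmented_orbit = G_system act X
  for act :: "'g::topological_group_add \<Rightarrow> 'x \<Rightarrow> 'x" and X :: "'x topology" +
  fixes f :: "'x \<Rightarrow> real"
  assumes continuous_f: "continuous_map X euclideanreal f"
    and fragmented: "equifragmented X (orbit_functions act f)"
begin

text \<open>The absolute value only serves to make \<open>gauge\<close> nonnegative off \<open>X\<close>. The square root puts every
  function \<open>x \<mapsto> f (g x)\<close> into the little Lipschitz space.\<close>

definition orbit_dist :: "'x \<Rightarrow> 'x \<Rightarrow> real" where
  "orbit_dist x y = (SUP g. \<bar>f (act g x) - f (act g y)\<bar>)"

definition gauge :: "'x \<Rightarrow> 'x \<Rightarrow> real" where
  "gauge x y = sqrt \<bar>orbit_dist x y\<bar>"

lemma orbit_dist_upper:
  assumes "x \<in> S" "y \<in> S"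
  shows "\<bar>f (act g x) - f (act g y)\<bar> \<le> orbit_dist x y"
proof -
  obtain b where b: "0 \<le> b" "\<And>x. x \<in> S \<Longrightarrow> \<bar>f x\<bar> \<le> b"
    using continuous_map_real_bounded[OF compact continuous_f] by blast
  have "\<bar>f (act g x) - f (act g y)\<bar> \<le> 2 * b" for g
    using b(2)[OF act_in[OF assms(1), of g]] b(2)[OF act_in[OF assms(2), of g]] by linarith
  then have "bdd_above (range (\<lambda>g. \<bar>f (act g x) - f (act g y)\<bar>))" by (intro bdd_aboveI2)
  then show ?thesis unfolding orbit_dist_def by (rule cSUP_upper[OF UNIV_I])
qed

lemma orbit_dist_least: "(\<And>g. \<bar>f (act g x) - f (act g y)\<bar> \<le> e) \<Longrightarrow> orbit_dist x y \<le> e"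
  unfolding orbit_dist_def by (rule cSUP_least) auto

lemma orbit_dist_nonneg: "x \<in> S \<Longrightarrow> y \<in> S \<Longrightarrow> 0 \<le> orbit_dist x y"
  using orbit_dist_upper[of x y 0] by linarith

lemma gauge_square: "x \<in> S \<Longrightarrow> y \<in> S \<Longrightarrow> orbit_dist x y = gauge x y * gauge x y"
  unfolding gauge_def using orbit_dist_nonneg by simp

lemma gauge_le:
  assumes "x \<in> S" "y \<in> S" "0 \<le> e" "\<And>g. \<bar>f (act g x) - f (act g y)\<bar> \<le> e * e"
  shows "gauge x y \<le> e"
proof -
  have "orbit_dist x y \<le> e\<^sup>2" using orbit_dist_least[OF assms(4)] by (simp add: power2_eq_square)
  then show ?thesis
    unfolding gauge_def using orbit_dist_nonneg[OF assms(1,2)] assms(3) by (simp add: real_le_lsqrt)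
qed

text \<open>The values at the translated points are those at \<open>x\<close> and \<open>y\<close>
  with \<open>g\<close> replaced by \<open>g + k\<close>, so they obey the same supremum.\<close>

lemma gauge_act:
  assumes "x \<in> S" "y \<in> S"
  shows "gauge (act k x) (act k y) \<le> gauge x y"
proof (rule gauge_le[OF act_in[OF assms(1)] act_in[OF assms(2)]])
  show "0 \<le> gauge x y" by (simp add: gauge_def)
  fix g
  have "\<bar>f (act (g + k) x) - f (act (g + k) y)\<bar> \<le> gauge x y * gauge x y"
    using orbit_dist_upper[OF assms] gauge_square[OF assms] by metis
  then show "\<bar>f (act g (act k x)) - f (act g (act k y))\<bar> \<le> gauge x y * gauge x y"
    using assms by (simp add: compact_G_systemD(5)[OF system])
qed

sublocale lip: fragmenting_gauge X gauge
proof
  show "compact_space X" by (rule compact)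
  show "0 \<le> gauge x y" for x y by (simp add: gauge_def)
  fix A and e :: real assume A: "A \<subseteq> S" "A \<noteq> {}" and e: "0 < e"
  \<comment> \<open>The square compensates the root in \<open>gauge\<close>.\<close>
  then have "0 < e * e" by simp
  then obtain U where U: "openin X U" "U \<inter> A \<noteq> {}"
    and small: "\<And>h x y. h \<in> orbit_functions act f \<Longrightarrow> x \<in> U \<inter> A \<Longrightarrow> y \<in> U \<inter> A \<Longrightarrow> \<bar>h x - h y\<bar> \<le> e * e"
    using equifragmentedD[OF fragmented A] by metis
  have "gauge x y \<le> e" if "x \<in> U \<inter> A" "y \<in> U \<inter> A" for x y
  proof (rule gauge_le)
    show "\<bar>f (act g x) - f (act g y)\<bar> \<le> e * e" for g
      using small[of "\<lambda>x. f (act g x)"] that unfolding orbit_functions_def by blast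
  qed (use that A e in auto)
  then show "\<exists>U. openin X U \<and> U \<inter> A \<noteq> {} \<and> (\<forall>x\<in>U \<inter> A. \<forall>y\<in>U \<inter> A. gauge x y \<le> e)"
    using U by blast
qed

section \<open>The isometric action on the little Lipschitz space\<close>

abbreviation "V \<equiv> little_lip X gauge"
abbreviation "N \<equiv> lip_norm X gauge"

text \<open>Composition with the action reverses products, which is why \<open>pull\<close> is a
  co-homomorphism.\<close>

definition pull :: "'g \<Rightarrow> ('x \<Rightarrow> real) \<Rightarrow> 'x \<Rightarrow> real" where
  "pull g v = (\<lambda>x. if x \<in> S then v (act g x) else 0)"

text \<open>Here the root pays off: the difference is at most \<open>gauge x y * gauge x y\<close>,
  so \<open>r = e\<close> serves in the little-o condition.\<close>

lemma pull_orbit_function: "pull g f \<in> V"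
  unfolding little_lip_def mem_Collect_eq
proof (intro conjI allI impI)
  have "continuous_map X euclideanreal (f \<circ> act g)"
    by (rule continuous_map_compose[OF continuous_act continuous_f])
  then show "continuous_map X euclideanreal (pull g f)"
    by (rule continuous_map_eq) (simp add: pull_def)
  show "pull g f x = 0" if "x \<notin> S" for x using that by (simp add: pull_def)
  fix e :: real assume e: "0 < e"
  have "\<bar>pull g f x - pull g f y\<bar> \<le> e * gauge x y" if xy: "x \<in> S" "y \<in> S" "gauge x y < e" for x y
  proof -
    have "\<bar>pull g f x - pull g f y\<bar> \<le> gauge x y * gauge x y"
      using orbit_dist_upper[OF xy(1,2), of g] gauge_square[OF xy(1,2)] xy(1,2) by (simp add: pull_def)
    also have "\<dots> \<le> e * gauge x y" using xy(3) lip.gauge_nonneg by (intro mult_right_mono) auto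
    finally show ?thesis .
  qed
  then show "\<exists>r>0. \<forall>x\<in>S. \<forall>y\<in>S. gauge x y < r \<longrightarrow> \<bar>pull g f x - pull g f y\<bar> \<le> e * gauge x y"
    using e by blast
qed

lemma pull_in:
  assumes v: "v \<in> V"
  shows "pull g v \<in> V"
  unfolding little_lip_def mem_Collect_eq
proof (intro conjI allI impI)
  have "continuous_map X euclideanreal (v \<circ> act g)"
    by (rule continuous_map_compose[OF continuous_act little_lipD(1)[OF v]])
  then show "continuous_map X euclideanreal (pull g v)"
    by (rule continuous_map_eq) (simp add: pull_def)
  show "pull g v x = 0" if "x \<notin> S" for x using that by (simp add: pull_def)
  fix e :: real assume e: "0 < e"
  obtain r where r: "r > 0" "\<forall>x\<in>S. \<forall>y\<in>S. gauge x y < r \<longrightarrow> \<bar>v x - v y\<bar> \<le> e * gauge x y"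
    using little_lipD(3)[OF v e] by blast
  have "\<bar>pull g v x - pull g v y\<bar> \<le> e * gauge x y" if xy: "x \<in> S" "y \<in> S" "gauge x y < r" for x y
  proof -
    note le = gauge_act[OF xy(1,2), of g]
    have "\<bar>v (act g x) - v (act g y)\<bar> \<le> e * gauge (act g x) (act g y)"
      using r(2) act_in[OF xy(1)] act_in[OF xy(2)] le xy(3) by auto
    also have "\<dots> \<le> e * gauge x y" using le e by simp
    finally show ?thesis using xy by (simp add: pull_def)
  qed
  then show "\<exists>r>0. \<forall>x\<in>S. \<forall>y\<in>S. gauge x y < r \<longrightarrow> \<bar>pull g v x - pull g v y\<bar> \<le> e * gauge x y"
    using r(1) by blast
qed

lemma pull_add:
  "pull (g + g') v = pull g' (pull g v)"
  unfolding pull_def using act_in compact_G_systemD(5)[OF system] by (auto simp: fun_eq_iff)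

lemma pull_zero:
  assumes "v \<in> V"
  shows "pull 0 v = v"
  unfolding pull_def using little_lipD(2)[OF assms] compact_G_systemD(4)[OF system] by (auto simp: fun_eq_iff)

lemma pull_norm_le:
  assumes v: "v \<in> V"
  shows "N (pull g v) \<le> N v"
proof (rule lip.lip_norm_le)
  note b = lip.lip_bound_norm[OF v]
  show "lip_bound X gauge (pull g v) (N v)"
    unfolding lip_bound_def
  proof (intro conjI ballI)
    show "0 \<le> N v" by (rule lip.lip_norm_nonneg[OF v])
    fix x assume x: "x \<in> S"
    show "\<bar>pull g v x\<bar> \<le> N v" using lip_boundD(2)[OF b act_in[OF x]] x by (simp add: pull_def)
    fix y assume y: "y \<in> S"
    have "\<bar>v (act g x) - v (act g y)\<bar> \<le> N v * gauge (act g x) (act g y)"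
      by (rule lip_boundD(3)[OF b act_in[OF x] act_in[OF y]])
    also have "\<dots> \<le> N v * gauge x y"
      by (rule mult_left_mono[OF gauge_act[OF x y] lip.lip_norm_nonneg[OF v]])
    finally show "\<bar>pull g v x - pull g v y\<bar> \<le> N v * gauge x y" using x y by (simp add: pull_def)
  qed
qed

text \<open>\<open>pull g\<close> and its inverse \<open>pull (- g)\<close> are both
  contractions.\<close>

lemma pull_Iso: "pull g \<in> Iso_on V N"
  unfolding Iso_on_def mem_Collect_eq
proof (intro conjI ballI)
  have inv: "pull (- g) (pull g v) = v" "pull g (pull (- g) v) = v" if "v \<in> V" for v g
    using pull_zero[OF that] pull_add[of g "- g" v] pull_add[of "- g" g v] by simp_all
  show "bij_betw (pull g) V V"
    by (rule bij_betw_byWitness[where f' = "pull (- g)"]) (use inv pull_in in auto)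
  show "linear_on V (pull g)"
    unfolding linear_on_def pull_def by (auto simp: fun_eq_iff scaleR_fun_def)
  fix v assume v: "v \<in> V"
  show "N (pull g v) = N v"
    using pull_norm_le[OF v, of g] pull_norm_le[OF pull_in[OF v], of "- g" g] inv(1)[OF v] by simp
qed

text \<open>Uniformity in \<open>x\<close> comes from the tube lemma around
  \<open>{g\<^sub>0} \<times> S\<close>.\<close>

lemma pull_uniformly_continuous:
  assumes v: "continuous_map X euclideanreal v" and \<eta>: "0 < (\<eta>::real)"
  shows "\<forall>\<^sub>F g in nhds g\<^sub>0. \<forall>x\<in>S. \<bar>v (act g x) - v (act g\<^sub>0 x)\<bar> < \<eta>"
proof -
  let ?P = "prod_topology euclidean X"
  have "continuous_map ?P euclideanreal (v \<circ> (\<lambda>(g, x). act g x))"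
    by (rule continuous_map_compose[OF compact_G_systemD(3)[OF system] v])
  moreover have "continuous_map ?P euclideanreal ((v \<circ> act g\<^sub>0) \<circ> snd)"
    by (intro continuous_map_compose[OF continuous_map_snd] continuous_map_compose[OF continuous_act v])
  ultimately have "continuous_map ?P euclideanreal
      (\<lambda>p. \<bar>(v \<circ> (\<lambda>(g, x). act g x)) p - ((v \<circ> act g\<^sub>0) \<circ> snd) p\<bar>)"
    by (intro continuous_map_real_abs continuous_map_diff)
  then have op: "openin ?P {p \<in> topspace ?P. \<bar>(v \<circ> (\<lambda>(g, x). act g x)) p - ((v \<circ> act g\<^sub>0) \<circ> snd) p\<bar> \<in> {..<\<eta>}}"
    (is "openin ?P ?W") by (rule openin_continuous_map_preimage) simp
  have "{g\<^sub>0} \<times> S \<subseteq> ?W" using \<eta> by auto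
  moreover have "compactin X S" using compact by (simp add: compact_space_def)
  ultimately obtain G O' where G: "openin euclidean G" "g\<^sub>0 \<in> G" "S \<subseteq> O'" "G \<times> O' \<subseteq> ?W"
    using tube_lemma_right[OF op, of S g\<^sub>0] by auto
  have "\<forall>x\<in>S. \<bar>v (act g x) - v (act g\<^sub>0 x)\<bar> < \<eta>" if "g \<in> G" for g
  proof
    fix x assume "x \<in> S"
    then have "(g, x) \<in> ?W" using G(3,4) that by blast
    then show "\<bar>v (act g x) - v (act g\<^sub>0 x)\<bar> < \<eta>" by simp
  qed
  then show ?thesis
    unfolding eventually_nhds using G(1,2) by (intro exI[of _ G]) auto
qed

text \<open>Two scales again: at small gauge both translates of \<open>v\<close> are flat, uniformly
  in the group element by \<open>gauge_act\<close>; at large gauge a uniformly small difference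
  suffices.\<close>

lemma pull_norm_continuous:
  assumes v: "v \<in> V"
  shows "((\<lambda>g. N (pull g v - pull g\<^sub>0 v)) \<longlongrightarrow> 0) (nhds g\<^sub>0)"
proof (rule tendstoI)
  fix e :: real assume "0 < e"
  then have e2: "0 < e / 2" and e4: "0 < e / 4" by auto
  obtain r where r: "r > 0" "\<forall>x\<in>S. \<forall>y\<in>S. gauge x y < r \<longrightarrow> \<bar>v x - v y\<bar> \<le> e / 4 * gauge x y"
    using little_lipD(3)[OF v e4] by blast
  \<comment> \<open>The first term gives the sup bound, the second a variation of at most
    \<open>e / 2 * r\<close> for pairs at distance at least \<open>r\<close>.\<close>
  define \<eta> where "\<eta> = min (e / 2) (e / 4 * r)"
  have \<eta>: "0 < \<eta>" "\<eta> \<le> e / 2" "2 * \<eta> \<le> e / 2 * r" unfolding \<eta>_def using \<open>0 < e\<close> r(1) by auto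
  have "\<forall>\<^sub>F g in nhds g\<^sub>0. \<forall>x\<in>S. \<bar>v (act g x) - v (act g\<^sub>0 x)\<bar> < \<eta>"
    by (rule pull_uniformly_continuous[OF little_lipD(1)[OF v] \<eta>(1)])
  then show "\<forall>\<^sub>F g in nhds g\<^sub>0. dist (N (pull g v - pull g\<^sub>0 v)) 0 < e"
  proof (rule eventually_mono)
    fix g assume g: "\<forall>x\<in>S. \<bar>v (act g x) - v (act g\<^sub>0 x)\<bar> < \<eta>"
    let ?u = "pull g v - pull g\<^sub>0 v"
    have uV: "?u \<in> V" by (intro subspace_diff[OF lip.subspace_little_lip] pull_in v)
    have u: "?u x = v (act g x) - v (act g\<^sub>0 x)" if "x \<in> S" for x
      using that by (simp add: pull_def)
    have "lip_bound X gauge ?u (e / 2)"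
      unfolding lip_bound_def
    proof (intro conjI ballI)
      show "0 \<le> e / 2" using e2 by simp
      fix x assume x: "x \<in> S"
      show "\<bar>?u x\<bar> \<le> e / 2" using bspec[OF g x] \<eta>(2) unfolding u[OF x] by linarith
      fix y assume y: "y \<in> S"
      show "\<bar>?u x - ?u y\<bar> \<le> e / 2 * gauge x y"
      proof (cases "gauge x y < r")
        case True
        have "\<bar>v (act k x) - v (act k y)\<bar> \<le> e / 4 * gauge x y" for k
        proof -
          have "gauge (act k x) (act k y) \<le> gauge x y" by (rule gauge_act[OF x y])
          then have "\<bar>v (act k x) - v (act k y)\<bar> \<le> e / 4 * gauge (act k x) (act k y)"
            using r(2) act_in[OF x] act_in[OF y] True by auto
          also have "\<dots> \<le> e / 4 * gauge x y" using gauge_act[OF x y] e4 by (intro mult_left_mono) auto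
          finally show ?thesis .
        qed
        from this[of g] this[of g\<^sub>0] show ?thesis unfolding u[OF x] u[OF y] by linarith
      next
        case False
        have "\<bar>?u x - ?u y\<bar> \<le> 2 * \<eta>" using bspec[OF g x] bspec[OF g y] unfolding u[OF x] u[OF y] by linarith
        also have "\<dots> \<le> e / 2 * r" by (rule \<eta>(3))
        also have "\<dots> \<le> e / 2 * gauge x y" using False e2 by (intro mult_left_mono) auto
        finally show ?thesis .
      qed
    qed
    then have "N ?u \<le> e / 2" by (rule lip.lip_norm_le)
    then show "dist (N ?u) 0 < e" using lip.lip_norm_nonneg[OF uV] \<open>0 < e\<close> by simp
  qed
qed

lemma strongly_continuous_pull: "strongly_continuous_cohom V N pull"
  unfolding strongly_continuous_cohom_def by (intro conjI allI ballI pull_Iso pull_add pull_norm_continuous)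

section \<open>Evaluation and the quotient system it embeds\<close>

definition eval :: "'x \<Rightarrow> ('x \<Rightarrow> real) \<Rightarrow> real" where
  "eval x v = (if v \<in> V then v x else 0)"

lemma eval_dual:
  assumes x: "x \<in> S"
  shows "eval x \<in> dual_on V N"
  unfolding dual_on_def mem_Collect_eq
proof (intro conjI allI impI)
  show "eval x v = 0" if "v \<notin> V" for v using that by (simp add: eval_def)
  show "linear_on V (eval x)"
    unfolding linear_on_def eval_def
    using subspace_add[OF lip.subspace_little_lip] subspace_scale[OF lip.subspace_little_lip]
    by (simp add: scaleR_fun_def)
  have "\<forall>v\<in>V. \<bar>eval x v\<bar> \<le> 1 * N v" using lip.abs_le_lip_norm[OF _ x] by (simp add: eval_def)
  then show "\<exists>C. \<forall>v\<in>V. \<bar>eval x v\<bar> \<le> C * N v" by (rule exI)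
qed

lemma continuous_eval: "continuous_map X (weak_star V N) eval"
  unfolding weak_star_def continuous_map_in_subtopology continuous_map_componentwise_UNIV
proof (intro conjI allI)
  show "continuous_map X euclideanreal (\<lambda>x. eval x v)" for v
    by (cases "v \<in> V") (simp_all add: eval_def little_lipD(1))
  show "eval \<in> S \<rightarrow> dual_on V N" using eval_dual by blast
qed

lemma Hausdorff_weak_star: "Hausdorff_space (weak_star V N)"
  unfolding weak_star_def by (simp add: Hausdorff_space_subtopology Hausdorff_space_product_topology)

text \<open>The points of the space at gauge 0 from \<open>x\<close>. Explicit classes keep the
  points of the quotient in \<open>'x set\<close>, the type fixed by \<open>RN_app\<close>.\<close>

definition same :: "'x \<Rightarrow> 'x set" where
  "same x = {y \<in> S. \<forall>g. f (act g x) = f (act g y)}"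

definition rep :: "'x set \<Rightarrow> 'x" where
  "rep c = (SOME y. y \<in> c)"

text \<open>Pulling back the weak-star topology along the injective evaluation makes the Hausdorff
  property and the embedding immediate. As a continuous image of \<open>X\<close>, the space is
  compact, so this is also the quotient topology.\<close>

definition quot :: "'x set topology" where
  "quot = pullback_topology (same ` S) (\<lambda>c. eval (rep c)) (weak_star V N)"

definition quot_act :: "'g \<Rightarrow> 'x set \<Rightarrow> 'x set" where
  "quot_act g c = same (act g (rep c))"

lemma in_same_iff: "y \<in> same x \<longleftrightarrow> y \<in> S \<and> (\<forall>g. f (act g x) = f (act g y))"
  by (simp add: same_def)

lemma rep_same:
  assumes "x \<in> S"
  shows "rep (same x) \<in> S" "f (act g (rep (same x))) = f (act g x)"
proof -
  have "x \<in> same x" using assms by (simp add: same_def)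
  then have "rep (same x) \<in> same x" unfolding rep_def by (rule someI)
  note r = this[unfolded in_same_iff]
  show "rep (same x) \<in> S" by (rule conjunct1[OF r])
  show "f (act g (rep (same x))) = f (act g x)" using conjunct2[OF r] by metis
qed

lemma same_eqI: "(\<And>g. f (act g x) = f (act g y)) \<Longrightarrow> same x = same y"
  unfolding same_def by simp

lemma same_act:
  assumes "x \<in> S"
  shows "quot_act g (same x) = same (act g x)"
  unfolding quot_act_def
proof (rule same_eqI)
  fix k
  have "f (act (k + g) (rep (same x))) = f (act (k + g) x)" by (rule rep_same(2)[OF assms])
  then show "f (act k (act g (rep (same x)))) = f (act k (act g x))"
    using assms rep_same(1)[OF assms] by (simp add: compact_G_systemD(5)[OF system])
qed

text \<open>Points of one class have gauge 0, where the Lipschitz bound leaves no difference to any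
  \<open>v\<close>; hence the chosen representative does not matter.\<close>

lemma eval_rep:
  assumes x: "x \<in> S"
  shows "eval (rep (same x)) = eval x"
proof
  fix v
  show "eval (rep (same x)) v = eval x v"
  proof (cases "v \<in> V")
    case True
    note r = rep_same[OF x]
    have "gauge (rep (same x)) x \<le> 0" using r by (intro gauge_le x) auto
    then have "gauge (rep (same x)) x = 0" using lip.gauge_nonneg[of "rep (same x)" x] by simp
    then have "\<bar>v (rep (same x)) - v x\<bar> \<le> 0"
      using lip_boundD(3)[OF lip.lip_bound_norm[OF True] r(1) x] by simp
    then show ?thesis using True by (simp add: eval_def)
  next
    case False
    then show ?thesis by (simp add: eval_def)
  qed
qed

text \<open>The functions \<open>pull g f\<close> lie in \<open>V\<close>, so evaluation recovers
  every \<open>f (act g x)\<close>.\<close>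

lemma eval_eq_imp_same_eq:
  assumes x: "x \<in> S" and y: "y \<in> S" and eq: "eval x = eval y"
  shows "same x = same y"
proof (rule same_eqI)
  fix g
  have "eval x (pull g f) = eval y (pull g f)" using eq by simp
  then show "f (act g x) = f (act g y)" using x y pull_orbit_function by (simp add: eval_def pull_def)
qed

lemma topspace_quot: "topspace quot = same ` S"
proof -
  have "topspace (weak_star V N) = dual_on V N" unfolding weak_star_def by simp
  then show ?thesis unfolding quot_def topspace_pullback_topology using eval_rep eval_dual by auto
qed

lemma continuous_same: "continuous_map X quot same"
  unfolding quot_def
proof (rule continuous_map_pullback')
  show "continuous_map X (weak_star V N) ((\<lambda>c. eval (rep c)) \<circ> same)"
    by (rule continuous_map_eq[OF continuous_eval]) (simp add: eval_rep)
qed auto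

lemma continuous_eval_rep: "continuous_map quot (weak_star V N) (\<lambda>c. eval (rep c))"
  using continuous_map_pullback[OF continuous_map_id[of "weak_star V N"]] unfolding quot_def by (simp add: o_def)

lemma inj_eval_rep: "inj_on (\<lambda>c. eval (rep c)) (topspace quot)"
  unfolding topspace_quot
proof (rule inj_onI; clarify)
  fix x y assume "x \<in> S" "y \<in> S" "eval (rep (same x)) = eval (rep (same y))"
  then show "same x = same y" using eval_rep eval_eq_imp_same_eq by metis
qed

lemma compact_quot: "compact_space quot"
proof -
  have "compactin quot (same ` S)"
    using compact continuous_same by (intro image_compactin) (auto simp: compact_space_def)
  then show ?thesis by (simp add: compact_space_def topspace_quot)
qed

lemma Hausdorff_quot: "Hausdorff_space quot"
  by (rule Hausdorff_space_injective_preimage[OF Hausdorff_weak_star continuous_eval_rep inj_eval_rep])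

lemma eval_rep_quot_act:
  assumes c: "c \<in> topspace quot" and v: "v \<in> V"
  shows "eval (rep (quot_act g c)) v = eval (rep c) (pull g v)"
proof -
  obtain x where x: "x \<in> S" "c = same x" using c unfolding topspace_quot by blast
  have "eval (rep (quot_act g c)) v = v (act g x)"
    using x v act_in by (simp add: same_act eval_rep) (simp add: eval_def)
  moreover have "eval (rep c) (pull g v) = v (act g x)"
    using x pull_in[OF v] by (simp add: eval_rep) (simp add: eval_def pull_def)
  ultimately show ?thesis by simp
qed

lemma quot_act_in: "c \<in> topspace quot \<Longrightarrow> quot_act g c \<in> topspace quot"
  unfolding topspace_quot using same_act act_in by auto

text \<open>Joint continuity is tested against each \<open>v\<close> in \<open>V\<close>: moving
  \<open>g0\<close> to \<open>g\<close> costs at most the norm of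
  \<open>pull g v - pull g0 v\<close>, uniformly in the point, and for fixed \<open>g0\<close> there
  remains evaluation at the single vector \<open>pull g0 v\<close>.\<close>

lemma quot_system: "compact_G_system quot_act quot"
  unfolding compact_G_system_def
proof (intro conjI compact_quot Hausdorff_quot ballI allI)
  let ?P = "prod_topology (euclidean :: 'g topology) quot"
  let ?F = "\<lambda>(g, c). quot_act g c"
  show "continuous_map ?P quot ?F"
    unfolding quot_def
  proof (rule continuous_map_pullback')
    show "topspace (prod_topology (euclidean :: 'g topology) (pullback_topology (same ` S) (\<lambda>c. eval (rep c)) (weak_star V N)))
        \<subseteq> ?F -` (same ` S)"
      unfolding quot_def[symmetric] using quot_act_in by (auto simp: topspace_quot)
    have "continuous_map ?P (weak_star V N) ((\<lambda>c. eval (rep c)) \<circ> ?F)"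
      unfolding weak_star_def continuous_map_in_subtopology continuous_map_componentwise_UNIV
    proof (intro conjI allI)
      show "(\<lambda>c. eval (rep c)) \<circ> ?F \<in> topspace ?P \<rightarrow> dual_on V N"
      proof
        fix p assume "p \<in> topspace ?P"
        then have "?F p \<in> topspace quot" using quot_act_in by auto
        then show "((\<lambda>c. eval (rep c)) \<circ> ?F) p \<in> dual_on V N"
          using eval_rep eval_dual unfolding topspace_quot by auto
      qed
      fix v
      show "continuous_map ?P euclideanreal (\<lambda>p. ((\<lambda>c. eval (rep c)) \<circ> ?F) p v)"
      proof (cases "v \<in> V")
        case False
        then show ?thesis by (simp add: eval_def)
      next
        case v: True
        have cont: "continuous_map quot euclideanreal (\<lambda>c. eval (rep c) u)" for u
          using continuous_eval_rep
          unfolding weak_star_def continuous_map_in_subtopology continuous_map_componentwise_UNIV by blast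
        have "continuous_map ?P Met_TC.mtopology (\<lambda>p. ((\<lambda>c. eval (rep c)) \<circ> ?F) p v)"
          unfolding Met_TC.continuous_map_to_metric
        proof (intro ballI allI impI)
          fix p and e :: real assume p: "p \<in> topspace ?P" and e: "0 < e"
          obtain g0 c0 where p0: "p = (g0, c0)" "c0 \<in> topspace quot" using p by auto
          have "\<forall>\<^sub>F g in nhds g0. N (pull g v - pull g0 v) < e / 2"
            using order_tendstoD(2)[OF pull_norm_continuous[OF v], of "e / 2"] e by simp
          then obtain G where G: "open G" "g0 \<in> G" "\<And>g. g \<in> G \<Longrightarrow> N (pull g v - pull g0 v) < e / 2"
            unfolding eventually_nhds by blast
          let ?O = "{c \<in> topspace quot. eval (rep c) (pull g0 v) \<in> ball (eval (rep c0) (pull g0 v)) (e / 2)}"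
          have O: "openin quot ?O" by (rule openin_continuous_map_preimage[OF cont]) simp
          have "openin ?P (G \<times> ?O)" using G(1) O by (simp add: openin_prod_Times_iff)
          moreover have "p \<in> G \<times> ?O" using p0 G(2) e by simp
          moreover have "((\<lambda>c. eval (rep c)) \<circ> ?F) z v \<in> Met_TC.mball (((\<lambda>c. eval (rep c)) \<circ> ?F) p v) e"
            if z: "z \<in> G \<times> ?O" for z
          proof -
            obtain g c where gc: "z = (g, c)" "g \<in> G" "c \<in> topspace quot"
              "\<bar>eval (rep c) (pull g0 v) - eval (rep c0) (pull g0 v)\<bar> < e / 2"
              using z by (auto simp: dist_real_def abs_minus_commute)
            obtain x where x: "x \<in> S" "c = same x" using gc(3) unfolding topspace_quot by blast
            have d: "pull g v - pull g0 v \<in> V"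
              by (intro subspace_diff[OF lip.subspace_little_lip] pull_in v)
            have "\<bar>(pull g v - pull g0 v) x\<bar> < e / 2"
              using lip.abs_le_lip_norm[OF d x(1)] G(3)[OF gc(2)] by simp
            moreover have "eval (rep c) (pull k v) = pull k v x" for k
              unfolding x(2) eval_rep[OF x(1)] using pull_in[OF v] by (simp add: eval_def)
            ultimately have "\<bar>eval (rep c) (pull g v) - eval (rep c) (pull g0 v)\<bar> < e / 2" by simp
            then have "\<bar>eval (rep c) (pull g v) - eval (rep c0) (pull g0 v)\<bar> < e"
              using gc(4) by linarith
            then show ?thesis
              unfolding gc(1) p0(1)
              by (simp add: eval_rep_quot_act[OF gc(3) v] eval_rep_quot_act[OF p0(2) v] dist_real_def abs_minus_commute)
          qed
          ultimately show "\<exists>U. openin ?P U \<and> p \<in> U \<and>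
              (\<forall>z\<in>U. ((\<lambda>c. eval (rep c)) \<circ> ?F) z v \<in> Met_TC.mball (((\<lambda>c. eval (rep c)) \<circ> ?F) p v) e)"
            by (intro exI[of _ "G \<times> ?O"] conjI ballI)
        qed
        then show ?thesis by simp
      qed
    qed
    then show "continuous_map (prod_topology (euclidean :: 'g topology) (pullback_topology (same ` S) (\<lambda>c. eval (rep c)) (weak_star V N)))
        (weak_star V N) ((\<lambda>c. eval (rep c)) \<circ> ?F)"
      unfolding quot_def .
  qed
  fix c assume "c \<in> topspace quot"
  then obtain x where x: "x \<in> S" "c = same x" unfolding topspace_quot by blast
  show "quot_act 0 c = c" using x same_act compact_G_systemD(4)[OF system] by simp
  show "quot_act (g + h) c = quot_act g (quot_act h c)" for g h
    using x same_act act_in compact_G_systemD(5)[OF system] by simp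
qed

lemma RN_quot: "RN_in TYPE('x \<Rightarrow> real) quot_act quot"
  unfolding RN_in_def
proof (intro conjI quot_system exI)
  show "asplund_on V N" by (rule lip.asplund_on_little_lip)
  show "strongly_continuous_cohom V N pull" by (rule strongly_continuous_pull)
  show "embedding_map quot (weak_star V N) (\<lambda>c. eval (rep c))"
    by (rule continuous_imp_embedding_map[OF continuous_eval_rep compact_quot Hausdorff_weak_star inj_eval_rep])
  show "\<forall>c\<in>topspace quot. dual_norm V N (eval (rep c)) \<le> 1"
  proof
    fix c assume "c \<in> topspace quot"
    then obtain x where x: "x \<in> S" "c = same x" unfolding topspace_quot by blast
    show "dual_norm V N (eval (rep c)) \<le> 1"
    proof (rule lip.dual_norm_le[OF lip.subspace_little_lip])
      fix w assume w: "w \<in> V" "N w \<le> 1"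
      then show "\<bar>eval (rep c) w\<bar> \<le> 1"
        using lip.abs_le_lip_norm[OF w(1) x(1)] unfolding x(2) eval_rep[OF x(1)] by (simp add: eval_def)
    qed
  qed
  show "\<forall>g. \<forall>c\<in>topspace quot. \<forall>v\<in>V. eval (rep (quot_act g c)) v = eval (rep c) (pull g v)"
    using eval_rep_quot_act by blast
qed

end

section \<open>Embedding into the product of the quotient systems\<close>

lemma HNS_imp_RN_app:
  fixes act :: "'g::topological_group_add \<Rightarrow> 'x \<Rightarrow> 'x"
  assumes X: "compact_G_system act X" and hns: "HNS act X"
  shows "RN_app act X"
proof -
  \<comment> \<open>One factor for each continuous function; the index set thus lives in the type
    \<open>'x \<Rightarrow> real\<close> fixed by \<open>RN_app\<close>.\<close>
  define I where "I = continuous_functions X"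
  define Y where "Y f = fragmented_orbit.quot act X f" for f
  define a where "a f = fragmented_orbit.quot_act act X f" for f
  define \<sigma> where "\<sigma> f = fragmented_orbit.same act X f" for f
  define \<theta> where "\<theta> x = (\<lambda>f\<in>I. \<sigma> f x)" for x
  have orb: "fragmented_orbit act X f" if "f \<in> I" for f
    using that X HNS_imp_equifragmented[OF X hns] unfolding I_def
    by unfold_locales auto
  have RN: "RN_in TYPE('x \<Rightarrow> real) (a f) (Y f)" if "f \<in> I" for f
    unfolding a_def Y_def by (rule fragmented_orbit.RN_quot[OF orb[OF that]])
  have \<sigma>: "continuous_map X (Y f) (\<sigma> f)" if "f \<in> I" for f
    unfolding \<sigma>_def Y_def by (rule fragmented_orbit.continuous_same[OF orb[OF that]])
  have \<theta>: "continuous_map X (product_topology Y I) \<theta>"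
    unfolding continuous_map_componentwise \<theta>_def using \<sigma> by auto
  have "Hausdorff_space (Y f)" if "f \<in> I" for f
    unfolding Y_def by (rule fragmented_orbit.Hausdorff_quot[OF orb[OF that]])
  then have Hprod: "Hausdorff_space (product_topology Y I)"
    by (simp add: Hausdorff_space_product_topology)
  have inj: "inj_on \<theta> (topspace X)"
  proof (rule inj_onI, rule ccontr)
    fix x y assume xy: "x \<in> topspace X" "y \<in> topspace X" "\<theta> x = \<theta> y" "x \<noteq> y"
    then obtain f where f: "f \<in> I" "f x \<noteq> f y"
      using separating_continuous_functions[OF compact_G_systemD(1,2)[OF X]] unfolding separating_def I_def by blast
    have "\<sigma> f x = \<sigma> f y" using fun_cong[OF xy(3), of f] f(1) unfolding \<theta>_def by simp
    moreover have "y \<in> \<sigma> f y" unfolding \<sigma>_def fragmented_orbit.same_def[OF orb[OF f(1)]] using xy(2) by simp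
    \<comment> \<open>Equality of classes, read at the neutral element, already contradicts the
      choice of \<open>f\<close>.\<close>
    ultimately have "f (act 0 x) = f (act 0 y)"
      unfolding \<sigma>_def fragmented_orbit.same_def[OF orb[OF f(1)]] by blast
    then show False using f(2) xy(1,2) compact_G_systemD(4)[OF X] by simp
  qed
  define Z where "Z = \<theta> ` topspace X"
  have "compactin (product_topology Y I) Z"
    unfolding Z_def using compact_G_systemD(1)[OF X] \<theta> by (intro image_compactin) (auto simp: compact_space_def)
  then have "closedin (product_topology Y I) Z" by (rule compactin_imp_closedin[OF Hprod])
  moreover have eq: "\<theta> (act g x) = product_action I a g (\<theta> x)" if x: "x \<in> topspace X" for g x
  proof
    fix f
    show "\<theta> (act g x) f = product_action I a g (\<theta> x) f"
      using fragmented_orbit.same_act[OF orb x, of f g] unfolding \<theta>_def product_action_def \<sigma>_def a_def by simp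
  qed
  moreover have "G_invariant (product_action I a) Z"
    unfolding G_invariant_def Z_def
  proof (intro allI ballI)
    fix g z assume "z \<in> \<theta> ` topspace X"
    then obtain x where x: "x \<in> topspace X" "z = \<theta> x" by blast
    then show "product_action I a g z \<in> \<theta> ` topspace X"
      using eq[OF x(1), of g] compact_G_system_act_in[OF X x(1), of g] by (metis imageI)
  qed
  moreover have "homeomorphic_map X (subtopology (product_topology Y I) Z) \<theta>"
    using continuous_imp_embedding_map[OF \<theta> compact_G_systemD(1)[OF X] Hprod inj] unfolding embedding_map_def Z_def .
  ultimately show ?thesis
    unfolding RN_app_in_def using X RN by blast
qed

text \<open>The conjuncts with arbitrary types \<open>'i\<close>, \<open>'y\<close> and
  \<open>'v\<close> justify the types fixed in \<open>RN_app\<close>: a representation over any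
  types gives HNS, and HNS gives one over the fixed types.\<close>

theorem theorem14p5:
  fixes act :: "'g::topological_group_add \<Rightarrow> 'x \<Rightarrow> 'x" and X :: "'x topology"
  assumes "compact_G_system act X"
  shows
    \<comment> \<open>the equivalence of HNS and RN-approximability asserted in (a) and in (d)\<close>
    "(HNS act X \<longleftrightarrow> RN_app act X) \<and>
     (RN_app_in TYPE('i) TYPE('y) TYPE('v::real_vector) act X \<longrightarrow> HNS act X) \<and>
     (HNS (enveloping_action act X) (enveloping_topology act X) \<longleftrightarrow>
        RN_app (enveloping_action act X) (enveloping_topology act X)) \<and>
     (RN_app_in TYPE('i) TYPE('y) TYPE('v) (enveloping_action act X) (enveloping_topology act X) \<longrightarrow>
        HNS (enveloping_action act X) (enveloping_topology act X)) \<and>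
     \<comment> \<open>part (1)\<close>
     ((HNS act X \<longleftrightarrow>
         fragmented_family X (compact_uniformity X) (range (translation act X))) \<and>
      (fragmented_family X (compact_uniformity X) (range (translation act X)) \<longleftrightarrow>
         fragmented_family X (compact_uniformity X) (enveloping_semigroup act X)) \<and>
      (fragmented_family X (compact_uniformity X) (enveloping_semigroup act X) \<longrightarrow>
         HNS (enveloping_action act X) (enveloping_topology act X)) \<and>
      (HNS (enveloping_action act X) (enveloping_topology act X) \<longleftrightarrow>
         F_semigroup (compose (topspace X)) (enveloping_topology act X))) \<and>
     \<comment> \<open>part (2)\<close>
     (point_transitive act X \<longrightarrow>
        (HNS act X \<longleftrightarrow>
           fragmented_family X (compact_uniformity X) (range (translation act X))) \<and>
        (fragmented_family X (compact_uniformity X) (range (translation act X)) \<longleftrightarrow>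
           fragmented_family X (compact_uniformity X) (enveloping_semigroup act X)) \<and>
        (fragmented_family X (compact_uniformity X) (enveloping_semigroup act X) \<longleftrightarrow>
           HNS (enveloping_action act X) (enveloping_topology act X)) \<and>
        (HNS (enveloping_action act X) (enveloping_topology act X) \<longleftrightarrow>
           F_semigroup (compose (topspace X)) (enveloping_topology act X)))"
proof -
  interpret G_system act X by unfold_locales (rule assms)
  have "HNS act X \<longleftrightarrow> RN_app act X" "HNS (enveloping_action act X) E \<longleftrightarrow> RN_app (enveloping_action act X) E"
    using HNS_imp_RN_app RN_app_in_imp_HNS system E_system by blast+
  moreover have "RN_app_in TYPE('i) TYPE('y) TYPE('v) act X \<longrightarrow> HNS act X"
    "RN_app_in TYPE('i) TYPE('y) TYPE('v) (enveloping_action act X) E \<longrightarrow> HNS (enveloping_action act X) E"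
    using RN_app_in_imp_HNS by blast+
  ultimately show ?thesis
    using HNS_iff_fragmented_translations[OF system] fragmented_translations_iff_E HNS_imp_HNS_E
      HNS_E_iff_F_semigroup point_transitive_HNS_E_imp_HNS by metis
qed

end
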